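(* Let $d\ge1$, let $\kappa$ be a regular cardinal (possibly $\kappa=\omega$), and let $\gamma_1,\gamma_2$ be ordinals with $\gamma_1\equiv\omega^\omega$, $\gamma_2\equiv\omega^\omega$ and $\operatorname{cf}(\gamma_1)=\operatorname{cf}(\gamma_2)=\kappa$. Then for every $q<\omega$ and every $d$-colored ordinal $\mathfrak A$ of order type $\gamma_1$ there exists a $d$-colored ordinal $\mathfrak B$ of order type $\gamma_2$ such that $\mathfrak A\equiv_q\mathfrak B$.
   Context: A $d$-colored ordinal is a structure $\mathfrak A=(A,<,C_0,\dots,C_{d-1})$ where $(A,<)$ is an ordinal (well-order) and the unary predicates $C_i$ partition $A$. $\mathfrak A\equiv_q\mathfrak B$ means agreement on all first-order sentences of quantifier rank at most $q$. For an ordinal $\gamma$, $\gamma\equiv\omega^\omega$ means that $(\gamma,<)$ and $(\omega^\omega,<)$ are elementarily equivalent as linear orders; equivalently, $\gamma\ge\omega^\omega$ and the Cantor normal form of $\gamma$ contains no term with finite exponent. $\operatorname{cf}$ denotes cofinality. *)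

theory Defs
  imports "HOL-Library.Disjoint_Sets" "HOL-Library.Multiset_Order"
begin

unbundle cardinal_syntax

text \<open>
  Following the library, an ordinal is a reflexive well-order relation \<open>r\<close> (predicate
  \<open>Well_order\<close>) taken up to the isomorphism \<open>=o\<close>; its universe is \<open>Field r\<close> and its strict
  order is \<open>(x, y) \<in> r \<and> x \<noteq> y\<close>.
\<close>

section \<open>First-order formulas over a colored linear order\<close>

datatype fm =
    Fls
  | Eq nat nat
  | Less nat nat
  | Color nat nat  \<comment> \<open>\<open>Color i x\<close>: variable \<open>x\<close> has color \<open>i\<close>\<close>
  | Neg fm
  | Conj fm fm
  | Exi nat fm

primrec free_vars :: "fm \<Rightarrow> nat set" where
  "free_vars Fls = {}"
| "free_vars (Eq x y) = {x, y}"
| "free_vars (Less x y) = {x, y}"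
| "free_vars (Color i x) = {x}"
| "free_vars (Neg \<phi>) = free_vars \<phi>"
| "free_vars (Conj \<phi> \<psi>) = free_vars \<phi> \<union> free_vars \<psi>"
| "free_vars (Exi x \<phi>) = free_vars \<phi> - {x}"

primrec colors_of :: "fm \<Rightarrow> nat set" where
  "colors_of Fls = {}"
| "colors_of (Eq x y) = {}"
| "colors_of (Less x y) = {}"
| "colors_of (Color i x) = {i}"
| "colors_of (Neg \<phi>) = colors_of \<phi>"
| "colors_of (Conj \<phi> \<psi>) = colors_of \<phi> \<union> colors_of \<psi>"
| "colors_of (Exi x \<phi>) = colors_of \<phi>"

primrec qrank :: "fm \<Rightarrow> nat" where
  "qrank Fls = 0"
| "qrank (Eq x y) = 0"
| "qrank (Less x y) = 0"
| "qrank (Color i x) = 0"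
| "qrank (Neg \<phi>) = qrank \<phi>"
| "qrank (Conj \<phi> \<psi>) = max (qrank \<phi>) (qrank \<psi>)"
| "qrank (Exi x \<phi>) = Suc (qrank \<phi>)"

definition sentence :: "nat \<Rightarrow> fm \<Rightarrow> bool" where
  "sentence d \<phi> \<longleftrightarrow> free_vars \<phi> = {} \<and> colors_of \<phi> \<subseteq> {..<d}"

record 'a colored =
  ord :: "'a rel"
  color :: "nat \<Rightarrow> 'a set"

primrec sat :: "'a colored \<Rightarrow> (nat \<Rightarrow> 'a) \<Rightarrow> fm \<Rightarrow> bool" where
  "sat \<AA> s Fls \<longleftrightarrow> False"
| "sat \<AA> s (Eq x y) \<longleftrightarrow> s x = s y"
| "sat \<AA> s (Less x y) \<longleftrightarrow> (s x, s y) \<in> ord \<AA> \<and> s x \<noteq> s y"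
| "sat \<AA> s (Color i x) \<longleftrightarrow> s x \<in> color \<AA> i"
| "sat \<AA> s (Neg \<phi>) \<longleftrightarrow> \<not> sat \<AA> s \<phi>"
| "sat \<AA> s (Conj \<phi> \<psi>) \<longleftrightarrow> sat \<AA> s \<phi> \<and> sat \<AA> s \<psi>"
| "sat \<AA> s (Exi x \<phi>) \<longleftrightarrow> (\<exists>a \<in> Field (ord \<AA>). sat \<AA> (s(x := a)) \<phi>)"

text \<open>Used for sentences only, whose truth value does not depend on the assignment.\<close>

definition models :: "'a colored \<Rightarrow> fm \<Rightarrow> bool" where
  "models \<AA> \<phi> \<longleftrightarrow> (\<forall>s. sat \<AA> s \<phi>)"

definition equiv_upto :: "nat \<Rightarrow> nat \<Rightarrow> 'a colored \<Rightarrow> 'b colored \<Rightarrow> bool" where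
  "equiv_upto d q \<AA> \<BB> \<longleftrightarrow>
    (\<forall>\<phi>. sentence d \<phi> \<and> qrank \<phi> \<le> q \<longrightarrow> (models \<AA> \<phi> \<longleftrightarrow> models \<BB> \<phi>))"

section \<open>Colored ordinals\<close>

text \<open>Color classes may be empty. Only the colors below \<open>d\<close> belong to the structure.\<close>

definition colored_ordinal :: "nat \<Rightarrow> 'a colored \<Rightarrow> bool" where
  "colored_ordinal d \<AA> \<longleftrightarrow> Well_order (ord \<AA>) \<and>
    disjoint_family_on (color \<AA>) {..<d} \<and> (\<Union>i<d. color \<AA> i) = Field (ord \<AA>)"

section \<open>Elementary equivalence of linear orders\<close>

definition elem_equiv :: "'a rel \<Rightarrow> 'b rel \<Rightarrow> bool" where
  "elem_equiv r r' \<longleftrightarrow> (\<forall>\<phi>. sentence 0 \<phi> \<longrightarrow>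
    (models \<lparr>ord = r, color = \<lambda>_. {}\<rparr> \<phi> \<longleftrightarrow> models \<lparr>ord = r', color = \<lambda>_. {}\<rparr> \<phi>))"

text \<open>
  The ordinal power \<open>\<omega>\<^sup>\<omega>\<close>: finitely supported functions compared at the largest argument
  where they differ, \<open>f\<close> standing for the Cantor normal form with coefficient \<open>f n\<close> at the
  exponent \<open>n\<close>.
\<close>

definition omega_omega :: "(nat \<Rightarrow> nat) rel" where
  "omega_omega = {(f, g). finite {n. f n \<noteq> 0} \<and> finite {n. g n \<noteq> 0} \<and>
    (f = g \<or> (\<exists>n. f n < g n \<and> (\<forall>m>n. f m = g m)))}"

lemma Field_omega_omega: "Field omega_omega = {f. finite {n. f n \<noteq> 0}}"
  unfolding Field_def omega_omega_def by auto

lemma Well_order_omega_omega: "Well_order omega_omega"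
proof -
  let ?F = "{f :: nat \<Rightarrow> nat. finite {n. f n \<noteq> 0}}"
  have tot: "f = g \<or> (f, g) \<in> omega_omega \<or> (g, f) \<in> omega_omega"
    if "f \<in> ?F" "g \<in> ?F" for f g
  proof (cases "f = g")
    case False
    let ?D = "{n. f n \<noteq> g n}"
    have fin: "finite ?D"
      by (rule finite_subset[of _ "{n. f n \<noteq> 0} \<union> {n. g n \<noteq> 0}"]) (use that in auto)
    have "?D \<noteq> {}" using False by auto
    with fin have "Max ?D \<in> ?D" by (rule Max_in)
    moreover have "\<forall>m>Max ?D. m \<notin> ?D" using Max_ge[OF fin] by (meson not_le)
    ultimately obtain n where n: "f n \<noteq> g n" "\<forall>m>n. f m = g m" by blast
    show ?thesis
    proof (cases "f n" "g n" rule: linorder_cases)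
      case less
      then have "(f, g) \<in> omega_omega" using that n(2) unfolding omega_omega_def by blast
      then show ?thesis by blast
    next
      case greater
      have "\<forall>m>n. g m = f m" using n(2) by metis
      then have "(g, f) \<in> omega_omega" using greater that unfolding omega_omega_def by blast
      then show ?thesis by blast
    qed (use n(1) in blast)
  qed simp
  have tr: "trans omega_omega"
  proof (rule transI)
    fix f g h assume a: "(f, g) \<in> omega_omega" "(g, h) \<in> omega_omega"
    show "(f, h) \<in> omega_omega"
    proof (cases "f = g \<or> g = h")
      case False
      then obtain n k where "f n < g n" "\<forall>m>n. f m = g m" "g k < h k" "\<forall>m>k. g m = h m"
        using a unfolding omega_omega_def by auto
      moreover from this have "f (max n k) < h (max n k)"
        by (cases n k rule: linorder_cases) (metis max.absorb4 max.absorb3 max.idem less_trans)+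
      moreover from calculation have "\<forall>m>max n k. f m = h m"
        by (metis max_less_iff_conj)
      ultimately have "\<exists>n. f n < h n \<and> (\<forall>m>n. f m = h m)" by blast
      then show ?thesis using a unfolding omega_omega_def by blast
    qed (use a in auto)
  qed
  have anti: "antisym omega_omega"
  proof (rule antisymI, rule ccontr)
    fix f g assume a: "(f, g) \<in> omega_omega" "(g, f) \<in> omega_omega" "f \<noteq> g"
    then obtain n k where "f n < g n" "\<forall>m>n. f m = g m" "g k < f k" "\<forall>m>k. g m = f m"
      unfolding omega_omega_def by auto
    then show False by (metis less_asym less_irrefl linorder_neqE_nat)
  qed
  have "omega_omega - Id \<subseteq> inv_image {(M, N :: nat multiset). M < N} Abs_multiset"
  proof (rule subrelI)
    fix f g assume "(f, g) \<in> omega_omega - Id"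
    then obtain n where n: "f n < g n" "\<forall>m>n. f m = g m"
      and fin: "finite {n. f n \<noteq> 0}" "finite {n. g n \<noteq> 0}"
      unfolding omega_omega_def by blast
    have cnt: "count (Abs_multiset f) = f" "count (Abs_multiset g) = g"
      using fin by (simp_all add: Abs_multiset_inverse)
    have "Abs_multiset f < Abs_multiset g"
    proof (unfold less_multiset\<^sub>H\<^sub>O cnt, intro conjI allI impI)
      show "Abs_multiset f \<noteq> Abs_multiset g" using cnt n(1) by (metis less_irrefl)
      fix y assume "g y < f y"
      then have "y < n" using n by (cases y n rule: linorder_cases) auto
      then show "\<exists>x>y. f x < g x" using n(1) by blast
    qed
    then show "(f, g) \<in> inv_image {(M, N :: nat multiset). M < N} Abs_multiset" by simp
  qed
  then have "wf (omega_omega - Id)"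
    by (rule wf_subset[rotated]) (intro wf_inv_image wf_less_multiset)
  then show ?thesis
    using tot tr anti
    unfolding well_order_on_def linear_order_on_def partial_order_on_def preorder_on_def
      refl_on_def total_on_def Field_omega_omega
    by (auto simp: omega_omega_def simp del: neq0_conv)
qed

section \<open>Cofinality\<close>

text \<open>
  Unlike the library's strict \<open>cofinal\<close>, this notion is also meaningful for successor
  ordinals. The two agree on orders without a greatest element.
\<close>

definition cofinal_subset :: "'a set \<Rightarrow> 'a rel \<Rightarrow> bool" where
  "cofinal_subset K r \<longleftrightarrow> K \<subseteq> Field r \<and> (\<forall>a \<in> Field r. \<exists>b \<in> K. (a, b) \<in> r)"

text \<open>
  \<open>\<kappa>\<close> is the least cardinality of a cofinal subset, a cardinal being given as in the library
  by a \<open>Card_order\<close> up to \<open>=o\<close>.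
\<close>

definition has_cofinality :: "'a rel \<Rightarrow> 'k rel \<Rightarrow> bool" where
  "has_cofinality r \<kappa> \<longleftrightarrow> Card_order \<kappa> \<and>
    (\<exists>K. cofinal_subset K r \<and> |K| =o \<kappa>) \<and> (\<forall>K. cofinal_subset K r \<longrightarrow> \<kappa> \<le>o |K| )"

end

(*
  The q-type of a colored order is determined recursively by the set of triples (color of a, type of
  the part below a, type of the part above a); types of rank q form a finite set and admit ordered
  sums, in particular a product and omega-products.  Let E_n be the set of types of colorings of
  omega^n.  Then E_{n+1} consists of the omega-products of elements of E_n, and by finiteness this
  sequence becomes constant, with value E say; E is closed under products and omega-products.

  Every sum of types from E over any nonempty well-order lies in E: by a Loewenheim-Skolem argument
  the index set may be taken countable, where induction on the well-order applies.  Conversely,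
  iterating Ramsey's theorem and using that powers in the semigroup of first-order types stabilize,
  every e in E factors as a t b with t = t t = t^omega, so that t is equal to all its well-ordered
  powers.  Hence any multiple of omega^n with a last omega^n-block, however large, realizes exactly
  the types in E (color the first block by a t, the last one by b, all others by t).

  An ordinal elementarily equivalent to omega^omega is a multiple of omega^n for every n.  Cutting
  two such ordinals of cofinality kappa into kappa many pieces that each have a last omega^n-block,
  one can replace the coloring piece by piece.
*)
theory Submission
  imports Defs "HOL-Library.Ramsey" "HOL-Library.Nat_Bijection" "HOL-Library.Countable_Set"
begin

text \<open>Finiteness alone makes the sequence \<open>E_n\<close> eventually periodic. Constancy
  comes from absorption: since omega^n + omega^m = omega^m for n < m, also
  \<open>E_n E_m = E_m\<close>; on the periodic part this holds for all pairs of indices, and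
  regrouping (ab)(ab)... as a(ba)(ba)... then turns the omega-products of \<open>E_(i+1)\<close>
  back into \<open>E_(i+1)\<close>.

  The obstacle is the number of blocks. Two pieces to be matched may consist of different,
  arbitrarily large well-ordered numbers of blocks, so a coloring cannot be copied block by block.
  The filler type t has to survive all well-ordered sums, and for this it must be fixed by the
  product and by the omega-power. Ramsey's theorem yields only t t = t. The equation t^omega = t is
  found on a cycle of iterated Ramsey factorizations, with the help of aperiodicity: quantifier rank
  q cannot tell apart exponents from 2^q - 1 on.

  A piece ends with a last block because the right factor b needs a place there.\<close>

section \<open>Types of colored orders\<close>

text \<open>
  Types are encoded as natural numbers so that they can be compared across structures of different
  HOL types. Colors are cut off at \<open>d\<close>: this keeps the encoded sets finite, and \<^term>\<open>set_encode\<close> is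
  injective only on finite sets.
\<close>

primrec tp :: "nat \<Rightarrow> ('a \<Rightarrow> 'a \<Rightarrow> bool) \<Rightarrow> ('a \<Rightarrow> nat) \<Rightarrow> nat \<Rightarrow> 'a set \<Rightarrow> nat" where
  "tp d lt c 0 X = 0"
| "tp d lt c (Suc q) X = set_encode ((\<lambda>a. prod_encode (min (c a) d,
     prod_encode (tp d lt c q {x \<in> X. lt x a}, tp d lt c q {x \<in> X. lt a x}))) ` X)"

text \<open>Equal profiles mean that the two points are matching moves of an Ehrenfeucht-Fraisse
  game with \<open>q\<close> rounds left after them.\<close>

definition profile :: "nat \<Rightarrow> ('a \<Rightarrow> 'a \<Rightarrow> bool) \<Rightarrow> ('a \<Rightarrow> nat) \<Rightarrow> nat \<Rightarrow> 'a set \<Rightarrow> 'a \<Rightarrow> nat" where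
  "profile d lt c q X a = prod_encode (min (c a) d,
     prod_encode (tp d lt c q {x \<in> X. lt x a}, tp d lt c q {x \<in> X. lt a x}))"

lemma tp_Suc: "tp d lt c (Suc q) X = set_encode (profile d lt c q X ` X)"
  by (simp add: profile_def)

lemma profile_eq_iff:
  "profile d lt c q X a = profile d lt' c' q Y b \<longleftrightarrow> min (c a) d = min (c' b) d \<and>
    tp d lt c q {x \<in> X. lt x a} = tp d lt' c' q {x \<in> Y. lt' x b} \<and>
    tp d lt c q {x \<in> X. lt a x} = tp d lt' c' q {x \<in> Y. lt' b x}"
  by (auto simp: profile_def)

text \<open>A finite superset of the possible codes, uniform in the structure and its carrier type.
  The pigeonhole and Ramsey arguments rest on it.\<close>

primrec tp_range :: "nat \<Rightarrow> nat \<Rightarrow> nat set" where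
  "tp_range d 0 = {0}"
| "tp_range d (Suc q) = set_encode ` Pow ((\<lambda>(k, l, r). prod_encode (k, prod_encode (l, r))) `
     ({..d} \<times> tp_range d q \<times> tp_range d q))"

lemma finite_tp_range: "finite (tp_range d q)"
  by (induction q) auto

lemma tp_in_tp_range: "tp d lt c q X \<in> tp_range d q"
proof (induction q arbitrary: X)
  case (Suc q)
  have "profile d lt c q X ` X \<subseteq> (\<lambda>(k, l, r). prod_encode (k, prod_encode (l, r))) `
     ({..d} \<times> tp_range d q \<times> tp_range d q)"
    unfolding profile_def by (intro image_subsetI, rule rev_image_eqI[where x = "(_, _, _)"]) (auto simp: Suc)
  then show ?case unfolding tp_Suc tp_range.simps by blast
qed simp

lemma finite_profile: "finite (profile d lt c q X ` X)"
proof (rule finite_subset)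
  show "profile d lt c q X ` X \<subseteq> (\<lambda>(k, l, r). prod_encode (k, prod_encode (l, r))) `
     ({..d} \<times> tp_range d q \<times> tp_range d q)"
    unfolding profile_def by (intro image_subsetI, rule rev_image_eqI[where x = "(_, _, _)"]) (auto simp: tp_in_tp_range)
qed (simp add: finite_tp_range)

lemma tp_Suc_eq_iff:
  "tp d lt c (Suc q) X = tp d lt' c' (Suc q) Y \<longleftrightarrow> profile d lt c q X ` X = profile d lt' c' q Y ` Y"
  unfolding tp_Suc
  by (metis finite_profile inj_on_set_encode inj_on_eq_iff mem_Collect_eq)

lemma tp_SucE:
  assumes "tp d lt c (Suc q) X = tp d lt' c' (Suc q) Y" "a \<in> X"
  obtains b where "b \<in> Y" "profile d lt c q X a = profile d lt' c' q Y b"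
  using assms unfolding tp_Suc_eq_iff by (metis image_iff)

lemma tp_Suc_eqD: "tp d lt c (Suc q) X = tp d lt' c' (Suc q) Y \<Longrightarrow> tp d lt c q X = tp d lt' c' q Y"
proof (induction q arbitrary: X Y)
  case (Suc q)
  have step: "profile d lt c q X a = profile d lt' c' q Y b"
    if "profile d lt c (Suc q) X a = profile d lt' c' (Suc q) Y b" for a b
    using that Suc.IH unfolding profile_eq_iff by blast
  have "profile d lt c q X ` X = profile d lt' c' q Y ` Y"
  proof (intro subset_antisym image_subsetI)
    fix a assume "a \<in> X"
    then obtain b where "b \<in> Y" "profile d lt c (Suc q) X a = profile d lt' c' (Suc q) Y b"
      using tp_SucE[OF Suc.prems] by metis
    with step show "profile d lt c q X a \<in> profile d lt' c' q Y ` Y" by simp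
  next
    fix b assume "b \<in> Y"
    then obtain a where "a \<in> X" "profile d lt' c' (Suc q) Y b = profile d lt c (Suc q) X a"
      using tp_SucE[OF Suc.prems[symmetric]] by metis
    with step[of a b] show "profile d lt' c' q Y b \<in> profile d lt c q X ` X" by (metis image_eqI)
  qed
  then show ?case unfolding tp_Suc_eq_iff .
qed simp

lemma tp_eq_le:
  assumes "tp d lt c q X = tp d lt' c' q Y" "q' \<le> q"
  shows "tp d lt c q' X = tp d lt' c' q' Y"
  using assms(2,1) by (induction rule: inc_induct) (auto intro: tp_Suc_eqD simp del: tp.simps)

lemma tp_empty: "tp d lt c q {} = tp d lt' c' q {}"
  by (cases q) simp_all

text \<open>Only points of distinct summands are constrained. The order inside a summand stays
  arbitrary, and shrinking summands, even to the empty set, keeps the property with the same index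
  set.\<close>

definition ordered_sum :: "('a \<Rightarrow> 'a \<Rightarrow> bool) \<Rightarrow> ('i \<Rightarrow> 'i \<Rightarrow> bool) \<Rightarrow> 'i set \<Rightarrow> ('i \<Rightarrow> 'a set) \<Rightarrow> bool" where
  "ordered_sum lt il I X \<longleftrightarrow>
    (\<forall>i\<in>I. \<forall>j\<in>I. i \<noteq> j \<longrightarrow> (\<forall>x\<in>X i. \<forall>y\<in>X j. lt x y \<longleftrightarrow> il i j))"

lemma ordered_sumD:
  "ordered_sum lt il I X \<Longrightarrow> i \<in> I \<Longrightarrow> j \<in> I \<Longrightarrow> i \<noteq> j \<Longrightarrow> x \<in> X i \<Longrightarrow> y \<in> X j \<Longrightarrow> lt x y \<longleftrightarrow> il i j"
  unfolding ordered_sum_def by blast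

lemma ordered_sum_mono:
  assumes "ordered_sum lt il I X" "J \<subseteq> I" "\<And>i. i \<in> J \<Longrightarrow> Z i \<subseteq> X i"
  shows "ordered_sum lt il J Z"
  using assms unfolding ordered_sum_def by (meson subsetD)

text \<open>The cut is written as a sum over all of \<open>I\<close>, with empty summands at the
  indices that are cut off. In this form the induction hypothesis of \<open>tp_sum\<close>, where
  \<open>I\<close> is fixed, applies to it.\<close>

lemma lower_sum:
  assumes "ordered_sum lt il I X" "i \<in> I" "a \<in> X i"
  shows "{x \<in> \<Union>(X ` I). lt x a} =
    (\<Union>j\<in>I. if j = i then {x \<in> X i. lt x a} else if il j i then X j else {})"
proof (rule set_eqI)
  fix x
  have "lt x a \<longleftrightarrow> il j i" if "j \<in> I" "j \<noteq> i" "x \<in> X j" for j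
    using ordered_sumD[OF assms(1) that(1) assms(2) that(2,3) assms(3)] .
  then show "x \<in> {x \<in> \<Union>(X ` I). lt x a} \<longleftrightarrow>
      x \<in> (\<Union>j\<in>I. if j = i then {x \<in> X i. lt x a} else if il j i then X j else {})"
    using assms(2) by (auto split: if_splits)
qed

lemma upper_sum:
  assumes "ordered_sum lt il I X" "i \<in> I" "a \<in> X i"
  shows "{x \<in> \<Union>(X ` I). lt a x} =
    (\<Union>j\<in>I. if j = i then {x \<in> X i. lt a x} else if il i j then X j else {})"
proof (rule set_eqI)
  fix x
  have "lt a x \<longleftrightarrow> il i j" if "j \<in> I" "j \<noteq> i" "x \<in> X j" for j
    using ordered_sumD[OF assms(1) assms(2) that(1) that(2)[symmetric] assms(3) that(3)] .
  then show "x \<in> {x \<in> \<Union>(X ` I). lt a x} \<longleftrightarrow>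
      x \<in> (\<Union>j\<in>I. if j = i then {x \<in> X i. lt a x} else if il i j then X j else {})"
    using assms(2) by (auto split: if_splits)
qed

text \<open>Half of the induction step of \<open>tp_sum\<close>, with the induction hypothesis as a
  premise, so that it can also be applied with the two structures exchanged.\<close>

lemma profile_sum_subset:
  assumes IH: "\<And>X Y. ordered_sum lt il I X \<Longrightarrow> ordered_sum lt' il I Y \<Longrightarrow>
      (\<And>i. i \<in> I \<Longrightarrow> tp d lt c q (X i) = tp d lt' c' q (Y i)) \<Longrightarrow>
      tp d lt c q (\<Union>(X ` I)) = tp d lt' c' q (\<Union>(Y ` I))"
    and X: "ordered_sum lt il I X" and Y: "ordered_sum lt' il I Y"
    and eq: "\<And>i. i \<in> I \<Longrightarrow> tp d lt c (Suc q) (X i) = tp d lt' c' (Suc q) (Y i)"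
  shows "profile d lt c q (\<Union>(X ` I)) ` \<Union>(X ` I) \<subseteq> profile d lt' c' q (\<Union>(Y ` I)) ` \<Union>(Y ` I)"
proof (rule image_subsetI)
  fix a assume "a \<in> \<Union>(X ` I)"
  then obtain i where i: "i \<in> I" "a \<in> X i" by blast
  obtain b where b: "b \<in> Y i" "profile d lt c q (X i) a = profile d lt' c' q (Y i) b"
    using tp_SucE[OF eq[OF i(1)] i(2)] .
  note eq' = eq[THEN tp_Suc_eqD]
  have "profile d lt c q (\<Union>(X ` I)) a = profile d lt' c' q (\<Union>(Y ` I)) b"
    unfolding profile_eq_iff lower_sum[OF X i] lower_sum[OF Y i(1) b(1)]
      upper_sum[OF X i] upper_sum[OF Y i(1) b(1)]
    using b(2) eq' unfolding profile_eq_iff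
    by (intro conjI IH) (auto intro: ordered_sum_mono[OF X] ordered_sum_mono[OF Y] tp_empty split: if_splits)
  then show "profile d lt c q (\<Union>(X ` I)) a \<in> profile d lt' c' q (\<Union>(Y ` I)) ` \<Union>(Y ` I)"
    using i(1) b(1) by blast
qed

text \<open>The composition theorem: a move in one summand is answered in the summand with the same
  index, and the other summands only pass to a smaller rank. Since \<open>I\<close> is arbitrary, it
  serves finite, omega-fold and \<kappa>-fold sums alike.\<close>

lemma tp_sum:
  assumes "ordered_sum lt il I X" "ordered_sum lt' il I Y"
    and "\<And>i. i \<in> I \<Longrightarrow> tp d lt c q (X i) = tp d lt' c' q (Y i)"
  shows "tp d lt c q (\<Union>(X ` I)) = tp d lt' c' q (\<Union>(Y ` I))"
  using assms
proof (induction q arbitrary: X Y)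
  case (Suc q)
  show ?case
    unfolding tp_Suc_eq_iff
  proof
    show "profile d lt c q (\<Union>(X ` I)) ` \<Union>(X ` I) \<subseteq> profile d lt' c' q (\<Union>(Y ` I)) ` \<Union>(Y ` I)"
      by (rule profile_sum_subset[OF Suc.IH Suc.prems(1,2)]) (use Suc.prems(3) in auto)
    show "profile d lt' c' q (\<Union>(Y ` I)) ` \<Union>(Y ` I) \<subseteq> profile d lt c q (\<Union>(X ` I)) ` \<Union>(X ` I)"
      by (rule profile_sum_subset[OF Suc.IH[symmetric] Suc.prems(2,1)]) (use Suc.prems(3) in auto)
  qed
qed simp

lemma tp_iso:
  assumes "bij_betw h X Y" "\<And>x. x \<in> X \<Longrightarrow> c x = c' (h x)"
    and "\<And>x y. x \<in> X \<Longrightarrow> y \<in> X \<Longrightarrow> lt x y \<longleftrightarrow> lt' (h x) (h y)"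
  shows "tp d lt c q X = tp d lt' c' q Y"
  using assms
proof (induction q arbitrary: X Y)
  case (Suc q)
  have inj: "inj_on h X" and Y: "Y = h ` X" using Suc.prems(1) by (auto simp: bij_betw_def)
  have "profile d lt c q X a = profile d lt' c' q Y (h a)" if "a \<in> X" for a
  proof -
    have "bij_betw h {x \<in> X. lt x a} {y \<in> Y. lt' y (h a)}" "bij_betw h {x \<in> X. lt a x} {y \<in> Y. lt' (h a) y}"
      using Suc.prems(3) that inj unfolding Y by (auto simp: bij_betw_def inj_on_def)
    moreover have "c x = c' (h x)" if "x \<in> X" for x using Suc.prems(2) that .
    moreover have "lt x y \<longleftrightarrow> lt' (h x) (h y)" if "x \<in> X" "y \<in> X" for x y using Suc.prems(3) that .
    ultimately have "tp d lt c q {x \<in> X. lt x a} = tp d lt' c' q {y \<in> Y. lt' y (h a)}"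
        "tp d lt c q {x \<in> X. lt a x} = tp d lt' c' q {y \<in> Y. lt' (h a) y}"
      by (intro Suc.IH; blast)+
    then show ?thesis
      using Suc.prems(2)[OF that] unfolding profile_eq_iff by simp
  qed
  then show ?case unfolding tp_Suc_eq_iff Y image_image by (intro image_cong) auto
qed simp

lemma tp_cong: "(\<And>x. x \<in> X \<Longrightarrow> c x = c' x) \<Longrightarrow> tp d lt c q X = tp d lt c' q X"
  by (rule tp_iso[where h = "\<lambda>x. x"]) (auto simp: bij_betw_def)

section \<open>The Ehrenfeucht-Fraisse game and first-order sentences\<close>

text \<open>
  The positions of a game in which the pebbles of the increasing list \<open>L\<close> have been placed: all
  intervals between consecutive pebbles have the same \<open>q\<close>-type.
\<close>

fun matched :: "nat \<Rightarrow> nat \<Rightarrow> ('a \<Rightarrow> 'a \<Rightarrow> bool) \<Rightarrow> ('a \<Rightarrow> nat) \<Rightarrow> ('b \<Rightarrow> 'b \<Rightarrow> bool) \<Rightarrow> ('b \<Rightarrow> nat) \<Rightarrow>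
    'a set \<Rightarrow> 'b set \<Rightarrow> ('a \<times> 'b) list \<Rightarrow> bool" where
  "matched d q lt c lt' c' X Y [] \<longleftrightarrow> tp d lt c q X = tp d lt' c' q Y"
| "matched d q lt c lt' c' X Y ((a, b) # L) \<longleftrightarrow> a \<in> X \<and> b \<in> Y \<and> min (c a) d = min (c' b) d \<and>
     tp d lt c q {x \<in> X. lt x a} = tp d lt' c' q {y \<in> Y. lt' y b} \<and>
     matched d q lt c lt' c' {x \<in> X. lt a x} {y \<in> Y. lt' b y} L"

lemma matched_Suc: "matched d (Suc q) lt c lt' c' X Y L \<Longrightarrow> matched d q lt c lt' c' X Y L"
  by (induction L arbitrary: X Y) (auto intro: tp_Suc_eqD simp del: tp.simps)

lemma matched_swap:
  "matched d q lt c lt' c' X Y L \<Longrightarrow> matched d q lt' c' lt c Y X (map prod.swap L)"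
  by (induction L arbitrary: X Y) auto

text \<open>At the end of the game the pebbles form a partial isomorphism. Later entries of
  \<open>L\<close> lie above earlier ones in both orders, so by asymmetry the position in the list
  decides every comparison.\<close>

lemma matched_partial_iso:
  assumes "matched d q lt c lt' c' X Y L"
    and "\<And>x y. x \<in> X \<Longrightarrow> y \<in> X \<Longrightarrow> lt x y \<Longrightarrow> \<not> lt y x" "\<And>x y. x \<in> Y \<Longrightarrow> y \<in> Y \<Longrightarrow> lt' x y \<Longrightarrow> \<not> lt' y x"
    and "(x, y) \<in> set L" "(x', y') \<in> set L"
  shows "x \<in> X \<and> y \<in> Y \<and> min (c x) d = min (c' y) d \<and> (x = x' \<longleftrightarrow> y = y') \<and> (lt x x' \<longleftrightarrow> lt' y y')"
proof -
  have mem: "x \<in> X \<and> y \<in> Y \<and> min (c x) d = min (c' y) d"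
    if "matched d q lt c lt' c' X Y L" "(x, y) \<in> set L" for X Y L x y
    using that
  proof (induction L arbitrary: X Y)
    case (Cons p L)
    obtain a b where p: "p = (a, b)" by force
    show ?case
    proof (cases "(x, y) = (a, b)")
      case False
      then have "(x, y) \<in> set L" using Cons.prems(2) p by auto
      with Cons.IH Cons.prems(1) p have "x \<in> {x \<in> X. lt a x} \<and> y \<in> {y \<in> Y. lt' b y} \<and> min (c x) d = min (c' y) d"
        unfolding p matched.simps by blast
      then show ?thesis by blast
    qed (use Cons.prems(1) p in simp)
  qed simp
  show ?thesis
    using assms
  proof (induction L arbitrary: X Y)
    case (Cons p L)
    obtain a b where p: "p = (a, b)" by force
    let ?X = "{x \<in> X. lt a x}" and ?Y = "{y \<in> Y. lt' b y}"
    have m: "matched d q lt c lt' c' ?X ?Y L" and ab: "a \<in> X" "b \<in> Y" "min (c a) d = min (c' b) d"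
      using Cons.prems(1) p by auto
    have irr: "\<not> lt a a" "\<not> lt' b b" using Cons.prems(2,3) ab by blast+
    consider "(x, y) = (a, b)" "(x', y') = (a, b)" | "(x, y) = (a, b)" "(x', y') \<in> set L"
      | "(x, y) \<in> set L" "(x', y') = (a, b)" | "(x, y) \<in> set L" "(x', y') \<in> set L"
      using Cons.prems(4,5) p by auto
    then show ?case
    proof cases
      case 4
      have "x \<in> ?X \<and> y \<in> ?Y \<and> min (c x) d = min (c' y) d \<and> (x = x' \<longleftrightarrow> y = y') \<and> (lt x x' \<longleftrightarrow> lt' y y')"
        by (rule Cons.IH[OF m _ _ 4]) (use Cons.prems(2,3) in auto)
      then show ?thesis by blast
    next
      case 2
      then show ?thesis using mem[OF m 2(2)] ab irr by auto
    next
      case 3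
      then show ?thesis using mem[OF m 3(1)] ab irr Cons.prems(2,3) by auto
    qed (use ab irr in auto)
  qed simp
qed

text \<open>One round: the new pebble falls on an old one or into one interval between pebbles. That
  interval spends a rank to supply the answer, the others just lose a rank. The list must stay
  sorted, so the pair enters at its place and only the set of \<open>L'\<close> is
  described.\<close>

lemma matched_insert:
  assumes "matched d (Suc q) lt c lt' c' X Y L" "a \<in> X"
    and "\<And>x y. x \<in> X \<Longrightarrow> y \<in> X \<Longrightarrow> x = y \<or> lt x y \<or> lt y x"
    and "transp lt" "transp lt'"
  shows "\<exists>b L'. b \<in> Y \<and> matched d q lt c lt' c' X Y L' \<and> set L' = insert (a, b) (set L)"
  using assms(1-3)
proof (induction L arbitrary: X Y)
  case Nil
  obtain b where "b \<in> Y" "profile d lt c q X a = profile d lt' c' q Y b"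
    using tp_SucE[OF Nil.prems(1)[unfolded matched.simps(1)] Nil.prems(2)] .
  then have "b \<in> Y \<and> matched d q lt c lt' c' X Y [(a, b)] \<and> set [(a, b)] = insert (a, b) (set [])"
    using Nil.prems(2) by (simp add: profile_eq_iff)
  then show ?case by blast
next
  case (Cons p L)
  obtain a1 b1 where p: "p = (a1, b1)" by force
  note m = Cons.prems(1)[unfolded p matched.simps]
  consider "a = a1" | "lt a a1" | "lt a1 a" using Cons.prems(2,3) m by blast
  then show ?case
  proof cases
    case 1
    have "matched d q lt c lt' c' X Y (p # L)" using Cons.prems(1) matched_Suc by blast
    then show ?thesis using 1 m p by (metis insert_absorb list.set_intros(1))
  next
    case 2
    have a: "a \<in> {x \<in> X. lt x a1}" using 2 Cons.prems(2) by simp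
    have eq: "tp d lt c (Suc q) {x \<in> X. lt x a1} = tp d lt' c' (Suc q) {y \<in> Y. lt' y b1}"
      using m by blast
    obtain b where b: "b \<in> {y \<in> Y. lt' y b1}"
        "profile d lt c q {x \<in> X. lt x a1} a = profile d lt' c' q {y \<in> Y. lt' y b1} b"
      using tp_SucE[OF eq a] .
    \<comment> \<open>By transitivity the cuts of the interval below \<open>a1\<close> are cuts of
      \<open>X\<close> itself, which is how \<open>matched\<close> describes them after the
      insertion.\<close>
    have eqs: "{x \<in> {x \<in> X. lt x a1}. lt x a} = {x \<in> X. lt x a}"
        "{x \<in> {x \<in> Y. lt' x b1}. lt' x b} = {x \<in> Y. lt' x b}"
        "{x \<in> {x \<in> X. lt x a1}. lt a x} = {x \<in> {x \<in> X. lt a x}. lt x a1}"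
        "{x \<in> {x \<in> Y. lt' x b1}. lt' b x} = {x \<in> {x \<in> Y. lt' b x}. lt' x b1}"
        "{x \<in> {x \<in> X. lt a x}. lt a1 x} = {x \<in> X. lt a1 x}"
        "{x \<in> {x \<in> Y. lt' b x}. lt' b1 x} = {x \<in> Y. lt' b1 x}"
      using 2 b(1) assms(4,5) by (auto dest: transpD)
    have "matched d q lt c lt' c' {x \<in> X. lt a1 x} {y \<in> Y. lt' b1 y} L"
      using m matched_Suc by blast
    moreover have "b \<in> Y" "b1 \<in> Y" "a1 \<in> X" "lt' b b1" "min (c a1) d = min (c' b1) d" using b(1) m by blast+
    moreover have "min (c a) d = min (c' b) d"
      "tp d lt c q {x \<in> X. lt x a} = tp d lt' c' q {x \<in> Y. lt' x b}"
      "tp d lt c q {x \<in> {x \<in> X. lt a x}. lt x a1} = tp d lt' c' q {x \<in> {x \<in> Y. lt' b x}. lt' x b1}"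
      using b(2)[unfolded profile_eq_iff eqs(1-4)] by blast+
    ultimately have "matched d q lt c lt' c' X Y ((a, b) # p # L)"
      unfolding p matched.simps eqs(5,6) using Cons.prems(2) 2 by blast
    moreover have "b \<in> Y" "set ((a, b) # p # L) = insert (a, b) (set (p # L))" using b by auto
    ultimately show ?thesis by blast
  next
    case 3
    have "\<exists>b L'. b \<in> {y \<in> Y. lt' b1 y} \<and>
        matched d q lt c lt' c' {x \<in> X. lt a1 x} {y \<in> Y. lt' b1 y} L' \<and> set L' = insert (a, b) (set L)"
      by (rule Cons.IH) (use m 3 Cons.prems in auto)
    then obtain b L' where b: "b \<in> {y \<in> Y. lt' b1 y}"
        "matched d q lt c lt' c' {x \<in> X. lt a1 x} {y \<in> Y. lt' b1 y} L'" "set L' = insert (a, b) (set L)"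
      by blast
    have "matched d q lt c lt' c' X Y (p # L')"
      using m b(2) unfolding p matched.simps by (auto intro: tp_Suc_eqD simp del: tp.simps)
    moreover have "b \<in> Y" "set (p # L') = insert (a, b) (set (p # L))" using b by auto
    ultimately show ?thesis by blast
  qed
qed

abbreviation strict :: "'a rel \<Rightarrow> 'a \<Rightarrow> 'a \<Rightarrow> bool" where
  "strict r x y \<equiv> (x, y) \<in> r \<and> x \<noteq> y"

lemma strict_transp: "Well_order r \<Longrightarrow> transp (strict r)"
  unfolding well_order_on_def linear_order_on_def partial_order_on_def preorder_on_def
  by (rule transpI) (auto dest: transD antisymD)

lemma strict_asym: "Well_order r \<Longrightarrow> strict r x y \<Longrightarrow> \<not> strict r y x"
  unfolding well_order_on_def linear_order_on_def partial_order_on_def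
  by (auto dest: antisymD)

lemma strict_linear: "Well_order r \<Longrightarrow> x \<in> Field r \<Longrightarrow> y \<in> Field r \<Longrightarrow> x = y \<or> strict r x y \<or> strict r y x"
  unfolding well_order_on_def linear_order_on_def total_on_def by blast

text \<open>The Ehrenfeucht-Fraisse theorem. Pebbles are never taken back: when a quantifier rebinds
  a variable, the old pebble stays in \<open>L\<close>, and only the values of the free variables
  are required to occur there.\<close>

lemma sat_matched:
  assumes A: "Well_order (ord \<AA>)" and B: "Well_order (ord \<BB>)"
    and cA: "\<And>x i. x \<in> Field (ord \<AA>) \<Longrightarrow> i < d \<Longrightarrow> x \<in> color \<AA> i \<longleftrightarrow> c x = i"
    and cB: "\<And>x i. x \<in> Field (ord \<BB>) \<Longrightarrow> i < d \<Longrightarrow> x \<in> color \<BB> i \<longleftrightarrow> c' x = i"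
    and "matched d q (strict (ord \<AA>)) c (strict (ord \<BB>)) c' (Field (ord \<AA>)) (Field (ord \<BB>)) L"
    and "qrank \<phi> \<le> q" "colors_of \<phi> \<subseteq> {..<d}" "\<And>x. x \<in> free_vars \<phi> \<Longrightarrow> (s x, t x) \<in> set L"
  shows "sat \<AA> s \<phi> \<longleftrightarrow> sat \<BB> t \<phi>"
  using assms(5-8)
proof (induction \<phi> arbitrary: q L s t)
  case (Eq x y)
  show ?case
    using matched_partial_iso[OF Eq(1) strict_asym[OF A] strict_asym[OF B], where x = "s x" and x' = "s y" and y = "t x" and y' = "t y"]
      Eq(4) by auto
next
  case (Less x y)
  show ?case
    using matched_partial_iso[OF Less(1) strict_asym[OF A] strict_asym[OF B], where x = "s x" and x' = "s y" and y = "t x" and y' = "t y"]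
      Less(4) by auto
next
  case (Color i x)
  have i: "i < d" using Color(3) by simp
  have "s x \<in> Field (ord \<AA>) \<and> t x \<in> Field (ord \<BB>) \<and> min (c (s x)) d = min (c' (t x)) d"
    using matched_partial_iso[OF Color(1) strict_asym[OF A] strict_asym[OF B], where x = "s x" and x' = "s x" and y = "t x" and y' = "t x"]
      Color(4) by auto
  \<comment> \<open>The cut-off at \<open>d\<close> loses nothing here because
    \<open>i < d\<close>.\<close>
  then show ?case using cA cB i by (auto simp: min_def split: if_splits)
next
  case (Conj \<phi> \<psi>)
  then show ?case by (metis (no_types, lifting) UnCI colors_of.simps(6) free_vars.simps(6) le_sup_iff max.bounded_iff qrank.simps(6) sat.simps(6))
next
  case (Exi x \<phi>)
  obtain q' where q: "q = Suc q'" using Exi.prems(2) by (cases q) auto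
  let ?M = "\<lambda>q L. matched d q (strict (ord \<AA>)) c (strict (ord \<BB>)) c' (Field (ord \<AA>)) (Field (ord \<BB>)) L"
  have IH: "sat \<AA> (s(x := a)) \<phi> \<longleftrightarrow> sat \<BB> (t(x := b)) \<phi>"
    if "?M q' L'" "set L' = insert (a, b) (set L)" for a b L'
    by (rule Exi.IH[OF that(1)]) (use Exi.prems that(2) q in auto)
  have forth: "\<exists>b\<in>Field (ord \<BB>). sat \<AA> (s(x := a)) \<phi> \<longleftrightarrow> sat \<BB> (t(x := b)) \<phi>" if a: "a \<in> Field (ord \<AA>)" for a
  proof -
    obtain b L' where b: "b \<in> Field (ord \<BB>)" "?M q' L'" "set L' = insert (a, b) (set L)"
      using matched_insert[OF Exi.prems(1)[unfolded q] a strict_linear[OF A] strict_transp[OF A] strict_transp[OF B]]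
      by meson
    then show ?thesis using IH by blast
  qed
  have backw: "\<exists>a\<in>Field (ord \<AA>). sat \<AA> (s(x := a)) \<phi> \<longleftrightarrow> sat \<BB> (t(x := b)) \<phi>" if b: "b \<in> Field (ord \<BB>)" for b
  proof -
    obtain a L' where a: "a \<in> Field (ord \<AA>)"
      "matched d q' (strict (ord \<BB>)) c' (strict (ord \<AA>)) c (Field (ord \<BB>)) (Field (ord \<AA>)) L'"
      "set L' = insert (b, a) (set (map prod.swap L))"
      using matched_insert[OF matched_swap[OF Exi.prems(1)[unfolded q]] b strict_linear[OF B] strict_transp[OF B] strict_transp[OF A]]
      by meson
    have "?M q' (map prod.swap L')" using matched_swap[OF a(2)] .
    moreover have "set (map prod.swap L') = insert (a, b) (set L)" using a(3) by (auto simp: image_image)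
    ultimately show ?thesis using a(1) IH by blast
  qed
  show ?case using forth backw by auto
qed auto

lemma tp_eq_imp_equiv_upto:
  assumes "Well_order (ord \<AA>)" "Well_order (ord \<BB>)"
    and "\<And>x i. x \<in> Field (ord \<AA>) \<Longrightarrow> i < d \<Longrightarrow> x \<in> color \<AA> i \<longleftrightarrow> c x = i"
    and "\<And>x i. x \<in> Field (ord \<BB>) \<Longrightarrow> i < d \<Longrightarrow> x \<in> color \<BB> i \<longleftrightarrow> c' x = i"
    and "tp d (strict (ord \<AA>)) c q (Field (ord \<AA>)) = tp d (strict (ord \<BB>)) c' q (Field (ord \<BB>))"
  shows "equiv_upto d q \<AA> \<BB>"
  unfolding equiv_upto_def models_def sentence_def
proof (intro allI impI)
  fix \<phi> assume \<phi>: "(free_vars \<phi> = {} \<and> colors_of \<phi> \<subseteq> {..<d}) \<and> qrank \<phi> \<le> q"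
  have "sat \<AA> s \<phi> \<longleftrightarrow> sat \<BB> t \<phi>" for s t
    by (rule sat_matched[OF assms(1-4), where L = "[]" and q = q]) (use \<phi> assms(5) in auto)
  then show "(\<forall>s. sat \<AA> s \<phi>) \<longleftrightarrow> (\<forall>s. sat \<BB> s \<phi>)" by blast
qed

section \<open>Products of types\<close>

text \<open>Both directions are stated because \<open>lt\<close> is an arbitrary relation. With
  them, \<open>before\<close> agrees with \<open>ordered_sum\<close> over two increasing
  indices.\<close>

definition before :: "('a \<Rightarrow> 'a \<Rightarrow> bool) \<Rightarrow> 'a set \<Rightarrow> 'a set \<Rightarrow> bool" where
  "before lt X Y \<longleftrightarrow> (\<forall>x\<in>X. \<forall>y\<in>Y. lt x y \<and> \<not> lt y x)"

lemma before_mono: "before lt X Y \<Longrightarrow> X' \<subseteq> X \<Longrightarrow> Y' \<subseteq> Y \<Longrightarrow> before lt X' Y'"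
  unfolding before_def by blast

lemma before_UN: "(\<And>i j. i \<in> I \<Longrightarrow> j \<in> J \<Longrightarrow> before lt (X i) (Y j)) \<Longrightarrow> before lt (\<Union>(X ` I)) (\<Union>(Y ` J))"
  unfolding before_def by blast

lemma ordered_sum_before:
  fixes X :: "nat \<Rightarrow> 'a set"
  shows "ordered_sum lt (<) I X \<longleftrightarrow> (\<forall>i\<in>I. \<forall>j\<in>I. i < j \<longrightarrow> before lt (X i) (X j))"
  unfolding ordered_sum_def before_def
  by (metis less_imp_neq less_asym linorder_neqE_nat)

locale types =
  fixes d q :: nat
begin

text \<open>A definition cannot quantify over carrier types, so the representatives live on
  \<open>nat\<close>, with an arbitrary relation. On this set the products below are well
  defined.\<close>

definition realizable :: "nat set" where
  "realizable = {tp d lt c q X | lt c (X :: nat set). True}"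

definition tp_none :: nat where
  "tp_none = tp d (\<lambda>_ _. False) (\<lambda>_. 0) q ({} :: nat set)"

lemma tp_empty_none: "tp d lt c q {} = tp_none"
  unfolding tp_none_def by (rule tp_empty)

lemma finite_realizable: "finite realizable"
  by (rule finite_subset[OF _ finite_tp_range[of d q]]) (auto simp: realizable_def tp_in_tp_range)

text \<open>The i-th representative is moved to the pairs \<open>(i, a)\<close>, coded by
  \<open>prod_encode\<close>, and pairs are compared lexicographically.\<close>

lemma realize:
  assumes "\<And>i :: nat. f i \<in> realizable"
  obtains lt c and X :: "nat \<Rightarrow> nat set"
  where "\<And>i. tp d lt c q (X i) = f i" "ordered_sum lt (<) UNIV X"
proof -
  have "\<forall>i. \<exists>p. f i = tp d (fst p) (fst (snd p)) q (snd (snd p) :: nat set)"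
    using assms unfolding realizable_def by auto
  then obtain p where p: "\<And>i. f i = tp d (fst (p i)) (fst (snd (p i))) q (snd (snd (p i)) :: nat set)"
    by metis
  define lt :: "nat \<Rightarrow> nat \<Rightarrow> bool" where "lt m n \<longleftrightarrow> fst (prod_decode m) < fst (prod_decode n) \<or>
    fst (prod_decode m) = fst (prod_decode n) \<and> fst (p (fst (prod_decode m))) (snd (prod_decode m)) (snd (prod_decode n))" for m n
  define c where "c m = fst (snd (p (fst (prod_decode m)))) (snd (prod_decode m))" for m
  define X where "X i = (\<lambda>a. prod_encode (i, a)) ` snd (snd (p i))" for i
  have "tp d lt c q (X i) = f i" for i
    unfolding p by (rule tp_iso[symmetric, where h = "\<lambda>a. prod_encode (i, a)"])
      (auto simp: X_def c_def lt_def bij_betw_def inj_on_def)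
  moreover have "ordered_sum lt (<) UNIV X"
    by (auto simp: ordered_sum_def X_def lt_def)
  ultimately show thesis using that by blast
qed

text \<open>Independent of the choice of representatives only for sequences of realizable types.\<close>

definition tp_omega :: "(nat \<Rightarrow> nat) \<Rightarrow> nat" where
  "tp_omega f = (SOME t. \<exists>lt c (X :: nat \<Rightarrow> nat set). (\<forall>i. tp d lt c q (X i) = f i) \<and>
     ordered_sum lt (<) UNIV X \<and> t = tp d lt c q (\<Union>(range X)))"

lemma tp_realizable: "tp d lt c q (X :: nat set) \<in> realizable"
  unfolding realizable_def by blast

lemma tp_none_realizable: "tp_none \<in> realizable"
  unfolding tp_none_def by (rule tp_realizable)

lemma tp_omega_witness:
  assumes "\<And>i. f i \<in> realizable"
  shows "\<exists>lt c (X :: nat \<Rightarrow> nat set). (\<forall>i. tp d lt c q (X i) = f i) \<and>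
     ordered_sum lt (<) UNIV X \<and> tp_omega f = tp d lt c q (\<Union>(range X))"
  unfolding tp_omega_def
proof (rule someI_ex)
  obtain lt c and X :: "nat \<Rightarrow> nat set"
    where X: "\<And>i. tp d lt c q (X i) = f i" "ordered_sum lt (<) UNIV X"
    using realize[of f] assms by blast
  show "\<exists>t lt c (X :: nat \<Rightarrow> nat set). (\<forall>i. tp d lt c q (X i) = f i) \<and>
     ordered_sum lt (<) UNIV X \<and> t = tp d lt c q (\<Union>(range X))"
    by (intro exI conjI allI, rule X(1), rule X(2), rule refl)
qed

lemma tp_omega_realizable: "(\<And>i. f i \<in> realizable) \<Longrightarrow> tp_omega f \<in> realizable"
  using tp_omega_witness[of f] by (metis tp_realizable)

text \<open>By \<open>tp_sum\<close> the choice made in \<open>tp_omega\<close> does not matter. The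
  sets \<open>X i\<close> may live in any type, so \<open>tp_omega\<close> also computes types of
  orders whose carrier is not \<open>nat\<close>.\<close>

lemma tp_UN_omega:
  assumes "ordered_sum lt (<) UNIV X" "\<And>i. tp d lt c q (X i) = f i" "\<And>i. f i \<in> realizable"
  shows "tp d lt c q (\<Union>(range X)) = tp_omega f"
proof -
  obtain lt' c' and Y :: "nat \<Rightarrow> nat set" where Y: "\<And>i. tp d lt' c' q (Y i) = f i"
     "ordered_sum lt' (<) UNIV Y" "tp_omega f = tp d lt' c' q (\<Union>(range Y))"
    using tp_omega_witness[of f, OF assms(3)] by blast
  show ?thesis unfolding Y(3) by (rule tp_sum[OF assms(1) Y(2)]) (simp add: Y(1) assms(2))
qed

text \<open>Padding with the type of the empty order makes the binary product a case of
  \<open>tp_omega\<close>, so that no second choice of representatives is made.\<close>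

definition tp_mult :: "nat \<Rightarrow> nat \<Rightarrow> nat" where
  "tp_mult s t = tp_omega (\<lambda>i. if i = 0 then s else if i = 1 then t else tp_none)"

lemma tp_mult_realizable: "s \<in> realizable \<Longrightarrow> t \<in> realizable \<Longrightarrow> tp_mult s t \<in> realizable"
  unfolding tp_mult_def by (rule tp_omega_realizable) (auto simp: tp_none_realizable)

lemma tp_Un:
  assumes "before lt X Y" "tp d lt c q X = s" "tp d lt c q Y = t" "s \<in> realizable" "t \<in> realizable"
  shows "tp d lt c q (X \<union> Y) = tp_mult s t"
proof -
  let ?Z = "\<lambda>i :: nat. if i = 0 then X else if i = 1 then Y else {}"
  have "tp d lt c q (\<Union>(range ?Z)) = tp_omega (\<lambda>i. if i = 0 then s else if i = 1 then t else tp_none)"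
    by (rule tp_UN_omega) (use assms in \<open>auto simp: ordered_sum_before before_def tp_empty_none tp_none_realizable\<close>)
  moreover have "\<Union>(range ?Z) = X \<union> Y" by (auto split: if_splits)
  ultimately show ?thesis unfolding tp_mult_def by simp
qed

lemma realize3:
  assumes "a \<in> realizable" "b \<in> realizable" "c \<in> realizable"
  obtains lt col and X Y Z :: "nat set"
  where "tp d lt col q X = a" "tp d lt col q Y = b" "tp d lt col q Z = c"
    "before lt X Y" "before lt Y Z" "before lt X Z"
proof -
  let ?f = "\<lambda>i :: nat. if i = 0 then a else if i = 1 then b else c"
  obtain lt col and X :: "nat \<Rightarrow> nat set"
    where X: "\<And>i. tp d lt col q (X i) = ?f i" "ordered_sum lt (<) UNIV X"
    using realize[of ?f] assms by metis
  show thesis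
    by (rule that[of lt col "X 0" "X 1" "X 2"]) (use X in \<open>auto simp: ordered_sum_before\<close>)
qed

lemma tp_mult_assoc:
  assumes "a \<in> realizable" "b \<in> realizable" "c \<in> realizable"
  shows "tp_mult (tp_mult a b) c = tp_mult a (tp_mult b c)"
proof -
  obtain lt col and X Y Z :: "nat set"
    where r: "tp d lt col q X = a" "tp d lt col q Y = b" "tp d lt col q Z = c"
      and b: "before lt X Y" "before lt Y Z" "before lt X Z"
    using realize3[OF assms] .
  have "tp_mult (tp_mult a b) c = tp d lt col q ((X \<union> Y) \<union> Z)"
    by (rule tp_Un[symmetric]) (use b assms r in \<open>auto simp: before_def tp_mult_realizable intro!: tp_Un\<close>)
  also have "\<dots> = tp d lt col q (X \<union> (Y \<union> Z))" by (simp add: Un_assoc)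
  also have "\<dots> = tp_mult a (tp_mult b c)"
    by (rule tp_Un) (use b assms r in \<open>auto simp: before_def tp_mult_realizable intro!: tp_Un\<close>)
  finally show ?thesis .
qed

lemma tp_mult_none_left: "a \<in> realizable \<Longrightarrow> tp_mult tp_none a = a"
proof -
  assume a: "a \<in> realizable"
  obtain lt col and X Y Z :: "nat set"
    where r: "tp d lt col q X = a" "tp d lt col q Y = a" "tp d lt col q Z = a"
    using realize3[OF a a a] .
  have "tp d lt col q ({} \<union> X) = tp_mult tp_none a"
    by (rule tp_Un) (use a r in \<open>auto simp: before_def tp_empty_none tp_none_realizable\<close>)
  then show ?thesis using r by simp
qed

lemma tp_mult_none_right: "a \<in> realizable \<Longrightarrow> tp_mult a tp_none = a"
proof -
  assume a: "a \<in> realizable"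
  obtain lt col and X Y Z :: "nat set"
    where r: "tp d lt col q X = a" "tp d lt col q Y = a" "tp d lt col q Z = a"
    using realize3[OF a a a] .
  have "tp d lt col q (X \<union> {}) = tp_mult a tp_none"
    by (rule tp_Un) (use a r in \<open>auto simp: before_def tp_empty_none tp_none_realizable\<close>)
  then show ?thesis using r by simp
qed

lemma tp_omega_Suc:
  assumes "\<And>i. f i \<in> realizable"
  shows "tp_omega f = tp_mult (f 0) (tp_omega (\<lambda>i. f (Suc i)))"
proof -
  obtain lt c and X :: "nat \<Rightarrow> nat set"
    where X: "\<And>i. tp d lt c q (X i) = f i" "ordered_sum lt (<) UNIV X"
    using realize[of f] assms by blast
  have "tp_omega f = tp d lt c q (\<Union>(range X))" by (rule tp_UN_omega[symmetric]) (use X assms in auto)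
  also have "\<Union>(range X) = X 0 \<union> \<Union>(range (\<lambda>i. X (Suc i)))"
    by (auto, metis not0_implies_Suc)
  also have "tp d lt c q \<dots> = tp_mult (f 0) (tp_omega (\<lambda>i. f (Suc i)))"
  proof (rule tp_Un)
    show "before lt (X 0) (\<Union>(range (\<lambda>i. X (Suc i))))"
      using X(2) unfolding ordered_sum_before before_def by blast
    show "tp d lt c q (\<Union>(range (\<lambda>i. X (Suc i)))) = tp_omega (\<lambda>i. f (Suc i))"
      by (rule tp_UN_omega) (use X assms in \<open>auto simp: ordered_sum_before\<close>)
  qed (use X assms in \<open>auto intro: tp_omega_realizable\<close>)
  finally show ?thesis .
qed

text \<open>Two bracketings of one sequence: (ab)(ab)... equals a(ba)(ba)..., here with factors that
  vary with \<open>i\<close>. The even positions of the auxiliary sequence carry the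
  \<open>a i\<close>, the odd ones the \<open>b i\<close>.\<close>

lemma tp_omega_swap:
  assumes "\<And>i. a i \<in> realizable" "\<And>i. b i \<in> realizable"
  shows "tp_omega (\<lambda>i. tp_mult (a i) (b i)) = tp_mult (a 0) (tp_omega (\<lambda>i. tp_mult (b i) (a (Suc i))))"
proof -
  let ?f = "\<lambda>i. if even i then a (i div 2) else b (i div 2)"
  obtain lt c and X :: "nat \<Rightarrow> nat set"
    where X: "\<And>i. tp d lt c q (X i) = ?f i" "ordered_sum lt (<) UNIV X"
    using realize[of ?f] assms by metis
  have bf: "before lt (X i) (X j)" if "i < j" for i j
    using X(2) that unfolding ordered_sum_before by blast
  have bf2: "before lt (X i \<union> X (Suc i)) (X j \<union> X (Suc j))" if "Suc i < j" for i j
    using bf[of i j] bf[of i "Suc j"] bf[of "Suc i" j] bf[of "Suc i" "Suc j"] that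
    unfolding before_def by auto
  have 1: "tp d lt c q (X (2 * i) \<union> X (Suc (2 * i))) = tp_mult (a i) (b i)" for i
    by (rule tp_Un[OF bf]) (use X(1) assms in auto)
  have 2: "tp d lt c q (X (Suc (2 * i)) \<union> X (Suc (Suc (2 * i)))) = tp_mult (b i) (a (Suc i))" for i
    by (rule tp_Un[OF bf]) (use X(1)[of "Suc (2 * i)"] X(1)[of "Suc (Suc (2 * i))"] assms in auto)
  have "tp_omega (\<lambda>i. tp_mult (a i) (b i)) = tp d lt c q (\<Union>i. X (2 * i) \<union> X (Suc (2 * i)))"
    by (rule tp_UN_omega[symmetric]) (use 1 assms in \<open>auto simp: ordered_sum_before tp_mult_realizable intro!: bf2\<close>)
  also have "(\<Union>i. X (2 * i) \<union> X (Suc (2 * i))) = \<Union>(range X)"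
  proof -
    have "X i \<subseteq> (\<Union>i. X (2 * i) \<union> X (Suc (2 * i)))" for i
      by (cases "even i") (auto elim!: evenE oddE)
    then show ?thesis by blast
  qed
  also have "\<Union>(range X) = X 0 \<union> (\<Union>i. X (Suc (2 * i)) \<union> X (Suc (Suc (2 * i))))"
  proof -
    have "X i \<subseteq> X 0 \<union> (\<Union>i. X (Suc (2 * i)) \<union> X (Suc (Suc (2 * i))))" for i
    proof (cases i)
      case (Suc j)
      then show ?thesis by (cases "even j") (auto elim!: evenE oddE)
    qed blast
    then show ?thesis by blast
  qed
  also have "tp d lt c q \<dots> = tp_mult (a 0) (tp_omega (\<lambda>i. tp_mult (b i) (a (Suc i))))"
  proof (rule tp_Un)
    show "before lt (X 0) (\<Union>i. X (Suc (2 * i)) \<union> X (Suc (Suc (2 * i))))"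
      using bf[of 0] unfolding before_def by blast
    show "tp d lt c q (\<Union>i. X (Suc (2 * i)) \<union> X (Suc (Suc (2 * i)))) = tp_omega (\<lambda>i. tp_mult (b i) (a (Suc i)))"
      by (rule tp_UN_omega) (use 2 assms in \<open>auto simp: ordered_sum_before tp_mult_realizable intro!: bf2\<close>)
  qed (use X(1)[of 0] assms in \<open>auto intro!: tp_omega_realizable tp_mult_realizable\<close>)
  finally show ?thesis .
qed

section \<open>Finite products and the Ramsey factorization\<close>

primrec tp_prod :: "(nat \<Rightarrow> nat) \<Rightarrow> nat \<Rightarrow> nat" where
  "tp_prod f 0 = tp_none"
| "tp_prod f (Suc n) = tp_mult (tp_prod f n) (f n)"

lemma tp_prod_realizable: "(\<And>i. f i \<in> realizable) \<Longrightarrow> tp_prod f n \<in> realizable"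
  by (induction n) (auto simp: tp_none_realizable tp_mult_realizable)

lemma tp_UN_prod:
  assumes "ordered_sum lt (<) UNIV X" "\<And>i. tp d lt c q (X i) = f i" "\<And>i. f i \<in> realizable"
  shows "tp d lt c q (\<Union>(X ` {..<n})) = tp_prod f n"
proof (induction n)
  case (Suc n)
  have "tp d lt c q (\<Union>(X ` {..<n}) \<union> X n) = tp_mult (tp_prod f n) (f n)"
    by (rule tp_Un) (use Suc assms in \<open>auto simp: ordered_sum_before before_def intro: tp_prod_realizable\<close>)
  then show ?case by (simp add: lessThan_Suc Un_commute)
qed (simp add: tp_empty_none)

text \<open>The interval has \<open>n + 1\<close> members: an empty one would have type
  \<open>tp_none\<close>, which need not belong to \<open>E\<close>.\<close>

lemma tp_interval_closed:
  assumes X: "ordered_sum lt (<) UNIV X" "\<And>i. tp d lt c q (X i) \<in> E"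
    and E: "E \<subseteq> realizable" "\<And>s t. s \<in> E \<Longrightarrow> t \<in> E \<Longrightarrow> tp_mult s t \<in> E"
  shows "tp d lt c q (\<Union>(X ` {i..<Suc i + n})) \<in> E"
proof (induction n)
  case 0
  then show ?case using X(2) by simp
next
  case (Suc n)
  have "tp d lt c q (\<Union>(X ` {i..<Suc i + n}) \<union> X (Suc i + n)) =
      tp_mult (tp d lt c q (\<Union>(X ` {i..<Suc i + n}))) (tp d lt c q (X (Suc i + n)))"
    by (rule tp_Un) (use X Suc E in \<open>auto simp: ordered_sum_before before_def\<close>)
  also have "\<dots> \<in> E" using E Suc X by blast
  also have "\<Union>(X ` {i..<Suc i + n}) \<union> X (Suc i + n) = \<Union>(X ` {i..<Suc i + Suc n})"
    by (auto simp: atLeastLessThanSuc)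
  finally show ?case .
qed

text \<open>Pairs \<open>i < j\<close> are colored by the type of the sum over
  \<open>{i..<j}\<close>. On a homogeneous infinite set all these types equal one \<open>t\<close>;
  joining two adjacent intervals gives t t = t, and cutting along the set leaves an initial part
  followed by omega many \<open>t\<close>.\<close>

lemma tp_omega_Ramsey:
  assumes f: "\<And>i. f i \<in> E" and E: "E \<subseteq> realizable" "\<And>s t. s \<in> E \<Longrightarrow> t \<in> E \<Longrightarrow> tp_mult s t \<in> E"
  obtains s t where "s \<in> E" "t \<in> E" "tp_mult t t = t" "tp_omega f = tp_mult s (tp_omega (\<lambda>_. t))"
proof -
  have fT: "f i \<in> realizable" for i using f E by blast
  obtain lt c and X :: "nat \<Rightarrow> nat set"
    where X: "\<And>i. tp d lt c q (X i) = f i" "ordered_sum lt (<) UNIV X"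
    using realize[of f] fT by blast
  have bf: "before lt (X i) (X j)" if "i < j" for i j
    using X(2) that unfolding ordered_sum_before by blast
  let ?S = "\<lambda>i j. \<Union>(X ` {i..<j})"
  have bS: "before lt (?S i j) (?S k l)" if "j \<le> k" for i j k l
    by (rule before_UN) (use bf that in auto)
  have cl: "tp d lt c q (?S i j) \<in> E" if "i < j" for i j
    using tp_interval_closed[OF X(2) _ E, of c i "j - Suc i"] X(1) f that by simp
  let ?g = "\<lambda>A. tp d lt c q (?S (Min A) (Max A))"
  \<comment> \<open>\<open>Ramsey2\<close> wants colors below a bound; types are numbers in a finite
    set.\<close>
  obtain m where m: "realizable \<subseteq> {..<m}" using finite_realizable finite_nat_iff_bounded by blast
  have "\<exists>Y t. Y \<subseteq> UNIV \<and> infinite Y \<and> t < m \<and> (\<forall>x\<in>Y. \<forall>y\<in>Y. x \<noteq> y \<longrightarrow> ?g {x, y} = t)"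
    by (rule Ramsey2) (use tp_realizable m in auto)
  then obtain Y t where Y: "infinite Y" "\<forall>x\<in>Y. \<forall>y\<in>Y. x \<noteq> y \<longrightarrow> ?g {x, y} = t" by blast
  let ?e = "enumerate Y"
  have eY: "?e i \<in> Y" and e_less: "i < j \<Longrightarrow> ?e i < ?e j" for i j
    using Y(1) by (auto simp: enumerate_in_set enumerate_mono)
  have hom: "tp d lt c q (?S (?e i) (?e j)) = t" if "i < j" for i j
    using Y(2)[rule_format, OF eY eY, of i j] e_less[OF that] by simp
  have tE: "t \<in> E" using cl[OF e_less[of 0 1]] hom[of 0 1] by simp
  have "?S (?e 0) (?e 2) = ?S (?e 0) (?e 1) \<union> ?S (?e 1) (?e 2)"
    using e_less[of 0 1] e_less[of 1 2] by (simp add: ivl_disj_un UN_Un[symmetric] del: UN_Un)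
  moreover have "tp d lt c q (?S (?e 0) (?e 1) \<union> ?S (?e 1) (?e 2)) = tp_mult t t"
    by (rule tp_Un[OF bS]) (use hom tE E in auto)
  ultimately have idem: "tp_mult t t = t" using hom[of 0 2] by simp
  have "tp_omega f = tp d lt c q (\<Union>(range X))" by (rule tp_UN_omega[symmetric]) (use X fT in auto)
  \<comment> \<open>The initial interval stops at \<open>?e 1\<close> and not at
    \<open>?e 0\<close>, which may be \<open>0\<close>: it must be nonempty for \<open>cl\<close> to
    put its type into \<open>E\<close>.\<close>
  also have "\<Union>(range X) = ?S 0 (?e 1) \<union> (\<Union>i. ?S (?e (Suc i)) (?e (Suc (Suc i))))"
  proof -
    have "X k \<subseteq> ?S 0 (?e 1) \<union> (\<Union>i. ?S (?e (Suc i)) (?e (Suc (Suc i))))" for k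
    proof (cases "k < ?e 1")
      case False
      have "k < ?e (Suc k)" using le_enumerate[OF Y(1), of "Suc k"] by simp
      then obtain n where n: "k < ?e n" "\<And>m. m < n \<Longrightarrow> \<not> k < ?e m"
        using exists_least_iff[of "\<lambda>n. k < ?e n"] by blast
      have "n \<noteq> 0" using n(1) False e_less[of 0 1] by (intro notI) simp
      moreover have "n \<noteq> 1" using n(1) False by (intro notI) simp
      ultimately obtain i where i: "n = Suc (Suc i)" by (cases n; cases "n - 1") auto
      with n(2)[of "Suc i"] n(1) i have "k \<in> {?e (Suc i)..<?e (Suc (Suc i))}" by simp
      then show ?thesis by blast
    qed auto
    then show ?thesis by blast
  qed
  also have "tp d lt c q \<dots> = tp_mult (tp d lt c q (?S 0 (?e 1))) (tp_omega (\<lambda>_. t))"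
  proof (rule tp_Un)
    show "before lt (?S 0 (?e 1)) (\<Union>i. ?S (?e (Suc i)) (?e (Suc (Suc i))))"
    proof -
      have "?e 1 \<le> ?e (Suc i)" for i using e_less[of 1 "Suc i"] by (cases i) auto
      then have "before lt (?S 0 (?e 1)) (?S (?e (Suc i)) (?e (Suc (Suc i))))" for i by (rule bS)
      then show ?thesis unfolding before_def by blast
    qed
    show "tp d lt c q (\<Union>i. ?S (?e (Suc i)) (?e (Suc (Suc i)))) = tp_omega (\<lambda>_. t)"
    proof (rule tp_UN_omega)
      have "before lt (?S (?e (Suc i)) (?e (Suc (Suc i)))) (?S (?e (Suc j)) (?e (Suc (Suc j))))" if "i < j" for i j
        by (rule bS) (use that e_less[of "Suc (Suc i)" "Suc j"] in \<open>cases "Suc i = j"; auto\<close>)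
      then show "ordered_sum lt (<) UNIV (\<lambda>i. ?S (?e (Suc i)) (?e (Suc (Suc i))))"
        unfolding ordered_sum_before by blast
    qed (use hom tE E in auto)
  qed (use tE E tp_realizable in \<open>auto intro!: tp_omega_realizable\<close>)
  finally have "tp_omega f = tp_mult (tp d lt c q (?S 0 (?e 1))) (tp_omega (\<lambda>_. t))" .
  moreover have "tp d lt c q (?S 0 (?e 1)) \<in> E" by (rule cl) (use e_less[of 0 1] in simp)
  ultimately show thesis using that tE idem by blast
qed

end

section \<open>Aperiodicity of powers\<close>

lemma tp_Un_cong:
  assumes "before lt X Y" "before lt' X' Y'"
    and "tp d lt c q X = tp d lt' c' q X'" "tp d lt c q Y = tp d lt' c' q Y'"
  shows "tp d lt c q (X \<union> Y) = tp d lt' c' q (X' \<union> Y')"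
proof -
  let ?Z = "\<lambda>X Y i. if i = (0::nat) then X else Y"
  have "tp d lt c q (\<Union>(?Z X Y ` {0, 1})) = tp d lt' c' q (\<Union>(?Z X' Y' ` {0, 1}))"
    by (rule tp_sum[where il = "(<)"]) (use assms in \<open>auto simp: ordered_sum_before\<close>)
  then show ?thesis by (simp add: Un_commute)
qed

text \<open>The game on finite linear orders with \<open>n\<close> and \<open>m\<close> points,
  where \<open>2 ^ q \<le> n + 1\<close> means too long to be measured in \<open>q\<close> rounds. A
  short side of the move is copied exactly; if both sides are long, \<open>j = 2 ^ q - 1\<close>
  leaves enough on both. The \<open>+ 1\<close> makes halving exact: \<open>n + 1\<close> splits
  into \<open>(i + 1) + (n - i)\<close>.\<close>

lemma power_step:
  assumes "n = m \<or> 2 ^ Suc q \<le> n + 1 \<and> 2 ^ Suc q \<le> m + (1::nat)" "i < n"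
  obtains j where "j < m" "i = j \<or> 2 ^ q \<le> i + 1 \<and> 2 ^ q \<le> j + 1"
    "n - Suc i = m - Suc j \<or> 2 ^ q \<le> n - Suc i + 1 \<and> 2 ^ q \<le> m - Suc j + 1"
proof (cases "n = m")
  case True
  then show thesis using assms(2) that[of i] by auto
next
  case False
  obtain p :: nat where p: "p = 2 ^ q" by blast
  have nm: "2 * p \<le> n + 1" "2 * p \<le> m + 1" "p \<ge> 1" using False assms(1) p by auto
  note that' = that[folded p]
  consider "i < p" | "i \<ge> p" "n - Suc i < p" | "i \<ge> p" "n - Suc i \<ge> p" by linarith
  then show thesis
  proof cases
    case 1
    then show thesis using nm assms(2) by (intro that'[of i]) auto
  next
    case 2
    then show thesis using nm assms(2) by (intro that'[of "m - Suc (n - Suc i)"]) auto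
  next
    case 3
    then show thesis using nm assms(2) by (intro that'[of "p - 1"]) auto
  qed
qed

lemma lower_interval:
  fixes X :: "nat \<Rightarrow> 'a set"
  assumes "ordered_sum lt (<) UNIV X" "x \<in> X k" "a \<le> k" "k < b"
  shows "{z \<in> \<Union>(X ` {a..<b}). lt z x} = \<Union>(X ` {a..<k}) \<union> {z \<in> X k. lt z x}"
proof (rule set_eqI)
  fix z
  have *: "lt z x \<longleftrightarrow> j < k" if "j \<noteq> k" "z \<in> X j" for j
    using ordered_sumD[OF assms(1) UNIV_I UNIV_I that(1,2) assms(2)] .
  show "z \<in> {z \<in> \<Union>(X ` {a..<b}). lt z x} \<longleftrightarrow> z \<in> \<Union>(X ` {a..<k}) \<union> {z \<in> X k. lt z x}"
    (is "?L \<longleftrightarrow> ?R")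
  proof
    assume ?L
    then obtain j where j: "a \<le> j" "j < b" "z \<in> X j" "lt z x" by auto
    then show ?R using *[of j] by (cases "j = k") auto
  next
    assume ?R
    then consider j where "a \<le> j" "j < k" "z \<in> X j" | "z \<in> X k" "lt z x"
      by auto
    then show ?L
    proof cases
      case 1
      then have "lt z x" using *[of j] by simp
      then show ?thesis using 1 assms(4) by auto
    qed (use assms(3,4) in auto)
  qed
qed

lemma upper_interval:
  fixes X :: "nat \<Rightarrow> 'a set"
  assumes "ordered_sum lt (<) UNIV X" "x \<in> X k" "a \<le> k" "k < b"
  shows "{z \<in> \<Union>(X ` {a..<b}). lt x z} = {z \<in> X k. lt x z} \<union> \<Union>(X ` {Suc k..<b})"
proof (rule set_eqI)
  fix z
  have *: "lt x z \<longleftrightarrow> k < j" if "k \<noteq> j" "z \<in> X j" for j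
    using ordered_sumD[OF assms(1) UNIV_I UNIV_I that(1) assms(2) that(2)] .
  show "z \<in> {z \<in> \<Union>(X ` {a..<b}). lt x z} \<longleftrightarrow> z \<in> {z \<in> X k. lt x z} \<union> \<Union>(X ` {Suc k..<b})"
    (is "?L \<longleftrightarrow> ?R")
  proof
    assume ?L
    then obtain j where j: "a \<le> j" "j < b" "z \<in> X j" "lt x z" by auto
    then show ?R using *[of j] by (cases "j = k") auto
  next
    assume ?R
    then consider j where "k < j" "j < b" "z \<in> X j" | "z \<in> X k" "lt x z"
      by (auto simp: Suc_le_eq)
    then show ?L
    proof cases
      case 1
      then have "lt x z" using *[of j] by simp
      then show ?thesis using 1 assms(3) by auto
    qed (use assms(3,4) in auto)
  qed
qed

lemma before_part:
  fixes X :: "nat \<Rightarrow> 'a set"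
  assumes "ordered_sum lt (<) UNIV X" "Z \<subseteq> X k"
  shows "before lt (\<Union>(X ` {a..<k})) Z" "before lt Z (\<Union>(X ` {Suc k..<b}))"
proof -
  have *: "before lt (X i) (X j)" if "i < j" for i j
    using assms(1) that unfolding ordered_sum_before by blast
  then have 1: "before lt (X i) Z" if "i < k" for i
    using before_mono[OF _ subset_refl assms(2)] that by blast
  have 2: "before lt Z (X j)" if "k < j" for j
    using before_mono[OF * assms(2) subset_refl] that by blast
  show "before lt (\<Union>(X ` {a..<k})) Z" "before lt Z (\<Union>(X ` {Suc k..<b}))"
    using 1 2 unfolding before_def by (auto simp: Suc_le_eq)
qed

text \<open>The move is answered on two levels: \<open>power_step\<close> picks the summand,
  equality of the summand types picks the point in it. Powers are intervals of an infinite sequence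
  with free starting points \<open>a\<close> and \<open>b\<close>, because the part above a move
  starts at a later index.\<close>

lemma profile_power_subset:
  fixes X :: "nat \<Rightarrow> 'a set" and Y :: "nat \<Rightarrow> 'b set"
  assumes X: "ordered_sum lt (<) UNIV X" and Y: "ordered_sum lt' (<) UNIV Y"
    and eq: "\<And>i j. tp d lt c (Suc q) (X i) = tp d lt' c' (Suc q) (Y j)"
    and IH: "\<And>n m a b. n = m \<or> 2 ^ q \<le> n + 1 \<and> 2 ^ q \<le> m + (1::nat) \<Longrightarrow>
      tp d lt c q (\<Union>(X ` {a..<a + n})) = tp d lt' c' q (\<Union>(Y ` {b..<b + m}))"
    and nm: "n = m \<or> 2 ^ Suc q \<le> n + 1 \<and> 2 ^ Suc q \<le> m + (1::nat)"
  shows "profile d lt c q (\<Union>(X ` {a..<a + n})) ` \<Union>(X ` {a..<a + n}) \<subseteq>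
    profile d lt' c' q (\<Union>(Y ` {b..<b + m})) ` \<Union>(Y ` {b..<b + m})"
proof (rule image_subsetI)
  fix x assume "x \<in> \<Union>(X ` {a..<a + n})"
  then obtain k where k: "a \<le> k" "k < a + n" "x \<in> X k" by auto
  obtain i where i: "k = a + i" "i < n" using k by (metis le_Suc_ex nat_add_left_cancel_less)
  obtain j where j: "j < m" "i = j \<or> 2 ^ q \<le> i + 1 \<and> 2 ^ q \<le> j + 1"
    "n - Suc i = m - Suc j \<or> 2 ^ q \<le> n - Suc i + 1 \<and> 2 ^ q \<le> m - Suc j + 1"
    using power_step[OF nm i(2)] .
  have x: "x \<in> X (a + i)" using k i by simp
  obtain y where y: "y \<in> Y (b + j)" "profile d lt c q (X (a + i)) x = profile d lt' c' q (Y (b + j)) y"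
    using tp_SucE[OF eq x] .
  have up: "{Suc (a + i)..<a + n} = {Suc (a + i)..<Suc (a + i) + (n - Suc i)}"
    "{Suc (b + j)..<b + m} = {Suc (b + j)..<Suc (b + j) + (m - Suc j)}"
    using i j by auto
  have ranges: "a \<le> a + i" "a + i < a + n" "b \<le> b + j" "b + j < b + m" using i j by auto
  have "profile d lt c q (\<Union>(X ` {a..<a + n})) x = profile d lt' c' q (\<Union>(Y ` {b..<b + m})) y"
    unfolding profile_eq_iff lower_interval[OF X x ranges(1,2)] lower_interval[OF Y y(1) ranges(3,4)]
      upper_interval[OF X x ranges(1,2)] upper_interval[OF Y y(1) ranges(3,4)]
  proof (intro conjI)
    show "tp d lt c q (\<Union>(X ` {a..<a + i}) \<union> {z \<in> X (a + i). lt z x}) =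
        tp d lt' c' q (\<Union>(Y ` {b..<b + j}) \<union> {z \<in> Y (b + j). lt' z y})"
      by (rule tp_Un_cong[OF before_part(1)[OF X] before_part(1)[OF Y] IH[OF j(2)]])
        (use y(2) in \<open>auto simp: profile_eq_iff\<close>)
    show "tp d lt c q ({z \<in> X (a + i). lt x z} \<union> \<Union>(X ` {Suc (a + i)..<a + n})) =
        tp d lt' c' q ({z \<in> Y (b + j). lt' y z} \<union> \<Union>(Y ` {Suc (b + j)..<b + m}))"
      unfolding up
      by (rule tp_Un_cong[OF before_part(2)[OF X] before_part(2)[OF Y] _ IH[OF j(3)]])
        (use y(2) in \<open>auto simp: profile_eq_iff\<close>)
    show "min (c x) d = min (c' y) d" using y(2) by (simp add: profile_eq_iff)
  qed
  moreover have "y \<in> \<Union>(Y ` {b..<b + m})" using y(1) j(1) by auto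
  ultimately show "profile d lt c q (\<Union>(X ` {a..<a + n})) x \<in>
      profile d lt' c' q (\<Union>(Y ` {b..<b + m})) ` \<Union>(Y ` {b..<b + m})"
    by blast
qed

lemma tp_power:
  fixes X :: "nat \<Rightarrow> 'a set" and Y :: "nat \<Rightarrow> 'b set"
  assumes "ordered_sum lt (<) UNIV X" "ordered_sum lt' (<) UNIV Y"
    and "\<And>i j. tp d lt c q (X i) = tp d lt' c' q (Y j)"
    and "n = m \<or> 2 ^ q \<le> n + 1 \<and> 2 ^ q \<le> m + (1::nat)"
  shows "tp d lt c q (\<Union>(X ` {a..<a + n})) = tp d lt' c' q (\<Union>(Y ` {b..<b + m}))"
  using assms(3,4)
proof (induction q arbitrary: n m a b)
  case (Suc q)
  have IH: "tp d lt c q (\<Union>(X ` {a..<a + n})) = tp d lt' c' q (\<Union>(Y ` {b..<b + m}))"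
    if "n = m \<or> 2 ^ q \<le> n + 1 \<and> 2 ^ q \<le> m + (1::nat)" for n m a b
    using Suc.IH[OF tp_Suc_eqD[OF Suc.prems(1)] that] .
  have nm: "m = n \<or> 2 ^ Suc q \<le> m + 1 \<and> 2 ^ Suc q \<le> n + (1::nat)" using Suc.prems(2) by auto
  show ?case
    unfolding tp_Suc_eq_iff
  proof
    show "profile d lt c q (\<Union>(X ` {a..<a + n})) ` \<Union>(X ` {a..<a + n}) \<subseteq>
        profile d lt' c' q (\<Union>(Y ` {b..<b + m})) ` \<Union>(Y ` {b..<b + m})"
      by (rule profile_power_subset[OF assms(1,2) Suc.prems(1) IH Suc.prems(2)])
    show "profile d lt' c' q (\<Union>(Y ` {b..<b + m})) ` \<Union>(Y ` {b..<b + m}) \<subseteq>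
        profile d lt c q (\<Union>(X ` {a..<a + n})) ` \<Union>(X ` {a..<a + n})"
    proof (rule profile_power_subset[OF assms(2,1) Suc.prems(1)[symmetric] _ nm])
      fix n m a b assume "n = m \<or> 2 ^ q \<le> n + 1 \<and> 2 ^ q \<le> m + (1::nat)"
      then have "m = n \<or> 2 ^ q \<le> m + 1 \<and> 2 ^ q \<le> n + (1::nat)" by blast
      then show "tp d lt' c' q (\<Union>(Y ` {a..<a + n})) = tp d lt c q (\<Union>(X ` {b..<b + m}))"
        by (rule IH[symmetric])
    qed
  qed
qed simp

context types
begin

text \<open>First-order types cannot count modulo anything: the powers of an element stabilize
  instead of entering a longer cycle.\<close>

lemma tp_prod_aperiodic:
  assumes "s \<in> realizable" "2 ^ q \<le> n + 1"
  shows "tp_prod (\<lambda>_. s) (Suc n) = tp_prod (\<lambda>_. s) n"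
proof -
  obtain lt c and X :: "nat \<Rightarrow> nat set"
    where X: "\<And>i. tp d lt c q (X i) = s" "ordered_sum lt (<) UNIV X"
    using realize[of "\<lambda>_. s", OF assms(1)] by blast
  have "tp d lt c q (\<Union>(X ` {0..<0 + Suc n})) = tp d lt c q (\<Union>(X ` {0..<0 + n}))"
    by (rule tp_power[OF X(2,2)]) (use X(1) assms(2) in auto)
  then show ?thesis
    using tp_UN_prod[OF X(2), of c "\<lambda>_. s", OF X(1)] assms(1) unfolding lessThan_atLeast0 by simp
qed

end

section \<open>Stability of the types of powers of omega\<close>

context types
begin

definition set_mult :: "nat set \<Rightarrow> nat set \<Rightarrow> nat set" where
  "set_mult A B = {tp_mult a b | a b. a \<in> A \<and> b \<in> B}"

definition set_omega :: "nat set \<Rightarrow> nat set" where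
  "set_omega A = {tp_omega f | f. \<forall>i. f i \<in> A}"

text \<open>\<open>power_types n\<close> is the set of types of colorings of \<open>\<omega>\<^sup>n\<close>.\<close>

primrec power_types :: "nat \<Rightarrow> nat set" where
  "power_types 0 = {tp d (\<lambda>_ _. False) (\<lambda>_. i) q {0 :: nat} | i. i < d}"
| "power_types (Suc n) = set_omega (power_types n)"

lemma set_omega_subset: "A \<subseteq> realizable \<Longrightarrow> set_omega A \<subseteq> realizable"
  unfolding set_omega_def by (auto intro!: tp_omega_realizable)

lemma power_types_subset: "power_types n \<subseteq> realizable"
proof (induction n)
  case 0
  then show ?case using tp_realizable by auto
qed (simp add: set_omega_subset)

lemma set_mult_assoc:
  assumes "A \<subseteq> realizable" "B \<subseteq> realizable" "C \<subseteq> realizable"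
  shows "set_mult (set_mult A B) C = set_mult A (set_mult B C)"
proof -
  have *: "tp_mult (tp_mult a b) c = tp_mult a (tp_mult b c)" if "a \<in> A" "b \<in> B" "c \<in> C" for a b c
    using tp_mult_assoc[of a b c] that assms by blast
  show ?thesis
  proof (intro subset_antisym subsetI)
    fix x assume "x \<in> set_mult (set_mult A B) C"
    then obtain a b c where "a \<in> A" "b \<in> B" "c \<in> C" "x = tp_mult (tp_mult a b) c" unfolding set_mult_def by blast
    then show "x \<in> set_mult A (set_mult B C)" unfolding set_mult_def using * by blast
  next
    fix x assume "x \<in> set_mult A (set_mult B C)"
    then obtain a b c where abc: "a \<in> A" "b \<in> B" "c \<in> C" "x = tp_mult a (tp_mult b c)" unfolding set_mult_def by blast
    then have "x = tp_mult (tp_mult a b) c" using * by simp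
    then show "x \<in> set_mult (set_mult A B) C" unfolding set_mult_def using abc by blast
  qed
qed

text \<open>\<open>tp_omega_swap\<close> lifted to sets, which is why that lemma allows varying
  factors. For the second inclusion the leading factor \<open>a0\<close> is put in front of the
  sequence of the \<open>a i\<close>.\<close>

lemma set_omega_set_mult:
  assumes "A \<subseteq> realizable" "B \<subseteq> realizable"
  shows "set_omega (set_mult A B) = set_mult A (set_omega (set_mult B A))"
proof (intro subset_antisym subsetI)
  fix x assume "x \<in> set_omega (set_mult A B)"
  then obtain f where f: "x = tp_omega f" "\<And>i. f i \<in> set_mult A B" unfolding set_omega_def by blast
  have "\<forall>i. \<exists>a b. f i = tp_mult a b \<and> a \<in> A \<and> b \<in> B" using f(2) unfolding set_mult_def by blast
  then obtain a b where ab: "\<And>i. f i = tp_mult (a i) (b i)" "\<And>i. a i \<in> A" "\<And>i. b i \<in> B" by metis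
  have "f = (\<lambda>i. tp_mult (a i) (b i))" using ab(1) by blast
  then have "x = tp_mult (a 0) (tp_omega (\<lambda>i. tp_mult (b i) (a (Suc i))))"
    unfolding f(1) using tp_omega_swap[of a b] ab(2,3) assms by blast
  then show "x \<in> set_mult A (set_omega (set_mult B A))" unfolding set_mult_def set_omega_def using ab(2,3) by blast
next
  fix x assume "x \<in> set_mult A (set_omega (set_mult B A))"
  then obtain a0 f where f: "x = tp_mult a0 (tp_omega f)" "a0 \<in> A" "\<And>i. f i \<in> set_mult B A"
    unfolding set_mult_def set_omega_def by blast
  have "\<forall>i. \<exists>b a. f i = tp_mult b a \<and> b \<in> B \<and> a \<in> A" using f(3) unfolding set_mult_def by blast
  then obtain b a where ab: "\<And>i. f i = tp_mult (b i) (a i)" "\<And>i. b i \<in> B" "\<And>i. a i \<in> A" by metis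
  define a' where "a' i = (case i of 0 \<Rightarrow> a0 | Suc j \<Rightarrow> a j)" for i
  have a': "a' i \<in> A" for i using f(2) ab(3) by (simp add: a'_def split: nat.split)
  have "f = (\<lambda>i. tp_mult (b i) (a' (Suc i)))" "a' 0 = a0" using ab(1) by (auto simp: a'_def)
  then have "x = tp_omega (\<lambda>i. tp_mult (a' i) (b i))"
    unfolding f(1) using tp_omega_swap[of a' b] a' ab(2) assms by (metis subsetD)
  then show "x \<in> set_omega (set_mult A B)" unfolding set_mult_def set_omega_def using a' ab(2) by blast
qed

lemma set_mult_set_omega:
  assumes "A \<subseteq> realizable"
  shows "set_mult A (set_omega A) = set_omega A"
proof (intro subset_antisym subsetI)
  fix x assume "x \<in> set_mult A (set_omega A)"
  then obtain a0 f where f: "x = tp_mult a0 (tp_omega f)" "a0 \<in> A" "\<And>i. f i \<in> A"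
    unfolding set_mult_def set_omega_def by blast
  define f' where "f' i = (case i of 0 \<Rightarrow> a0 | Suc j \<Rightarrow> f j)" for i
  have f': "f' i \<in> A" for i using f by (simp add: f'_def split: nat.split)
  have "tp_omega f' = tp_mult (f' 0) (tp_omega (\<lambda>i. f' (Suc i)))" by (rule tp_omega_Suc) (use f' assms in blast)
  then have "x = tp_omega f'" unfolding f(1) by (simp add: f'_def)
  then show "x \<in> set_omega A" unfolding set_omega_def using f' by blast
next
  fix x assume "x \<in> set_omega A"
  then obtain f where f: "x = tp_omega f" "\<And>i. f i \<in> A" unfolding set_omega_def by blast
  then have "x = tp_mult (f 0) (tp_omega (\<lambda>i. f (Suc i)))" using tp_omega_Suc[of f] assms by blast
  then show "x \<in> set_mult A (set_omega A)" unfolding set_mult_def set_omega_def using f(2) by blast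
qed

text \<open>The counterpart of omega^n + omega^m = omega^m for n < m.\<close>

lemma power_types_absorb:
  assumes "n < m"
  shows "set_mult (power_types n) (power_types m) = power_types m"
  using assms
proof (induction m)
  case (Suc m)
  show ?case
  proof (cases "n = m")
    case True
    then show ?thesis using set_mult_set_omega[OF power_types_subset] by simp
  next
    case False
    then have IH: "set_mult (power_types n) (power_types m) = power_types m" using Suc by simp
    have "set_mult (power_types n) (power_types (Suc m)) = set_mult (power_types n) (set_mult (power_types m) (power_types (Suc m)))"
      using set_mult_set_omega[OF power_types_subset] by simp
    also have "\<dots> = set_mult (set_mult (power_types n) (power_types m)) (power_types (Suc m))"
      by (rule set_mult_assoc[symmetric]) (rule power_types_subset)+
    also have "\<dots> = power_types (Suc m)" unfolding IH using set_mult_set_omega[OF power_types_subset] by simp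
    finally show ?thesis .
  qed
qed simp

text \<open>Two equal members give a period \<open>p\<close> from index \<open>i\<close> on, hence
  absorption in both directions between \<open>power_types i\<close> and
  \<open>power_types (Suc i)\<close>. Swapping factors under the omega-product then shows that
  \<open>N = Suc i\<close> works.\<close>

lemma power_types_stable:
  obtains N where "set_omega (power_types N) = power_types N" "set_mult (power_types N) (power_types N) = power_types N"
proof -
  have "\<not> inj power_types"
  proof
    assume "inj power_types"
    moreover have "finite (range power_types)"
      by (rule finite_subset[of _ "Pow realizable"]) (use power_types_subset finite_realizable in auto)
    ultimately show False using finite_imageD by blast
  qed
  then obtain i j where ij: "i < j" "power_types i = power_types j"
    unfolding inj_def by (metis linorder_neqE_nat)
  obtain p where p: "j = i + p" "p > 0" using ij(1) less_imp_add_positive by blast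
  have per: "power_types (i + k) = power_types (i + k + p)" for k
    by (induction k) (use ij(2) p in auto)
  have per': "power_types m = power_types (m + k * p)" if "m \<ge> i" for m k
  proof (induction k)
    case (Suc k)
    have "power_types (m + k * p) = power_types (m + k * p + p)" using per[of "m + k * p - i"] that by simp
    then show ?case using Suc by (simp add: algebra_simps)
  qed simp
  have ab: "set_mult (power_types n) (power_types m) = power_types m" if "m \<ge> i" for n m
  proof -
    \<comment> \<open>Going \<open>Suc n\<close> periods ahead does not change the right factor and
      brings its index above \<open>n\<close>.\<close>
    have "n < m + Suc n * p" using p(2) by (cases p) auto
    then show ?thesis using power_types_absorb per'[OF that, of "Suc n"] by metis
  qed
  \<comment> \<open>Let A and B be the sets with index \<open>i\<close> and \<open>Suc i\<close>.
    Omega-products of B = AB are A times omega-products of BA = A; the latter form B, and AB =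
    B.\<close>
  have "set_omega (power_types (Suc i)) = set_omega (set_mult (power_types i) (power_types (Suc i)))" using ab[of "Suc i" i] by simp
  also have "\<dots> = set_mult (power_types i) (set_omega (set_mult (power_types (Suc i)) (power_types i)))"
    by (rule set_omega_set_mult) (rule power_types_subset)+
  also have "\<dots> = set_mult (power_types i) (power_types (Suc i))" using ab[of i "Suc i"] by simp
  also have "\<dots> = power_types (Suc i)" by (rule ab) simp
  finally show thesis using ab[of "Suc i" "Suc i"] that[of "Suc i"] by simp
qed

text \<open>
  The \<open>x k\<close> form a cycle under \<open>x \<mapsto> s x\<^sup>\<omega>\<close>. Unrolling the cycle writes \<open>x k\<close> as \<open>S\<^sup>m V\<^sup>m\<close> with \<open>V\<close> a
  product of the \<open>x\<^sup>\<omega>\<close> over one period, so aperiodicity lets \<open>x k\<close> absorb \<open>V\<close>.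
\<close>

lemma tp_omega_fixed_on_cycle:
  assumes x: "\<And>k. x k \<in> realizable"
    and s: "\<And>k. s k \<in> realizable" "\<And>k. x k = tp_mult (s k) (tp_omega (\<lambda>_. x (Suc k)))"
    and p: "p > 0" "\<And>k. x (k + p) = x k"
  shows "tp_omega (\<lambda>_. x k) = x k"
proof -
  \<comment> \<open>\<open>V k n\<close> is \<open>u (k+n) ... u (k+1)\<close> with falling indices,
    \<open>S k n\<close> is \<open>s k ... s (k+n-1)\<close>.\<close>
  define u where "u k = tp_omega (\<lambda>_. x k)" for k
  define V where "V k n = rec_nat tp_none (\<lambda>n v. tp_mult (u (k + Suc n)) v) n" for k n
  define S where "S k n = rec_nat tp_none (\<lambda>n v. tp_mult v (s (k + n))) n" for k n
  have V: "V k 0 = tp_none" "V k (Suc n) = tp_mult (u (k + Suc n)) (V k n)" for k n by (simp_all add: V_def)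
  have S: "S k 0 = tp_none" "S k (Suc n) = tp_mult (S k n) (s (k + n))" for k n by (simp_all add: S_def)
  have xT [simp]: "x k \<in> realizable" and sT [simp]: "s k \<in> realizable" for k using x s(1) by blast+
  have uT [simp]: "u k \<in> realizable" for k unfolding u_def by (rule tp_omega_realizable) simp
  have VT [simp]: "V k n \<in> realizable" for k n by (induction n) (auto simp: V tp_none_realizable tp_mult_realizable)
  have ST [simp]: "S k n \<in> realizable" for k n by (induction n) (auto simp: S tp_none_realizable tp_mult_realizable)
  have xs: "x k = tp_mult (s k) (u (Suc k))" for k unfolding u_def by (rule s(2))
  have xu: "tp_mult (x k) (u k) = u k" for k
    unfolding u_def by (rule tp_omega_Suc[of "\<lambda>_. x k", symmetric]) simp
  have up: "u (k + p) = u k" for k by (simp add: u_def p)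
  \<comment> \<open>Since \<open>u j = x j u j\<close> and \<open>x j = s j u (j+1)\<close>, the
    first factor \<open>u j\<close> of \<open>V\<close> can be replaced by
    \<open>s j u (j+1) u j\<close>, which lengthens \<open>S\<close> and \<open>V\<close> by one
    factor each.\<close>
  have xSV: "x k = tp_mult (S k (Suc n)) (V k (Suc n))" for k n
  proof (induction n)
    case 0
    show ?case using xs[of k] by (simp add: S V tp_mult_none_left tp_mult_none_right)
  next
    case (Suc n)
    have "u (k + Suc n) = tp_mult (tp_mult (s (k + Suc n)) (u (Suc (k + Suc n)))) (u (k + Suc n))"
      using xu[of "k + Suc n"] xs[of "k + Suc n"] by simp
    then have "V k (Suc n) = tp_mult (tp_mult (tp_mult (s (k + Suc n)) (u (Suc (k + Suc n)))) (u (k + Suc n))) (V k n)"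
      unfolding V(2)[of k n] by (rule arg_cong2[where f = tp_mult, OF _ refl])
    also have "\<dots> = tp_mult (s (k + Suc n)) (V k (Suc (Suc n)))"
      by (simp add: V tp_mult_assoc tp_mult_realizable)
    finally have eq: "V k (Suc n) = tp_mult (s (k + Suc n)) (V k (Suc (Suc n)))" .
    have "x k = tp_mult (S k (Suc n)) (tp_mult (s (k + Suc n)) (V k (Suc (Suc n))))"
      using Suc unfolding eq .
    then show ?case by (simp add: S(2)[of k "Suc n"] tp_mult_assoc)
  qed
  have V_add: "V k (a + b) = tp_mult (V (k + a) b) (V k a)" for k a b
    by (induction b) (simp_all add: V tp_mult_none_left tp_mult_assoc add.assoc)
  have V_per: "V (k + p) n = V k n" for k n
  proof (induction n)
    case (Suc n)
    have "u (k + p + Suc n) = u (k + Suc n)" using up[of "k + Suc n"] by (simp add: add_ac)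
    then show ?case using Suc by (simp add: V)
  qed (simp add: V)
  have V_pow: "V k (m * p) = tp_prod (\<lambda>_. V k p) m" for k m
  proof (induction m)
    case (Suc m)
    have "V k (Suc m * p) = tp_mult (V (k + p) (m * p)) (V k p)" using V_add[of k p "m * p"] by simp
    then show ?case using Suc by (simp add: V_per)
  qed (simp add: V)
  \<comment> \<open>Let V be \<open>V k p\<close>. Over \<open>m\<close> periods, with
    \<open>m\<close> beyond the threshold of aperiodicity, the right factor V^m absorbs one more V,
    so \<open>x k\<close> V = \<open>x k\<close>. But V begins with \<open>u (k+p) = u k\<close>,
    and \<open>x k u k = u k\<close>, so \<open>x k\<close> V = V.\<close>
  have xV: "x k = V k p" for k
  proof -
    obtain m :: nat where m: "m > 0" "2 ^ q \<le> m + 1"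
      by (rule that[of "2 ^ q"]) auto
    obtain n where n: "m * p = Suc n" using m(1) p(1) by (metis mult_pos_pos not0_implies_Suc less_numeral_extra(3))
    have xm: "x k = tp_mult (S k (m * p)) (V k (m * p))" using xSV[of k n] n by simp
    have "tp_mult (x k) (V k p) = tp_mult (S k (m * p)) (tp_mult (V k (m * p)) (V k p))"
      by (subst xm) (simp add: tp_mult_assoc)
    also have "tp_mult (V k (m * p)) (V k p) = V k (m * p)"
      unfolding V_pow using tp_prod_aperiodic[OF VT[of k p] m(2)] by simp
    finally have 1: "tp_mult (x k) (V k p) = x k" using xm by simp
    obtain p' where p': "p = Suc p'" using p(1) gr0_implies_Suc by blast
    have V1: "V k p = tp_mult (u k) (V k p')" using up[of k] unfolding p' by (simp add: V)
    have "tp_mult (x k) (V k p) = tp_mult (tp_mult (x k) (u k)) (V k p')" unfolding V1 by (simp add: tp_mult_assoc)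
    then have "tp_mult (x k) (V k p) = V k p" unfolding xu V1 .
    with 1 show ?thesis by simp
  qed
  \<comment> \<open>Write \<open>x (k+1) = u (k+1) W\<close>. By the swap, \<open>u (k+1)\<close>
    equals \<open>u (k+1)\<close> times the omega-power of \<open>W u (k+1)\<close>, and
    \<open>W u (k+1)\<close> is \<open>V k p = x k\<close>.\<close>
  have uu: "u (Suc k) = tp_mult (u (Suc k)) (u k)" for k
  proof -
    obtain p' where p': "p = Suc p'" using p(1) gr0_implies_Suc by blast
    have "x (Suc k) = tp_mult (u (Suc k)) (V (Suc k) p')"
      using xV[of "Suc k"] up[of "Suc k"] unfolding p' by (simp add: V)
    then have "tp_omega (\<lambda>_. x (Suc k)) = tp_omega (\<lambda>_. tp_mult (u (Suc k)) (V (Suc k) p'))"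
      by (rule arg_cong[where f = "\<lambda>v. tp_omega (\<lambda>_. v)"])
    then have "u (Suc k) = tp_omega (\<lambda>_. tp_mult (u (Suc k)) (V (Suc k) p'))" unfolding u_def[of "Suc k"] .
    also have "\<dots> = tp_mult (u (Suc k)) (tp_omega (\<lambda>_. tp_mult (V (Suc k) p') (u (Suc k))))"
      by (rule tp_omega_swap) simp_all
    also have "tp_mult (V (Suc k) p') (u (Suc k)) = x k"
      using V_add[of k 1 p'] xV[of k] unfolding p' by (simp add: V tp_mult_none_right)
    finally show ?thesis unfolding u_def[of k] .
  qed
  \<comment> \<open>Each factor of \<open>V\<close> absorbs its right neighbor, so
    \<open>V k p\<close> collapses to its first factor \<open>u (k+p) = u k\<close>.\<close>
  have uV: "u (k + Suc n) = V k (Suc n)" for k n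
  proof (induction n)
    case 0
    then show ?case by (simp add: V tp_mult_none_right)
  next
    case (Suc n)
    then show ?case using uu[of "k + Suc n"] V(2)[of k "Suc n"] by simp
  qed
  obtain p' where p': "p = Suc p'" using p(1) gr0_implies_Suc by blast
  have "u k = x k" using uV[of k p'] up[of k] xV[of k] unfolding p' by simp
  then show ?thesis unfolding u_def .
qed

text \<open>As \<open>\<tau>\<close> is a function, its iteration from \<open>e\<close> runs into a
  cycle in the finite set of types. There \<open>tp_omega_fixed_on_cycle\<close> strengthens
  idempotence to t^omega = t, and every later member of the orbit is a two-sided factor of
  \<open>e\<close>.\<close>

lemma factor_through_fixed_type:
  assumes E: "E \<subseteq> realizable" "set_mult E E = E" "set_omega E = E" and e: "e \<in> E"
  obtains a t b where "a \<in> E" "t \<in> E" "b \<in> E" "tp_mult t t = t" "tp_omega (\<lambda>_. t) = t" "e = tp_mult (tp_mult a t) b"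
proof -
  have ml_E: "tp_mult s t \<in> E" if "s \<in> E" "t \<in> E" for s t using E(2) that unfolding set_mult_def by blast
  have Om_E: "tp_omega f \<in> E" if "\<And>i. f i \<in> E" for f using E(3) that unfolding set_omega_def by blast
  have ET: "x \<in> realizable" if "x \<in> E" for x using that E(1) by blast
  have "\<exists>s t. s \<in> E \<and> t \<in> E \<and> tp_mult t t = t \<and> x = tp_mult s (tp_omega (\<lambda>_. t))" if "x \<in> E" for x
  proof -
    have "x \<in> set_omega E" using that E(3) by simp
    then obtain f where f: "x = tp_omega f" "\<And>i. f i \<in> E" unfolding set_omega_def by blast
    obtain s t where "s \<in> E" "t \<in> E" "tp_mult t t = t" "tp_omega f = tp_mult s (tp_omega (\<lambda>_. t))"
      by (rule tp_omega_Ramsey[OF f(2) E(1) ml_E])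
    then show ?thesis unfolding f(1) by blast
  qed
  then obtain \<sigma> \<tau> where st: "\<And>x. x \<in> E \<Longrightarrow> \<sigma> x \<in> E" "\<And>x. x \<in> E \<Longrightarrow> \<tau> x \<in> E"
    "\<And>x. x \<in> E \<Longrightarrow> tp_mult (\<tau> x) (\<tau> x) = \<tau> x" "\<And>x. x \<in> E \<Longrightarrow> x = tp_mult (\<sigma> x) (tp_omega (\<lambda>_. \<tau> x))"
    by metis
  define y where "y k = (\<tau> ^^ k) e" for k
  have y: "y 0 = e" "y (Suc k) = \<tau> (y k)" for k by (simp_all add: y_def)
  have yE: "y k \<in> E" for k by (induction k) (auto simp: y e st)
  \<comment> \<open>Unfolding one factor of the omega-power exposes the next member of the orbit:
    \<open>y k\<close> is \<open>\<sigma> (y k) y (k+1)\<close> times the omega-power of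
    \<open>y (k+1)\<close>. Substitution moves the factorization of \<open>e\<close> one step along
    the orbit.\<close>
  have fac: "\<exists>a b. a \<in> E \<and> b \<in> E \<and> e = tp_mult (tp_mult a (y (Suc k))) b" for k
  proof (induction k)
    case 0
    have "tp_omega (\<lambda>_. \<tau> e) = tp_mult (\<tau> e) (tp_omega (\<lambda>_. \<tau> e))"
      by (rule tp_omega_Suc) (use ET st(2) e in blast)
    moreover have "e = tp_mult (\<sigma> e) (tp_omega (\<lambda>_. \<tau> e))" using st(4)[OF e] .
    ultimately have "e = tp_mult (\<sigma> e) (tp_mult (\<tau> e) (tp_omega (\<lambda>_. \<tau> e)))" by metis
    also have "\<dots> = tp_mult (tp_mult (\<sigma> e) (\<tau> e)) (tp_omega (\<lambda>_. \<tau> e))"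
      by (rule tp_mult_assoc[symmetric]) (use ET st(1,2)[OF e] Om_E in auto)
    finally have "e = tp_mult (tp_mult (\<sigma> e) (\<tau> e)) (tp_omega (\<lambda>_. \<tau> e))" .
    then show ?case using st(1,2)[OF e] Om_E[of "\<lambda>_. \<tau> e"] y by auto
  next
    case (Suc k)
    then obtain a b where ab: "a \<in> E" "b \<in> E" "e = tp_mult (tp_mult a (y (Suc k))) b" by blast
    let ?y = "y (Suc k)" and ?z = "y (Suc (Suc k))"
    have z: "?z \<in> E" "\<sigma> ?y \<in> E" "tp_omega (\<lambda>_. ?z) \<in> E" using yE st(1) Om_E by auto
    have "tp_omega (\<lambda>_. ?z) = tp_mult ?z (tp_omega (\<lambda>_. ?z))"
      by (rule tp_omega_Suc) (use ET z in blast)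
    moreover have "?y = tp_mult (\<sigma> ?y) (tp_omega (\<lambda>_. ?z))"
      unfolding y(2)[of "Suc k"] by (rule st(4)[OF yE])
    ultimately have "?y = tp_mult (\<sigma> ?y) (tp_mult ?z (tp_omega (\<lambda>_. ?z)))" by metis
    then have "e = tp_mult (tp_mult a (tp_mult (\<sigma> ?y) (tp_mult ?z (tp_omega (\<lambda>_. ?z))))) b" using ab(3) by metis
    also have "\<dots> = tp_mult (tp_mult (tp_mult a (\<sigma> ?y)) ?z) (tp_mult (tp_omega (\<lambda>_. ?z)) b)"
      using ab(1,2) z ET by (simp add: tp_mult_assoc tp_mult_realizable)
    finally have "e = tp_mult (tp_mult (tp_mult a (\<sigma> ?y)) ?z) (tp_mult (tp_omega (\<lambda>_. ?z)) b)" .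
    then show ?case using ml_E ab z by blast
  qed
  \<comment> \<open>Only indices from 1 on are used: \<open>y 0 = e\<close> need not be
    idempotent.\<close>
  obtain i p where p: "p > 0" "y (Suc (i + p)) = y (Suc i)"
  proof -
    have "\<not> inj (\<lambda>k. y (Suc k))"
    proof
      assume "inj (\<lambda>k. y (Suc k))"
      moreover have "finite (range (\<lambda>k. y (Suc k)))"
        by (rule finite_subset[OF _ finite_realizable]) (use yE ET in auto)
      ultimately show False using finite_imageD by blast
    qed
    then obtain i j where "i < j" "y (Suc i) = y (Suc j)"
      unfolding inj_def by (metis linorder_neqE_nat)
    then show thesis using that less_imp_add_positive by metis
  qed
  have idem: "tp_mult (y (Suc k)) (y (Suc k)) = y (Suc k)" for k using st(3)[OF yE] y by simp
  have Om_y: "tp_omega (\<lambda>_. y (Suc i)) = y (Suc i)"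
  proof -
    have per: "y (Suc (i + k + p)) = y (Suc (i + k))" for k
    proof (induction k)
      case (Suc k)
      then show ?case using y(2)[of "Suc (i + k + p)"] y(2)[of "Suc (i + k)"] by simp
    qed (use p in simp)
    have "tp_omega (\<lambda>_. y (Suc (i + 0))) = y (Suc (i + 0))"
    proof (rule tp_omega_fixed_on_cycle[where x = "\<lambda>k. y (Suc (i + k))" and s = "\<lambda>k. \<sigma> (y (Suc (i + k)))" and p = p])
      show "y (Suc (i + k)) = tp_mult (\<sigma> (y (Suc (i + k)))) (tp_omega (\<lambda>_. y (Suc (i + Suc k))))" for k
        using st(4)[OF yE[of "Suc (i + k)"]] unfolding y(2)[of "Suc (i + k)", symmetric] by simp
      show "y (Suc (i + (k + p))) = y (Suc (i + k))" for k using per[of k] by (simp add: add.assoc)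
    qed (use ET yE st(1) p(1) in auto)
    then show ?thesis by simp
  qed
  show thesis using fac[of i] that yE idem Om_y by blast
qed

end

section \<open>Well-ordered sums\<close>

lemma WO_trans: "Well_order r \<Longrightarrow> (x, y) \<in> r \<Longrightarrow> (y, z) \<in> r \<Longrightarrow> (x, z) \<in> r"
  unfolding well_order_on_def linear_order_on_def partial_order_on_def preorder_on_def
  by (meson transD)

lemma WO_antisym: "Well_order r \<Longrightarrow> (x, y) \<in> r \<Longrightarrow> (y, x) \<in> r \<Longrightarrow> x = y"
  unfolding well_order_on_def linear_order_on_def partial_order_on_def by (meson antisymD)

lemma WO_refl: "Well_order r \<Longrightarrow> x \<in> Field r \<Longrightarrow> (x, x) \<in> r"
  unfolding well_order_on_def linear_order_on_def partial_order_on_def preorder_on_def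
  by (meson refl_onD)

lemma WO_wf: "Well_order r \<Longrightarrow> wf (r - Id)"
  unfolding well_order_on_def by blast

lemma WO_not_less:
  "Well_order r \<Longrightarrow> x \<in> Field r \<Longrightarrow> y \<in> Field r \<Longrightarrow> \<not> strict r x y \<longleftrightarrow> (y, x) \<in> r"
  using strict_linear[of r x y] WO_antisym[of r x y] WO_refl[of r x] by auto

lemma WO_less_le_trans: "Well_order r \<Longrightarrow> strict r x y \<Longrightarrow> (y, z) \<in> r \<Longrightarrow> strict r x z"
  using WO_trans[of r x y z] WO_antisym[of r x y] by blast

lemma WO_le_less_trans: "Well_order r \<Longrightarrow> (x, y) \<in> r \<Longrightarrow> strict r y z \<Longrightarrow> strict r x z"
  using WO_trans[of r x y z] WO_antisym[of r y z] by blast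

lemma WO_less_trans: "Well_order r \<Longrightarrow> strict r x y \<Longrightarrow> strict r y z \<Longrightarrow> strict r x z"
  by (rule WO_less_le_trans) auto

lemma WO_least:
  assumes "Well_order r" "K \<subseteq> Field r" "K \<noteq> {}"
  obtains k where "k \<in> K" "\<And>j. j \<in> K \<Longrightarrow> (k, j) \<in> r"
proof -
  obtain k where k: "k \<in> K" "\<And>y. (y, k) \<in> r - Id \<Longrightarrow> y \<notin> K"
    using wfE_min'[OF WO_wf[OF assms(1)] assms(3)] by blast
  have "(k, j) \<in> r" if "j \<in> K" for j
    using k(2)[of j] WO_not_less[OF assms(1), of j k] assms(2) that k(1) by auto
  with k(1) show thesis using that by blast
qed

text \<open>In contrast to \<open>lower_sum\<close>, the cut shrinks the index set and keeps the
  summands, since now sums over different index sets are compared.\<close>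

lemma lower_UN:
  assumes "ordered_sum lt il I X" "K \<subseteq> I" "k \<in> K" "x \<in> X k" "\<not> il k k"
  shows "{z \<in> \<Union>(X ` K). lt z x} = \<Union>(X ` {j \<in> K. il j k}) \<union> {z \<in> X k. lt z x}"
proof (rule set_eqI)
  fix z
  have *: "lt z x \<longleftrightarrow> il j k" if "j \<in> K" "j \<noteq> k" "z \<in> X j" for j
    using ordered_sumD[OF assms(1) _ _ that(2,3) assms(4)] that(1) assms(2,3) by blast
  show "z \<in> {z \<in> \<Union>(X ` K). lt z x} \<longleftrightarrow> z \<in> \<Union>(X ` {j \<in> K. il j k}) \<union> {z \<in> X k. lt z x}"
    (is "?L \<longleftrightarrow> ?R")
  proof
    assume ?L
    then obtain j where j: "j \<in> K" "z \<in> X j" "lt z x" by blast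
    then show ?R using *[of j] by (cases "j = k") auto
  next
    assume ?R
    then consider j where "j \<in> K" "il j k" "z \<in> X j" | "z \<in> X k" "lt z x" by blast
    then show ?L
    proof cases
      case 1
      then have "lt z x" using *[of j] assms(5) by auto
      then show ?thesis using 1 by blast
    qed (use assms(3) in blast)
  qed
qed

lemma upper_UN:
  assumes "ordered_sum lt il I X" "K \<subseteq> I" "k \<in> K" "x \<in> X k" "\<not> il k k"
  shows "{z \<in> \<Union>(X ` K). lt x z} = {z \<in> X k. lt x z} \<union> \<Union>(X ` {j \<in> K. il k j})"
proof (rule set_eqI)
  fix z
  have *: "lt x z \<longleftrightarrow> il k j" if "j \<in> K" "k \<noteq> j" "z \<in> X j" for j
    using ordered_sumD[OF assms(1) _ _ that(2) assms(4) that(3)] that(1) assms(2,3) by blast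
  show "z \<in> {z \<in> \<Union>(X ` K). lt x z} \<longleftrightarrow> z \<in> {z \<in> X k. lt x z} \<union> \<Union>(X ` {j \<in> K. il k j})"
    (is "?L \<longleftrightarrow> ?R")
  proof
    assume ?L
    then obtain j where j: "j \<in> K" "z \<in> X j" "lt x z" by blast
    then show ?R using *[of j] by (cases "j = k") auto
  next
    assume ?R
    then consider j where "j \<in> K" "il k j" "z \<in> X j" | "z \<in> X k" "lt x z" by blast
    then show ?L
    proof cases
      case 1
      then have "lt x z" using *[of j] assms(5) by auto
      then show ?thesis using 1 by blast
    qed (use assms(3) in blast)
  qed
qed

lemma before_UN_strict:
  assumes r: "Well_order r" and X: "ordered_sum lt (strict r) I X" and KL: "K \<subseteq> I" "L \<subseteq> I"
    and less: "\<And>i j. i \<in> K \<Longrightarrow> j \<in> L \<Longrightarrow> strict r i j"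
    and sub: "\<And>i. i \<in> K \<Longrightarrow> A i \<subseteq> X i" "\<And>i. i \<in> L \<Longrightarrow> B i \<subseteq> X i"
  shows "before lt (\<Union>(A ` K)) (\<Union>(B ` L))"
proof (rule before_UN)
  fix i j assume ij: "i \<in> K" "j \<in> L"
  have "strict r i j" "\<not> strict r j i" using less[OF ij] strict_asym[OF r] by blast+
  then show "before lt (A i) (B j)"
    unfolding before_def
  proof (intro ballI)
    fix x y assume "x \<in> A i" "y \<in> B j"
    then have xy: "x \<in> X i" "y \<in> X j" using sub ij by blast+
    have IJ: "i \<in> I" "j \<in> I" "i \<noteq> j" "j \<noteq> i" using ij KL \<open>strict r i j\<close> by blast+
    have "lt x y \<longleftrightarrow> strict r i j" by (rule ordered_sumD[OF X IJ(1,2,3) xy])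
    moreover have "lt y x \<longleftrightarrow> strict r j i" by (rule ordered_sumD[OF X IJ(2,1,4) xy(2,1)])
    ultimately show "lt x y \<and> \<not> lt y x" using \<open>strict r i j\<close> \<open>\<not> strict r j i\<close> by blast
  qed
qed

lemma profile_UN_eq:
  assumes r: "Well_order r" and X: "ordered_sum lt (strict r) I X" and K: "K \<subseteq> I" "K' \<subseteq> I"
    and k: "k \<in> K" "x \<in> X k" "k' \<in> K'" "x' \<in> X k'"
    and eq: "profile d lt c q (X k) x = profile d lt c q (X k') x'"
    and lo: "tp d lt c q (\<Union>(X ` {j \<in> K. strict r j k})) = tp d lt c q (\<Union>(X ` {j \<in> K'. strict r j k'}))"
    and hi: "tp d lt c q (\<Union>(X ` {j \<in> K. strict r k j})) = tp d lt c q (\<Union>(X ` {j \<in> K'. strict r k' j}))"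
  shows "profile d lt c q (\<Union>(X ` K)) x = profile d lt c q (\<Union>(X ` K')) x'"
proof -
  have b1: "before lt (\<Union>(X ` {j \<in> L. strict r j l})) {z \<in> X l. lt z y}" if "L \<subseteq> I" "l \<in> L" for L l y
  proof -
    have "before lt (\<Union>(X ` {j \<in> L. strict r j l})) (\<Union>((\<lambda>i. {z \<in> X i. lt z y}) ` {l}))"
      by (rule before_UN_strict[OF r X]) (use that in blast)+
    then show ?thesis by simp
  qed
  have b2: "before lt {z \<in> X l. lt y z} (\<Union>(X ` {j \<in> L. strict r l j}))" if "L \<subseteq> I" "l \<in> L" for L l y
  proof -
    have "before lt (\<Union>((\<lambda>i. {z \<in> X i. lt y z}) ` {l})) (\<Union>(X ` {j \<in> L. strict r l j}))"
      by (rule before_UN_strict[OF r X]) (use that in blast)+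
    then show ?thesis by simp
  qed
  have irr: "\<not> strict r l l" for l by blast
  show ?thesis
    unfolding profile_eq_iff lower_UN[OF X K(1) k(1,2) irr] lower_UN[OF X K(2) k(3,4) irr]
      upper_UN[OF X K(1) k(1,2) irr] upper_UN[OF X K(2) k(3,4) irr]
    using eq[unfolded profile_eq_iff]
    by (intro conjI tp_Un_cong[OF b1[OF K(1) k(1)] b1[OF K(2) k(3)] lo]
        tp_Un_cong[OF b2[OF K(1) k(1)] b2[OF K(2) k(3)] _ hi]) blast+
qed

section \<open>Reduction to countable index sets, and closure under well-ordered sums\<close>

context types
begin

text \<open>A Loewenheim-Skolem hull: for every interval of \<open>I\<close> with ends in
  \<open>J\<close>, or unbounded, and every triple of types realized there by an index,
  \<open>J\<close> contains an index realizing it. A move outside \<open>J\<close> is thus exchanged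
  for one in \<open>J\<close>, and the game goes on between ends in \<open>J\<close>.\<close>

lemma countable_subsum:
  fixes I :: "'i set"
  assumes r: "Well_order r" and X: "ordered_sum lt (strict r) I X" and I: "I \<subseteq> Field r" "I \<noteq> {}"
  obtains J where "J \<subseteq> I" "countable J" "J \<noteq> {}" "tp d lt c q (\<Union>(X ` J)) = tp d lt c q (\<Union>(X ` I))"
proof -
  define Iv where "Iv lo hi = {k \<in> I. (case lo of None \<Rightarrow> True | Some i \<Rightarrow> strict r i k) \<and>
    (case hi of None \<Rightarrow> True | Some j \<Rightarrow> strict r k j)}" for lo hi
  define U where "U K = \<Union>(X ` K)" for K
  define key where "key lo hi k = (tp d lt c q (U (Iv lo (Some k))), tp d lt c q (X k), tp d lt c q (U (Iv (Some k) hi)))" for lo hi k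
  define w where "w lo hi p = (SOME k. k \<in> Iv lo hi \<and> key lo hi k = p)" for lo hi p
  define opt where "opt K = insert None (Some ` K)" for K :: "'i set"
  \<comment> \<open>The triples of types are countably many, so every stage stays countable. The
    intersection keeps the arbitrary values of \<open>w\<close>, at triples that no index realizes,
    from leaving \<open>I\<close>.\<close>
  define step where "step K = K \<union> (I \<inter> (\<lambda>(lo, hi, p). w lo hi p) ` (opt K \<times> opt K \<times> UNIV))" for K
  obtain i0 where i0: "i0 \<in> I" using I(2) by blast
  define Jn where "Jn n = (step ^^ n) {i0}" for n
  define J where "J = (\<Union>n. Jn n)"
  have Jn: "Jn 0 = {i0}" "Jn (Suc n) = step (Jn n)" for n by (simp_all add: Jn_def)
  have Jn_I: "Jn n \<subseteq> I" for n by (induction n) (auto simp: Jn i0 step_def)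
  have "countable (Jn n)" for n
  proof (induction n)
    case (Suc n)
    then have "countable (opt (Jn n))" by (simp add: opt_def)
    then show ?case using Suc by (simp add: Jn step_def)
  qed (simp add: Jn)
  then have cJ: "countable J" unfolding J_def by blast
  have JI: "J \<subseteq> I" using Jn_I unfolding J_def by blast
  have Jne: "J \<noteq> {}" using Jn(1) unfolding J_def by blast
  have mono: "Jn n \<subseteq> Jn m" if "n \<le> m" for n m
    using that by (rule lift_Suc_mono_le[rotated]) (auto simp: Jn step_def)
  have opt_J: "\<exists>n. lo \<in> opt (Jn n)" if "lo \<in> opt J" for lo
    using that unfolding opt_def J_def by auto
  have opt_mono: "opt (Jn n) \<subseteq> opt (Jn m)" if "n \<le> m" for n m
    using mono[OF that] unfolding opt_def by auto
  have closed: "\<exists>k'\<in>J \<inter> Iv lo hi. key lo hi k' = key lo hi k"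
    if lohi: "lo \<in> opt J" "hi \<in> opt J" and kI: "k \<in> Iv lo hi" for lo hi k
  proof -
    let ?k = "w lo hi (key lo hi k)"
    have k: "?k \<in> Iv lo hi \<and> key lo hi ?k = key lo hi k"
      unfolding w_def by (rule someI[of _ k]) (use kI in simp)
    obtain n m where "lo \<in> opt (Jn n)" "hi \<in> opt (Jn m)"
      using opt_J[OF lohi(1)] opt_J[OF lohi(2)] by blast
    then have lh: "lo \<in> opt (Jn (max n m))" "hi \<in> opt (Jn (max n m))"
      using opt_mono[of n "max n m"] opt_mono[of m "max n m"] by auto
    have "?k \<in> I" using k unfolding Iv_def by blast
    moreover have "?k \<in> (\<lambda>(lo, hi, p). w lo hi p) ` (opt (Jn (max n m)) \<times> opt (Jn (max n m)) \<times> UNIV)"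
      by (rule rev_image_eqI[of "(lo, hi, key lo hi k)"]) (use lh in simp_all)
    ultimately have "?k \<in> Jn (Suc (max n m))" unfolding Jn step_def by blast
    then have "?k \<in> J" unfolding J_def by blast
    then show ?thesis using k by blast
  qed
  have Iv_I: "Iv lo hi \<subseteq> I" for lo hi unfolding Iv_def by blast
  have Iv_lo: "{j \<in> Iv lo hi. strict r j k} = Iv lo (Some k)" if "k \<in> Iv lo hi" for lo hi k
  proof -
    have "strict r j h" if "hi = Some h" "strict r j k" for j h
      using \<open>k \<in> Iv lo hi\<close> that WO_less_trans[OF r that(2), of h] unfolding Iv_def by simp
    then show ?thesis using that unfolding Iv_def by (cases hi) auto
  qed
  have Iv_hi: "{j \<in> Iv lo hi. strict r k j} = Iv (Some k) hi" if "k \<in> Iv lo hi" for lo hi k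
  proof -
    have "strict r h j" if "lo = Some h" "strict r k j" for j h
      using \<open>k \<in> Iv lo hi\<close> that WO_less_trans[OF r _ that(2), of h] unfolding Iv_def by simp
    then show ?thesis using that unfolding Iv_def by (cases lo) auto
  qed
  have JIv_lo: "{j \<in> J \<inter> Iv lo hi. strict r j k} = J \<inter> Iv lo (Some k)" if "k \<in> Iv lo hi" for lo hi k
    using Iv_lo[OF that] by blast
  have JIv_hi: "{j \<in> J \<inter> Iv lo hi. strict r k j} = J \<inter> Iv (Some k) hi" if "k \<in> Iv lo hi" for lo hi k
    using Iv_hi[OF that] by blast
  \<comment> \<open>The ends have to lie in \<open>J\<close>, where witnesses are provided.
    \<open>key\<close> records types of rank \<open>q\<close>, which decide every smaller rank
    \<open>q'\<close>.\<close>
  have main: "tp d lt c q' (U (J \<inter> Iv lo hi)) = tp d lt c q' (U (Iv lo hi))"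
    if "q' \<le> q" "lo \<in> opt J" "hi \<in> opt J" for q' lo hi
    using that
  proof (induction q' arbitrary: lo hi)
    case (Suc q')
    have q': "q' \<le> q" using Suc.prems by simp
    have sub: "J \<inter> Iv lo hi \<subseteq> I" using JI by blast
    have A: "profile d lt c q' (U (J \<inter> Iv lo hi)) x = profile d lt c q' (U (Iv lo hi)) x"
      if k: "k \<in> J" "k \<in> Iv lo hi" and x: "x \<in> X k" for k x
    proof -
      have "Some k \<in> opt J" using k(1) unfolding opt_def by blast
      then have IH: "tp d lt c q' (U (J \<inter> Iv lo (Some k))) = tp d lt c q' (U (Iv lo (Some k)))"
        "tp d lt c q' (U (J \<inter> Iv (Some k) hi)) = tp d lt c q' (U (Iv (Some k) hi))"
        using Suc.IH q' Suc.prems by blast+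
      show ?thesis
        unfolding U_def
        by (rule profile_UN_eq[OF r X sub Iv_I _ x k(2) x refl])
          (use k IH in \<open>simp_all add: JIv_lo[OF k(2), simplified] JIv_hi[OF k(2), simplified] Iv_lo[OF k(2), simplified] Iv_hi[OF k(2), simplified] U_def\<close>)
    qed
    show ?case
      unfolding tp_Suc_eq_iff
    proof (intro subset_antisym image_subsetI)
      fix x assume "x \<in> U (J \<inter> Iv lo hi)"
      then obtain k where k: "k \<in> J" "k \<in> Iv lo hi" "x \<in> X k" unfolding U_def by blast
      have "x \<in> U (Iv lo hi)" using k unfolding U_def by blast
      then show "profile d lt c q' (U (J \<inter> Iv lo hi)) x \<in> profile d lt c q' (U (Iv lo hi)) ` U (Iv lo hi)"
        unfolding A[OF k] by (rule imageI)
    next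
      fix x assume "x \<in> U (Iv lo hi)"
      then obtain k where k: "k \<in> Iv lo hi" "x \<in> X k" unfolding U_def by blast
      obtain k' where k': "k' \<in> J" "k' \<in> Iv lo hi" "key lo hi k' = key lo hi k"
        using closed[OF Suc.prems(2,3) k(1)] by blast
      have eqs: "tp d lt c q (U (Iv lo (Some k))) = tp d lt c q (U (Iv lo (Some k')))"
        "tp d lt c q (X k) = tp d lt c q (X k')"
        "tp d lt c q (U (Iv (Some k) hi)) = tp d lt c q (U (Iv (Some k') hi))"
        using k'(3) unfolding key_def by simp_all
      obtain x' where x': "x' \<in> X k'" "profile d lt c q' (X k) x = profile d lt c q' (X k') x'"
        using tp_SucE[OF tp_eq_le[OF eqs(2) Suc.prems(1)] k(2)] .
      \<comment> \<open>First the point is exchanged within the full sum for one over an index in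
        \<open>J\<close>; then \<open>A\<close> compares the full with the thinned sum at that
        point.\<close>
      have "profile d lt c q' (U (Iv lo hi)) x = profile d lt c q' (U (Iv lo hi)) x'"
        unfolding U_def
      proof (rule profile_UN_eq[OF r X Iv_I Iv_I k k'(2) x'])
        show "tp d lt c q' (\<Union>(X ` {j \<in> Iv lo hi. strict r j k})) = tp d lt c q' (\<Union>(X ` {j \<in> Iv lo hi. strict r j k'}))"
          unfolding Iv_lo[OF k(1)] Iv_lo[OF k'(2)] U_def[symmetric] by (rule tp_eq_le[OF eqs(1) q'])
        show "tp d lt c q' (\<Union>(X ` {j \<in> Iv lo hi. strict r k j})) = tp d lt c q' (\<Union>(X ` {j \<in> Iv lo hi. strict r k' j}))"
          unfolding Iv_hi[OF k(1)] Iv_hi[OF k'(2)] U_def[symmetric] by (rule tp_eq_le[OF eqs(3) q'])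
      qed
      also have "\<dots> = profile d lt c q' (U (J \<inter> Iv lo hi)) x'" using A[OF k'(1,2) x'(1)] by simp
      finally have "profile d lt c q' (U (Iv lo hi)) x = profile d lt c q' (U (J \<inter> Iv lo hi)) x'" .
      moreover have "x' \<in> U (J \<inter> Iv lo hi)" using k' x' unfolding U_def by blast
      ultimately show "profile d lt c q' (U (Iv lo hi)) x \<in> profile d lt c q' (U (J \<inter> Iv lo hi)) ` U (J \<inter> Iv lo hi)"
        by blast
    qed
  qed simp
  have "Iv None None = I" unfolding Iv_def by simp
  then have "tp d lt c q (U J) = tp d lt c q (U I)"
    using main[of q None None] JI by (simp add: opt_def Int_absorb2)
  then show thesis using that[OF JI cJ Jne] unfolding U_def by blast
qed

text \<open>If \<open>K\<close> has a last index, the sum is a single summand or a binary product.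
  Otherwise, \<open>K\<close> being countable, an omega-sequence is cofinal in it and cuts the sum
  into an omega-product of segments.\<close>

lemma tp_sum_step:
  assumes r: "Well_order r" and X: "ordered_sum lt (strict r) K X" and K: "K \<subseteq> Field r" "K \<noteq> {}" "countable K"
    and E: "E \<subseteq> realizable" "\<And>s t. s \<in> E \<Longrightarrow> t \<in> E \<Longrightarrow> tp_mult s t \<in> E" "\<And>f. (\<And>i. f i \<in> E) \<Longrightarrow> tp_omega f \<in> E"
    and XE: "\<And>i. i \<in> K \<Longrightarrow> tp d lt c q (X i) \<in> E"
    and seg: "\<And>k i. k \<in> K \<Longrightarrow> i \<in> K \<Longrightarrow> strict r k i \<Longrightarrow> tp d lt c q (\<Union>(X ` {j \<in> K. (k, j) \<in> r \<and> strict r j i})) \<in> E"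
  shows "tp d lt c q (\<Union>(X ` K)) \<in> E"
proof -
  obtain k0 where k0: "k0 \<in> K" "\<And>j. j \<in> K \<Longrightarrow> (k0, j) \<in> r" using WO_least[OF r K(1,2)] by blast
  have KF: "k \<in> Field r" if "k \<in> K" for k using that K(1) by blast
  show ?thesis
  proof (cases "\<exists>m\<in>K. \<forall>j\<in>K. (j, m) \<in> r")
    case True
    then obtain m where m: "m \<in> K" "\<And>j. j \<in> K \<Longrightarrow> (j, m) \<in> r" by blast
    show ?thesis
    proof (cases "m = k0")
      case True
      then have "K = {k0}" using m k0 WO_antisym[OF r] by blast
      then show ?thesis using XE by simp
    next
      case False
      let ?A = "{j \<in> K. (k0, j) \<in> r \<and> strict r j m}"
      have KA: "\<Union>(X ` K) = \<Union>(X ` ?A) \<union> X m"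
        using m k0 by blast
      have "before lt (\<Union>(X ` ?A)) (\<Union>(X ` {m}))"
        by (rule before_UN_strict[OF r X]) (use m in auto)
      moreover have AE: "tp d lt c q (\<Union>(X ` ?A)) \<in> E" by (rule seg) (use k0 m False in auto)
      ultimately have "tp d lt c q (\<Union>(X ` ?A) \<union> X m) = tp_mult (tp d lt c q (\<Union>(X ` ?A))) (tp d lt c q (X m))"
        by (intro tp_Un) (use XE m E(1) in auto)
      then show ?thesis unfolding KA using E(2)[OF AE XE[OF m(1)]] by simp
    qed
  next
    case False
    have ex: "\<exists>y. y \<in> K \<and> strict r a y \<and> strict r b y" if "a \<in> K" "b \<in> K" for a b
    proof -
      have gt: "\<exists>j\<in>K. strict r m j" if "m \<in> K" for m
        using False that WO_not_less[OF r] KF by meson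
      show ?thesis
      proof (cases "strict r a b")
        case True
        then show ?thesis using gt[OF that(2)] WO_less_trans[OF r] by blast
      next
        case False
        then have "(b, a) \<in> r" using WO_not_less[OF r] KF that by blast
        then show ?thesis using gt[OF that(1)] WO_le_less_trans[OF r] by blast
      qed
    qed
    define e where "e = from_nat_into K"
    have e: "range e = K" unfolding e_def using K(2,3) by simp
    then have eK: "e n \<in> K" for n by blast
    \<comment> \<open>Starting at the least index leaves nothing below the segments; exceeding
      \<open>e n\<close>, the n-th index of an enumeration, makes the sequence cofinal.\<close>
    define z where "z = rec_nat k0 (\<lambda>n a. SOME y. y \<in> K \<and> strict r a y \<and> strict r (e n) y)"
    have z0: "z 0 = k0" by (simp add: z_def)
    have zS: "z (Suc n) = (SOME y. y \<in> K \<and> strict r (z n) y \<and> strict r (e n) y)" for n by (simp add: z_def)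
    have zK: "z n \<in> K" for n
    proof (induction n)
      case (Suc n)
      then show ?case unfolding zS using someI_ex[OF ex[OF Suc eK[of n]]] by blast
    qed (simp add: z0 k0)
    have zS': "strict r (z n) (z (Suc n))" "strict r (e n) (z (Suc n))" for n
      unfolding zS using someI_ex[OF ex[OF zK[of n] eK[of n]]] by blast+
    have z_le: "(z n, z m) \<in> r" if "n \<le> m" for n m
      using that
    proof (induction rule: dec_induct)
      case base
      show ?case using WO_refl[OF r KF[OF zK]] .
    next
      case (step k)
      then show ?case using zS'(1)[of k] WO_trans[OF r] by blast
    qed
    let ?B = "\<lambda>n. {j \<in> K. (z n, j) \<in> r \<and> strict r j (z (Suc n))}"
    have cover: "\<exists>n. j \<in> ?B n" if "j \<in> K" for j
    proof -
      have "j \<in> range e" using e that by simp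
      then obtain m where "e m = j" by blast
      then have "strict r j (z (Suc m))" using zS'(2)[of m] by simp
      then obtain n where n: "strict r j (z n)" "\<And>m. m < n \<Longrightarrow> \<not> strict r j (z m)"
        using exists_least_iff[of "\<lambda>n. strict r j (z n)"] by blast
      have "n \<noteq> 0"
      proof
        assume "n = 0"
        then have "strict r j k0" using n(1) z0 by simp
        then show False using k0(2)[OF that] WO_antisym[OF r] by blast
      qed
      then obtain n' where n': "n = Suc n'" by (cases n) auto
      then have "\<not> strict r j (z n')" using n(2)[of n'] by simp
      then have "(z n', j) \<in> r" using WO_not_less[OF r KF[OF that] KF[OF zK]] by blast
      then show ?thesis using n(1) n' that by blast
    qed
    have "tp d lt c q (\<Union>(range (\<lambda>n. \<Union>(X ` ?B n)))) = tp_omega (\<lambda>n. tp d lt c q (\<Union>(X ` ?B n)))"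
    proof (rule tp_UN_omega)
      have "before lt (\<Union>(X ` ?B n)) (\<Union>(X ` ?B m))" if "n < m" for n m
      proof (rule before_UN_strict[OF r X])
        fix i j assume ij: "i \<in> ?B n" "j \<in> ?B m"
        have "(z (Suc n), z m) \<in> r" using that by (intro z_le) simp
        then have "(z (Suc n), j) \<in> r" using ij(2) WO_trans[OF r] by blast
        then show "strict r i j" using ij(1) WO_less_le_trans[OF r] by blast
      qed auto
      then show "ordered_sum lt (<) UNIV (\<lambda>n. \<Union>(X ` ?B n))" unfolding ordered_sum_before by blast
      show "tp d lt c q (\<Union>(X ` ?B i)) \<in> realizable" for i
        using seg[OF zK zK zS'(1)] E(1) by blast
    qed simp
    also have "\<Union>(range (\<lambda>n. \<Union>(X ` ?B n))) = \<Union>(X ` K)"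
    proof
      show "\<Union>(X ` K) \<subseteq> \<Union>(range (\<lambda>n. \<Union>(X ` ?B n)))"
      proof
        fix x assume "x \<in> \<Union>(X ` K)"
        then obtain j where j: "j \<in> K" "x \<in> X j" by blast
        then obtain n where "j \<in> ?B n" using cover by blast
        then show "x \<in> \<Union>(range (\<lambda>n. \<Union>(X ` ?B n)))" using j by blast
      qed
    qed blast
    finally show ?thesis using E(3)[OF seg[OF zK zK zS'(1)]] by simp
  qed
qed

text \<open>After passing to a countable index set, well-founded induction on the right end of
  segments. It is applied to the stable set of types and to \<open>{t}\<close>, where it says that
  \<open>t\<close> equals all its well-ordered powers.\<close>

lemma tp_sum_closed:
  assumes r: "Well_order r" and X: "ordered_sum lt (strict r) I X" and I: "I \<subseteq> Field r" "I \<noteq> {}"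
    and E: "E \<subseteq> realizable" "\<And>s t. s \<in> E \<Longrightarrow> t \<in> E \<Longrightarrow> tp_mult s t \<in> E" "\<And>f. (\<And>i. f i \<in> E) \<Longrightarrow> tp_omega f \<in> E"
    and XE: "\<And>i. i \<in> I \<Longrightarrow> tp d lt c q (X i) \<in> E"
  shows "tp d lt c q (\<Union>(X ` I)) \<in> E"
proof -
  obtain J where J: "J \<subseteq> I" "countable J" "J \<noteq> {}"
    "tp d lt c q (\<Union>(X ` J)) = tp d lt c q (\<Union>(X ` I))"
    using countable_subsum[OF r X I] .
  have XS: "ordered_sum lt (strict r) K X" if "K \<subseteq> J" for K
    using ordered_sum_mono[OF X] that J(1) by blast
  have seg: "tp d lt c q (\<Union>(X ` {j \<in> J. (k, j) \<in> r \<and> strict r j i})) \<in> E"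
    if "k \<in> J" "strict r k i" for k i
    using that
  proof (induction i arbitrary: k rule: wf_induct_rule[OF WO_wf[OF r]])
    case (1 i)
    let ?K = "{j \<in> J. (k, j) \<in> r \<and> strict r j i}"
    show ?case
    proof (rule tp_sum_step[OF r XS _ _ _ E])
      have "k \<in> ?K" using 1 WO_refl[OF r] J(1) I(1) by blast
      then show "?K \<noteq> {}" by blast
      show "countable ?K" using J(2) by (rule countable_subset[rotated]) blast
      show "tp d lt c q (X i) \<in> E" if "i \<in> ?K" for i using XE that J(1) by blast
      fix k' i' assume ki: "k' \<in> ?K" "i' \<in> ?K" "strict r k' i'"
      \<comment> \<open>A segment of a segment is a segment of \<open>J\<close>, with the smaller
        end \<open>i'\<close>.\<close>
      have "{j \<in> ?K. (k', j) \<in> r \<and> strict r j i'} = {j \<in> J. (k', j) \<in> r \<and> strict r j i'}"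
        using ki WO_trans[OF r, of k k'] WO_less_trans[OF r, of _ i' i] by blast
      moreover have "tp d lt c q (\<Union>(X ` {j \<in> J. (k', j) \<in> r \<and> strict r j i'})) \<in> E"
        by (rule "1.IH") (use ki in auto)
      ultimately show "tp d lt c q (\<Union>(X ` {j \<in> ?K. (k', j) \<in> r \<and> strict r j i'})) \<in> E" by simp
    qed (use J(1) I(1) in auto)
  qed
  have "tp d lt c q (\<Union>(X ` J)) \<in> E"
    by (rule tp_sum_step[OF r XS[OF subset_refl] _ J(3,2) E]) (use J(1) I(1) XE seg in auto)
  then show ?thesis using J(4) by simp
qed

end

section \<open>Limit points and powers of omega\<close>

text \<open>
  The points satisfying \<open>lim_fm n\<close> in a well-order are the multiples of \<open>\<omega>\<^sup>n\<close>, \<open>0\<close> included.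
\<close>

primrec lim_fm :: "nat \<Rightarrow> nat \<Rightarrow> fm" where
  "lim_fm 0 v = Neg Fls"
| "lim_fm (Suc n) v = Neg (Exi (v + 1) (Conj (Less (v + 1) v) (Neg (Exi (v + 2)
     (Conj (Conj (Less (v + 1) (v + 2)) (Less (v + 2) v)) (lim_fm n (v + 2)))))))"

primrec lim_pt :: "'a rel \<Rightarrow> nat \<Rightarrow> 'a \<Rightarrow> bool" where
  "lim_pt r 0 x \<longleftrightarrow> True"
| "lim_pt r (Suc n) x \<longleftrightarrow> (\<forall>y\<in>Field r. strict r y x \<longrightarrow>
     (\<exists>z\<in>Field r. strict r y z \<and> strict r z x \<and> lim_pt r n z))"

text \<open>Through these sentences elementary equivalence with \<open>omega_omega\<close> enters:
  they transfer the unboundedness of the multiples of omega^n.\<close>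

definition unbounded_fm :: "nat \<Rightarrow> fm" where
  "unbounded_fm n = Neg (Exi 0 (Neg (Exi 1 (Conj (Less 0 1) (lim_fm n 1)))))"

lemma sat_lim_fm: "sat \<lparr>ord = r, color = C\<rparr> s (lim_fm n v) \<longleftrightarrow> lim_pt r n (s v)"
  by (induction n arbitrary: s v) auto

lemma sentence_unbounded_fm: "sentence 0 (unbounded_fm n)"
proof -
  have fv: "free_vars (lim_fm n v) \<subseteq> {v}" for v by (induction n arbitrary: v) auto
  have "colors_of (lim_fm n v) = {}" for v by (induction n arbitrary: v) auto
  then show ?thesis using fv[of 1] by (auto simp: sentence_def unbounded_fm_def)
qed

definition lim_unbounded :: "'a rel \<Rightarrow> nat \<Rightarrow> bool" where
  "lim_unbounded r n \<longleftrightarrow> (\<forall>x\<in>Field r. \<exists>y\<in>Field r. strict r x y \<and> lim_pt r n y)"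

lemma models_unbounded_fm:
  "models \<lparr>ord = r, color = C\<rparr> (unbounded_fm n) \<longleftrightarrow> lim_unbounded r n"
  by (simp add: models_def unbounded_fm_def lim_unbounded_def sat_lim_fm)

lemma omega_omega_lim_pt:
  assumes "finite {m. f m \<noteq> 0}" "\<And>m. m < n \<Longrightarrow> f m = 0"
  shows "lim_pt omega_omega n f"
  using assms
proof (induction n arbitrary: f)
  case (Suc n)
  show ?case
    unfolding lim_pt.simps
  proof (intro ballI impI)
    fix y assume y: "y \<in> Field omega_omega" "strict omega_omega y f"
    then have fy: "finite {m. y m \<noteq> 0}" unfolding Field_omega_omega by simp
    obtain p where p: "y p < f p" "\<forall>m>p. y m = f m" using y(2) unfolding omega_omega_def by auto
    have pn: "n < p"
    proof (rule ccontr)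
      assume "\<not> n < p"
      then have "f p = 0" using Suc.prems(2) by simp
      then show False using p(1) by simp
    qed
    \<comment> \<open>The least multiple of omega^n above \<open>y\<close>. Only positions up to
      \<open>n\<close> change, so it stays below \<open>f\<close>, which exceeds \<open>y\<close> at
      \<open>p > n\<close>.\<close>
    define z where "z m = (if m < n then 0 else if m = n then Suc (y n) else y m)" for m
    have "{m. z m \<noteq> 0} \<subseteq> insert n {m. y m \<noteq> 0}" by (auto simp: z_def split: if_splits)
    then have fz: "finite {m. z m \<noteq> 0}" using fy by (meson finite.insertI finite_subset)
    have "\<exists>k. y k < z k \<and> (\<forall>m>k. y m = z m)" by (rule exI[of _ n]) (auto simp: z_def)
    moreover have "\<exists>k. z k < f k \<and> (\<forall>m>k. z m = f m)" by (rule exI[of _ p]) (use p pn in \<open>auto simp: z_def\<close>)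
    ultimately have "strict omega_omega y z" "strict omega_omega z f"
      using fy fz Suc.prems(1) unfolding omega_omega_def by (auto simp del: neq0_conv)
    moreover have "lim_pt omega_omega n z" by (rule Suc.IH[OF fz]) (simp add: z_def)
    ultimately show "\<exists>z\<in>Field omega_omega. strict omega_omega y z \<and> strict omega_omega z f \<and> lim_pt omega_omega n z"
      using fz unfolding Field_omega_omega by blast
  qed
qed simp

lemma omega_omega_unbounded: "lim_unbounded omega_omega n"
  unfolding lim_unbounded_def
proof
  fix f :: "nat \<Rightarrow> nat" assume "f \<in> Field omega_omega"
  then have f: "finite {m. f m \<noteq> 0}" unfolding Field_omega_omega by simp
  obtain b where b: "\<And>m. f m \<noteq> 0 \<Longrightarrow> m < b"
    using f unfolding finite_nat_set_iff_bounded by blast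
  \<comment> \<open>This is omega^(b+n), while all exponents in \<open>f\<close> are below
    \<open>b\<close>.\<close>
  define g where "g m = (if m = b + n then 1 else 0 :: nat)" for m
  have fg: "finite {m. g m \<noteq> 0}" by (simp add: g_def)
  have "\<exists>k. f k < g k \<and> (\<forall>m>k. f m = g m)"
  proof (intro exI conjI allI impI)
    have z: "f m = 0" if "m \<ge> b" for m using b[of m] that by (cases "f m = 0") auto
    show "f (b + n) < g (b + n)" using z[of "b + n"] by (simp add: g_def)
    show "f m = g m" if "b + n < m" for m using z[of m] that by (simp add: g_def)
  qed
  then have "strict omega_omega f g" using f fg unfolding omega_omega_def by (auto simp del: neq0_conv)
  moreover have "lim_pt omega_omega n g" by (rule omega_omega_lim_pt[OF fg]) (simp add: g_def)
  ultimately show "\<exists>g\<in>Field omega_omega. strict omega_omega f g \<and> lim_pt omega_omega n g"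
    using fg unfolding Field_omega_omega by blast
qed

lemma elem_equiv_unbounded: "elem_equiv r omega_omega \<Longrightarrow> lim_unbounded r n"
  using sentence_unbounded_fm[of n] omega_omega_unbounded[of n]
  unfolding elem_equiv_def models_unbounded_fm[of _ "\<lambda>_. {}", symmetric] by blast

lemma lim_pt_Suc: "lim_pt r (Suc n) x \<Longrightarrow> lim_pt r n x"
proof (induction n arbitrary: x)
  case (Suc n)
  show ?case
    unfolding lim_pt.simps(2)[of r n]
  proof (intro ballI impI)
    fix y assume y: "y \<in> Field r" "strict r y x"
    then obtain z where "z \<in> Field r" "strict r y z" "strict r z x" "lim_pt r (Suc n) z"
      using Suc.prems unfolding lim_pt.simps(2)[of r "Suc n"] by blast
    then show "\<exists>z\<in>Field r. strict r y z \<and> strict r z x \<and> lim_pt r n z" using Suc.IH by blast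
  qed
qed simp

text \<open>Order type omega^n without ordinal arithmetic: omega^(n+1) is omega copies of omega^n in
  a row.\<close>

primrec omega_power :: "('a \<Rightarrow> 'a \<Rightarrow> bool) \<Rightarrow> nat \<Rightarrow> 'a set \<Rightarrow> bool" where
  "omega_power lt 0 X \<longleftrightarrow> (\<exists>x. X = {x} \<and> \<not> lt x x)"
| "omega_power lt (Suc n) X \<longleftrightarrow> (\<exists>Y. X = \<Union>(range Y) \<and> ordered_sum lt (<) UNIV Y \<and>
     (\<forall>i :: nat. omega_power lt n (Y i)))"

context types
begin

lemma tp_omega_power:
  "omega_power lt n X \<Longrightarrow> (\<And>x. x \<in> X \<Longrightarrow> c x < d) \<Longrightarrow> tp d lt c q X \<in> power_types n"
proof (induction n arbitrary: X)
  case 0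
  then obtain x where x: "X = {x}" "\<not> lt x x" by auto
  have "tp d lt c q {x} = tp d (\<lambda>_ _. False) (\<lambda>_. c x) q {0 :: nat}"
    by (rule tp_iso[where h = "\<lambda>_. 0"]) (use x in \<open>auto simp: bij_betw_def\<close>)
  then show ?case using 0(2)[of x] x(1) by auto
next
  case (Suc n)
  then obtain Y :: "nat \<Rightarrow> 'a set" where Y: "X = \<Union>(range Y)" "ordered_sum lt (<) UNIV Y" "\<And>i. omega_power lt n (Y i)"
    by auto
  have t: "tp d lt c q (Y i) \<in> power_types n" for i
    by (rule Suc.IH[OF Y(3)]) (use Suc.prems(2) Y(1) in blast)
  have "tp d lt c q (\<Union>(range Y)) = tp_omega (\<lambda>i. tp d lt c q (Y i))"
    by (rule tp_UN_omega[OF Y(2)]) (use t power_types_subset in blast)+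
  then show ?case unfolding Y(1) power_types.simps set_omega_def using t by auto
qed

lemma combine_colorings:
  assumes "0 < d" and dis: "\<And>i j x. i \<in> K \<Longrightarrow> j \<in> K \<Longrightarrow> x \<in> X i \<Longrightarrow> x \<in> X j \<Longrightarrow> i = j"
    and ex: "\<And>k. k \<in> K \<Longrightarrow> \<exists>c. (\<forall>x. c x < d) \<and> tp d lt c q (X k) = f k"
  obtains c where "\<And>x. c x < d" "\<And>k. k \<in> K \<Longrightarrow> tp d lt c q (X k) = f k"
proof -
  obtain c where c: "\<And>k x. k \<in> K \<Longrightarrow> c k x < d" "\<And>k. k \<in> K \<Longrightarrow> tp d lt (c k) q (X k) = f k"
    using ex by metis
  \<comment> \<open>Disjointness makes the chosen index unique. Points outside all the sets get
    color \<open>0\<close>, which exists because \<open>0 < d\<close>.\<close>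
  define c' where "c' x = (if \<exists>k\<in>K. x \<in> X k then c (SOME k. k \<in> K \<and> x \<in> X k) x else 0)" for x
  have c': "c' x = c k x" if "k \<in> K" "x \<in> X k" for k x
  proof -
    have "(SOME k. k \<in> K \<and> x \<in> X k) = k"
      by (rule some_equality) (use that dis in blast)+
    then show ?thesis using that unfolding c'_def by auto
  qed
  have "tp d lt c' q (X k) = tp d lt (c k) q (X k)" if "k \<in> K" for k
    by (rule tp_cong) (rule c'[OF that])
  moreover have "c' x < d" for x
  proof (cases "\<exists>k\<in>K. x \<in> X k")
    case True
    then show ?thesis using c' c(1) by metis
  qed (use assms(1) in \<open>simp add: c'_def\<close>)
  ultimately show thesis using that c(2) by metis
qed

text \<open>The converse of \<open>tp_omega_power\<close>; together they justify reading
  \<open>power_types n\<close> as the types of colorings of omega^n. An omega-product prescribes the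
  types of the parts, and colorings of the disjoint parts are glued.\<close>

lemma omega_power_realize:
  "omega_power lt n X \<Longrightarrow> e \<in> power_types n \<Longrightarrow> \<exists>c. (\<forall>x. c x < d) \<and> tp d lt c q X = e"
proof (induction n arbitrary: X e)
  case 0
  then obtain x i where x: "X = {x}" "\<not> lt x x" and i: "i < d" "e = tp d (\<lambda>_ _. False) (\<lambda>_. i) q {0 :: nat}"
    by auto
  have "tp d lt (\<lambda>_. i) q {x} = e"
    unfolding i(2) by (rule tp_iso[where h = "\<lambda>_. 0"]) (use x in \<open>auto simp: bij_betw_def\<close>)
  then show ?case using x(1) i(1) by (intro exI[of _ "\<lambda>_. i"]) simp
next
  case (Suc n)
  then obtain Y :: "nat \<Rightarrow> 'a set" where Y: "X = \<Union>(range Y)" "ordered_sum lt (<) UNIV Y" "\<And>i. omega_power lt n (Y i)"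
    by auto
  obtain f where f: "e = tp_omega f" "\<And>i. f i \<in> power_types n" using Suc.prems(2) unfolding power_types.simps set_omega_def by blast
  have "\<forall>i. \<exists>c. (\<forall>x. c x < d) \<and> tp d lt c q (Y i) = f i" using Suc.IH[OF Y(3) f(2)] by blast
  then have ex: "\<exists>c. (\<forall>x. c x < d) \<and> tp d lt c q (Y i) = f i" for i by blast
  have d: "0 < d"
    using ex[of 0] by (metis gr0I not_less_zero)
  have dis: "i = j" if "x \<in> Y i" "x \<in> Y j" for i j x
    using Y(2) that unfolding ordered_sum_before before_def by (metis UNIV_I linorder_neqE_nat)
  obtain c where c: "\<And>x. c x < d" "\<And>i. tp d lt c q (Y i) = f i"
    by (rule combine_colorings[where K = UNIV and X = Y and lt = lt and f = f]) (use d dis ex in blast)+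
  have "tp d lt c q (\<Union>(range Y)) = tp_omega f"
    by (intro tp_UN_omega[OF Y(2)]) (use c(2) f(2) power_types_subset in \<open>simp, blast\<close>)
  then show ?case unfolding Y(1) f(1) using c(1) by blast
qed

end

section \<open>Cutting a well-order into blocks of type omega^n\<close>

definition next_lim :: "'a rel \<Rightarrow> nat \<Rightarrow> 'a \<Rightarrow> 'a" where
  "next_lim r n x = (SOME y. y \<in> Field r \<and> strict r x y \<and> lim_pt r n y \<and>
     (\<forall>z\<in>Field r. strict r x z \<and> lim_pt r n z \<longrightarrow> (y, z) \<in> r))"

text \<open>If \<open>x\<close> is a multiple of omega^n, this is the half-open interval from
  \<open>x\<close> to x + omega^n.\<close>

definition block :: "'a rel \<Rightarrow> nat \<Rightarrow> 'a \<Rightarrow> 'a set" where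
  "block r n x = {y \<in> Field r. (x, y) \<in> r \<and> strict r y (next_lim r n x)}"

lemma next_lim:
  assumes "Well_order r" "lim_unbounded r n" "x \<in> Field r"
  shows "next_lim r n x \<in> Field r" "strict r x (next_lim r n x)" "lim_pt r n (next_lim r n x)"
    "z \<in> Field r \<Longrightarrow> strict r x z \<Longrightarrow> lim_pt r n z \<Longrightarrow> (next_lim r n x, z) \<in> r"
proof -
  let ?K = "{y \<in> Field r. strict r x y \<and> lim_pt r n y}"
  have "?K \<noteq> {}" using assms(2,3) unfolding lim_unbounded_def by blast
  then obtain k where "k \<in> ?K" "\<And>j. j \<in> ?K \<Longrightarrow> (k, j) \<in> r"
    using WO_least[OF assms(1), of ?K] by blast
  then have ex: "k \<in> Field r \<and> strict r x k \<and> lim_pt r n k \<and>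
     (\<forall>z\<in>Field r. strict r x z \<and> lim_pt r n z \<longrightarrow> (k, z) \<in> r)" by blast
  let ?Q = "\<lambda>y. y \<in> Field r \<and> strict r x y \<and> lim_pt r n y \<and>
     (\<forall>z\<in>Field r. strict r x z \<and> lim_pt r n z \<longrightarrow> (y, z) \<in> r)"
  have P: "?Q (next_lim r n x)"
    unfolding next_lim_def by (rule someI[of ?Q k, OF ex])
  show "next_lim r n x \<in> Field r" "strict r x (next_lim r n x)" "lim_pt r n (next_lim r n x)"
    using P by blast+
  show "(next_lim r n x, z) \<in> r" if "z \<in> Field r" "strict r x z" "lim_pt r n z"
    using P that by blast
qed

lemma block_0:
  assumes r: "Well_order r" "lim_unbounded r 0" "x \<in> Field r"
  shows "block r 0 x = {x}"
proof
  show "{x} \<subseteq> block r 0 x" using next_lim(2)[OF r] WO_refl[OF r(1,3)] r(3) unfolding block_def by simp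
  show "block r 0 x \<subseteq> {x}"
  proof
    fix y assume y: "y \<in> block r 0 x"
    show "y \<in> {x}"
    proof (rule ccontr)
      assume "y \<notin> {x}"
      then have "(next_lim r 0 x, y) \<in> r"
        using y next_lim(4)[OF r, of y] unfolding block_def by auto
      then show False using y WO_antisym[OF r(1), of y "next_lim r 0 x"] unfolding block_def by auto
    qed
  qed
qed

text \<open>The points \<open>z k\<close>, as ordinals x + omega^n k, cut the block of level
  \<open>Suc n\<close> into omega many blocks of level \<open>n\<close>.\<close>

lemma block_omega_power:
  assumes r: "Well_order r" and unb: "\<And>n. lim_unbounded r n"
  shows "x \<in> Field r \<Longrightarrow> lim_pt r n x \<Longrightarrow> omega_power (strict r) n (block r n x)"
proof (induction n arbitrary: x)
  case 0
  then show ?case using block_0[OF r unb] by simp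
next
  case (Suc n)
  define z where "z k = (next_lim r n ^^ k) x" for k
  have z: "z 0 = x" "z (Suc k) = next_lim r n (z k)" for k by (simp_all add: z_def)
  have zF: "z k \<in> Field r" for k by (induction k) (auto simp: z Suc.prems intro: next_lim(1)[OF r unb])
  have zl: "lim_pt r n (z k)" for k
    using next_lim(3)[OF r unb zF] lim_pt_Suc[OF Suc.prems(2)] z by (cases k) auto
  have zs: "strict r (z k) (z (Suc k))" for k unfolding z by (rule next_lim(2)[OF r unb zF])
  have z_le: "(z k, z l) \<in> r" if "k \<le> l" for k l
    using that
  proof (induction rule: dec_induct)
    case base
    show ?case by (rule WO_refl[OF r zF])
  next
    case (step l)
    then show ?case using zs[of l] WO_trans[OF r] by blast
  qed
  let ?x' = "next_lim r (Suc n) x"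
  note x' = next_lim[OF r unb[of "Suc n"] Suc.prems(1)]
  have zx': "strict r (z k) ?x'" for k
  proof (induction k)
    case 0
    then show ?case using x'(2) z by simp
  next
    case (Suc k)
    then obtain w where w: "w \<in> Field r" "strict r (z k) w" "strict r w ?x'" "lim_pt r n w"
      using x'(3) zF unfolding lim_pt.simps by blast
    then have "(z (Suc k), w) \<in> r" unfolding z by (intro next_lim(4)[OF r unb zF])
    then show ?case using w(3) WO_le_less_trans[OF r] by blast
  qed
  have "block r (Suc n) x = (\<Union>k. block r n (z k))"
  proof
    show "(\<Union>k. block r n (z k)) \<subseteq> block r (Suc n) x"
    proof
      fix y assume "y \<in> (\<Union>k. block r n (z k))"
      then obtain k where y: "y \<in> Field r" "(z k, y) \<in> r" "strict r y (z (Suc k))" unfolding block_def z by blast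
      have "(x, y) \<in> r" using z_le[of 0 k] y(2) WO_trans[OF r] z(1) by (metis le0)
      moreover have "strict r y ?x'" using WO_less_trans[OF r y(3) zx'] .
      ultimately show "y \<in> block r (Suc n) x" using y(1) unfolding block_def by blast
    qed
    show "block r (Suc n) x \<subseteq> (\<Union>k. block r n (z k))"
    proof
      fix y assume "y \<in> block r (Suc n) x"
      then have y: "y \<in> Field r" "(x, y) \<in> r" "strict r y ?x'" unfolding block_def by blast+
      \<comment> \<open>Otherwise the supremum \<open>w\<close> of the \<open>z k\<close> would be a
        multiple of omega^(n+1) above \<open>x\<close> and at most \<open>y\<close>, contradicting
        the minimality of \<open>?x'\<close>.\<close>
      have "\<exists>k. strict r y (z k)"
      proof (rule ccontr)
        assume no: "\<nexists>k. strict r y (z k)"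
        let ?W = "{w \<in> Field r. \<forall>k. (z k, w) \<in> r}"
        have yW: "y \<in> ?W" using no y(1) WO_not_less[OF r y(1) zF] by blast
        obtain w where w: "w \<in> ?W" "\<And>v. v \<in> ?W \<Longrightarrow> (w, v) \<in> r"
          using WO_least[OF r, of ?W] yW by blast
        have "lim_pt r (Suc n) w"
          unfolding lim_pt.simps
        proof (intro ballI impI)
          fix v assume v: "v \<in> Field r" "strict r v w"
          have "v \<notin> ?W" using w(2)[of v] v(2) WO_antisym[OF r] by blast
          then obtain k where "(z k, v) \<notin> r" using v(1) by blast
          then have "strict r v (z k)" using WO_not_less[OF r v(1) zF] by blast
          moreover have "strict r (z k) w" using zs[of k] w(1) WO_less_le_trans[OF r] by blast
          ultimately show "\<exists>z\<in>Field r. strict r v z \<and> strict r z w \<and> lim_pt r n z" using zF zl by blast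
        qed
        moreover have "strict r x w" using zs[of 0] w(1) WO_less_le_trans[OF r] z(1) by (metis (mono_tags, lifting) mem_Collect_eq)
        ultimately have "(?x', w) \<in> r" using x'(4) w(1) by blast
        then have "(?x', y) \<in> r" using w(2)[OF yW] WO_trans[OF r] by blast
        then show False using y(3) WO_antisym[OF r] by blast
      qed
      then obtain k where k: "strict r y (z k)" "\<And>m. m < k \<Longrightarrow> \<not> strict r y (z m)"
        using exists_least_iff[of "\<lambda>k. strict r y (z k)"] by blast
      have "k \<noteq> 0"
      proof
        assume "k = 0"
        then have "strict r y x" using k(1) z(1) by simp
        then show False using y(2) WO_antisym[OF r] by blast
      qed
      then obtain k' where k': "k = Suc k'" by (cases k) auto
      then have "(z k', y) \<in> r" using k(2)[of k'] WO_not_less[OF r y(1) zF] by blast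
      then have "y \<in> block r n (z k')" using k(1) y(1) unfolding block_def k' z by blast
      then show "y \<in> (\<Union>k. block r n (z k))" by blast
    qed
  qed
  moreover have "before (strict r) (block r n (z i)) (block r n (z j))" if "i < j" for i j
    unfolding before_def
  proof (intro ballI)
    fix a b assume "a \<in> block r n (z i)" "b \<in> block r n (z j)"
    then have ab: "strict r a (z (Suc i))" "(z j, b) \<in> r" unfolding block_def z by blast+
    have "(z (Suc i), b) \<in> r" using z_le[of "Suc i" j] that ab(2) WO_trans[OF r] by (metis Suc_leI)
    then have "strict r a b" using ab(1) WO_less_le_trans[OF r] by blast
    then show "strict r a b \<and> \<not> strict r b a" using strict_asym[OF r] by blast
  qed
  moreover have "omega_power (strict r) n (block r n (z k))" for k by (rule Suc.IH[OF zF zl])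
  ultimately show ?case unfolding omega_power.simps ordered_sum_before by (intro exI[of _ "\<lambda>k. block r n (z k)"]) blast
qed

text \<open>Wanted is the greatest multiple of omega^n up to \<open>y\<close>, but a well-order
  supplies least elements. So take the least \<open>x\<close> after which no multiple occurs up to
  \<open>y\<close>. If \<open>x\<close> were not a multiple itself, multiples would accumulate at
  \<open>x\<close> and make it one.\<close>

lemma block_cover:
  assumes r: "Well_order r" and unb: "lim_unbounded r n" and y: "y \<in> Field r"
  obtains x where "x \<in> Field r" "lim_pt r n x" "y \<in> block r n x"
proof -
  let ?Z = "{z \<in> Field r. (z, y) \<in> r \<and> (\<forall>w\<in>Field r. strict r z w \<and> (w, y) \<in> r \<longrightarrow> \<not> lim_pt r n w)}"
  have "y \<in> ?Z" using y WO_refl[OF r] WO_antisym[OF r, of y] by blast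
  then obtain x where x: "x \<in> ?Z" "\<And>z. z \<in> ?Z \<Longrightarrow> (x, z) \<in> r" using WO_least[OF r, of ?Z] by blast
  have "lim_pt r n x"
  proof (rule ccontr)
    assume nl: "\<not> lim_pt r n x"
    have "lim_pt r (Suc n) x"
      unfolding lim_pt.simps
    proof (intro ballI impI)
      fix v assume v: "v \<in> Field r" "strict r v x"
      have "v \<notin> ?Z" using x(2)[of v] v(2) WO_antisym[OF r] by blast
      moreover have "(v, y) \<in> r" using v(2) x(1) WO_trans[OF r] by blast
      ultimately obtain w where w: "w \<in> Field r" "strict r v w" "(w, y) \<in> r" "lim_pt r n w" using v(1) by blast
      have "\<not> strict r x w" using x(1) w by blast
      then have "strict r w x" using strict_linear[OF r, of x w] x(1) w nl by auto
      then show "\<exists>z\<in>Field r. strict r v z \<and> strict r z x \<and> lim_pt r n z" using w by blast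
    qed
    then have "lim_pt r n x" by (rule lim_pt_Suc)
    then show False using nl by contradiction
  qed
  moreover have xF: "x \<in> Field r" using x(1) by blast
  moreover have "strict r y (next_lim r n x)"
  proof -
    note nx = next_lim[OF r unb xF]
    have "(next_lim r n x, y) \<notin> r" using nx(1-3) x(1) by blast
    then show ?thesis using WO_not_less[OF r y nx(1)] by blast
  qed
  ultimately show thesis using that x(1) y unfolding block_def by blast
qed

lemma blocks_ordered:
  assumes r: "Well_order r" and unb: "lim_unbounded r n"
  shows "ordered_sum (strict r) (strict r) {x \<in> Field r. lim_pt r n x} (block r n)"
  unfolding ordered_sum_def
proof (intro ballI impI)
  have less: "strict r a b" if "x \<in> Field r" "x' \<in> Field r" "lim_pt r n x'" "strict r x x'"
    "a \<in> block r n x" "b \<in> block r n x'" for x x' a b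
  proof -
    have "(next_lim r n x, x') \<in> r" by (rule next_lim(4)[OF r unb that(1,2,4,3)])
    moreover have "(x', b) \<in> r" "strict r a (next_lim r n x)" using that(5,6) unfolding block_def by blast+
    ultimately show ?thesis using WO_trans[OF r] WO_less_le_trans[OF r] by blast
  qed
  fix i j a b assume ij: "i \<in> {x \<in> Field r. lim_pt r n x}" "j \<in> {x \<in> Field r. lim_pt r n x}" "i \<noteq> j"
    and ab: "a \<in> block r n i" "b \<in> block r n j"
  have "strict r i j \<or> strict r j i" using strict_linear[OF r, of i j] ij by blast
  then show "strict r a b \<longleftrightarrow> strict r i j"
  proof
    assume "strict r i j"
    then show ?thesis using less[of i j a b] ij ab by blast
  next
    assume ji: "strict r j i"
    then have "strict r b a" using less[of j i b a] ij ab by blast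
    then show ?thesis using ji strict_asym[OF r] by blast
  qed
qed

section \<open>Cofinal sequences and the transfer of colorings\<close>

abbreviation lim_pts :: "'a rel \<Rightarrow> nat \<Rightarrow> 'a set" where
  "lim_pts r n \<equiv> {x \<in> Field r. lim_pt r n x}"

lemma blocks_disjoint:
  assumes r: "Well_order r" and unb: "lim_unbounded r n"
    and "i \<in> lim_pts r n" "j \<in> lim_pts r n" "x \<in> block r n i" "x \<in> block r n j"
  shows "i = j"
proof (rule ccontr)
  assume "i \<noteq> j"
  have "strict r x x \<longleftrightarrow> strict r i j"
    by (rule ordered_sumD[OF blocks_ordered[OF r unb] assms(3,4) \<open>i \<noteq> j\<close> assms(5,6)])
  moreover have "strict r x x \<longleftrightarrow> strict r j i"
    by (rule ordered_sumD[OF blocks_ordered[OF r unb] assms(4,3) \<open>i \<noteq> j\<close>[symmetric] assms(6,5)])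
  ultimately show False using strict_linear[OF r, of i j] assms(3,4) \<open>i \<noteq> j\<close> by blast
qed

section \<open>Prescribing the type of a run of blocks\<close>

context types
begin

lemma realize_blocks:
  assumes d: "0 < d" and r: "Well_order r" and unb: "\<And>n. lim_unbounded r n"
    and N: "set_mult (power_types N) (power_types N) = power_types N" "set_omega (power_types N) = power_types N"
    and K: "K \<subseteq> lim_pts r N" "m \<in> K" "\<And>j. j \<in> K \<Longrightarrow> (j, m) \<in> r" and e: "e \<in> power_types N"
  shows "\<exists>c. (\<forall>x. c x < d) \<and> tp d (strict r) c q (\<Union>(block r N ` K)) = e"
proof -
  note ST = power_types_subset[of N]
  have op: "omega_power (strict r) N (block r N k)" if "k \<in> K" for k
    by (rule block_omega_power[OF r unb]) (use K(1) that in blast)+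
  have KF: "K \<subseteq> Field r" "K \<noteq> {}" using K by blast+
  obtain k0 where k0: "k0 \<in> K" "\<And>j. j \<in> K \<Longrightarrow> (k0, j) \<in> r" using WO_least[OF r KF] by blast
  show ?thesis
  proof (cases "k0 = m")
    case True
    then have "K = {m}" using k0 K(2,3) WO_antisym[OF r] by blast
    then show ?thesis using omega_power_realize[OF op[OF K(2)] e] by simp
  next
    case False
    obtain a t b where abt: "a \<in> power_types N" "t \<in> power_types N" "b \<in> power_types N" "tp_mult t t = t" "tp_omega (\<lambda>_. t) = t" "e = tp_mult (tp_mult a t) b"
      by (rule factor_through_fixed_type[OF ST N e])
    have at: "tp_mult a t \<in> power_types N" using N(1) abt(1,2) unfolding set_mult_def by blast
    have realizable: "a \<in> realizable" "t \<in> realizable" "b \<in> realizable" "tp_mult a t \<in> realizable" using abt(1-3) at ST by blast+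
    \<comment> \<open>The first block gets \<open>a t\<close> instead of \<open>a\<close>, so that
      the run without its last block has type \<open>a t\<close> whether or not there are blocks in
      the middle.\<close>
    define g where "g k = (if k = k0 then tp_mult a t else if k = m then b else t)" for k
    have gS: "g k \<in> power_types N" for k using abt at by (simp add: g_def)
    obtain c where c: "\<And>x. c x < d" "\<And>k. k \<in> K \<Longrightarrow> tp d (strict r) c q (block r N k) = g k"
    proof (rule combine_colorings[OF d])
      show "i = j" if "i \<in> K" "j \<in> K" "x \<in> block r N i" "x \<in> block r N j" for i j x
        using blocks_disjoint[OF r unb _ _ that(3,4)] that(1,2) K(1) by blast
      show "\<exists>c. (\<forall>x. c x < d) \<and> tp d (strict r) c q (block r N k) = g k" if "k \<in> K" for k
        by (rule omega_power_realize[OF op[OF that] gS])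
    next
      fix c assume "\<And>x. c x < d" "\<And>k. k \<in> K \<Longrightarrow> tp d (strict r) c q (block r N k) = g k"
      then show thesis by (rule that)
    qed
    let ?M = "K - {k0, m}"
    have M: "strict r k0 j" "strict r j m" if "j \<in> ?M" for j using k0(2) K(3) that by auto
    have k0m: "strict r k0 m" using False K(3) k0(1) by auto
    note X = blocks_ordered[OF r unb[of N]]
    have init: "tp d (strict r) c q (block r N k0 \<union> \<Union>(block r N ` ?M)) = tp_mult a t"
    proof (cases "?M = {}")
      case True
      then show ?thesis unfolding True using c(2)[OF k0(1)] by (simp add: g_def)
    next
      case ne: False
      \<comment> \<open>The singleton \<open>{t}\<close> is closed under products and
        omega-products, hence under well-ordered sums.\<close>
      have "tp d (strict r) c q (\<Union>(block r N ` ?M)) \<in> {t}"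
      proof (rule tp_sum_closed[OF r])
        show "ordered_sum (strict r) (strict r) ?M (block r N)"
          by (rule ordered_sum_mono[OF X]) (use K(1) in blast)+
        show "tp_omega f \<in> {t}" if "\<And>i. f i \<in> {t}" for f
        proof -
          have "f = (\<lambda>_. t)" using that by blast
          then show ?thesis using abt(5) by simp
        qed
        show "tp d (strict r) c q (block r N i) \<in> {t}" if "i \<in> ?M" for i
          using c(2)[of i] that by (simp add: g_def)
      qed (use KF ne realizable abt(4) in auto)
      then have Mt: "tp d (strict r) c q (\<Union>(block r N ` ?M)) = t" by simp
      have "before (strict r) (\<Union>(block r N ` {k0})) (\<Union>(block r N ` ?M))"
        by (rule before_UN_strict[OF r X]) (use K(1) k0(1) M in auto)
      then have "tp d (strict r) c q (block r N k0 \<union> \<Union>(block r N ` ?M)) = tp_mult (tp_mult a t) t"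
        by (intro tp_Un) (use c(2)[OF k0(1)] Mt realizable in \<open>simp_all add: g_def\<close>)
      also have "\<dots> = tp_mult a t" using realizable abt(4) by (simp add: tp_mult_assoc)
      finally show ?thesis .
    qed
    have "before (strict r) (\<Union>(block r N ` (insert k0 ?M))) (\<Union>(block r N ` {m}))"
      by (rule before_UN_strict[OF r X]) (use K(1,2) k0(1) M k0m in auto)
    then have bf: "before (strict r) (block r N k0 \<union> \<Union>(block r N ` ?M)) (block r N m)" by simp
    have "tp d (strict r) c q (block r N m) = b" using c(2)[OF K(2)] False by (simp add: g_def)
    then have "tp d (strict r) c q ((block r N k0 \<union> \<Union>(block r N ` ?M)) \<union> block r N m) = tp_mult (tp_mult a t) b"
      by (rule tp_Un[OF bf init _ realizable(4,3)])
    moreover have "(block r N k0 \<union> \<Union>(block r N ` ?M)) \<union> block r N m = \<Union>(block r N ` K)"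
      using k0(1) K(2) by blast
    ultimately have "tp d (strict r) c q (\<Union>(block r N ` K)) = e" using abt(6) by simp
    then show ?thesis using c(1) by blast
  qed
qed

end

text \<open>Recursion along \<kappa>: fewer than \<kappa> earlier values are not cofinal, so some
  point bounds them. The next value is a multiple of omega^n beyond that bound and beyond
  \<open>h i\<close>, where \<open>h\<close> enumerates a cofinal set of size \<kappa>.\<close>

lemma cofinal_sequence:
  fixes \<kappa> :: "'k rel" and r :: "'a rel"
  assumes r: "Well_order r" and unb: "lim_unbounded r n" and cf: "has_cofinality r \<kappa>"
  obtains g :: "'k \<Rightarrow> 'a" where "\<And>i. i \<in> Field \<kappa> \<Longrightarrow> g i \<in> lim_pts r n"
    "\<And>i j. i \<in> Field \<kappa> \<Longrightarrow> strict \<kappa> j i \<Longrightarrow> strict r (g j) (g i)"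
    "\<And>x. x \<in> Field r \<Longrightarrow> \<exists>i\<in>Field \<kappa>. (x, g i) \<in> r"
proof -
  have \<kappa>: "Card_order \<kappa>" and least: "\<And>K. cofinal_subset K r \<Longrightarrow> \<kappa> \<le>o |K|"
    using cf unfolding has_cofinality_def by blast+
  obtain K where K: "cofinal_subset K r" "|K| =o \<kappa>" using cf unfolding has_cofinality_def by blast
  have "|Field \<kappa>| =o |K|"
    using card_of_Field_ordIso[OF \<kappa>] K(2) ordIso_transitive ordIso_symmetric by blast
  then obtain h where h: "bij_betw h (Field \<kappa>) K" using card_of_ordIso by blast
  have wo: "Well_order \<kappa>" using \<kappa> by (rule card_order_on_well_order_on)
  \<comment> \<open>\<open>dependent_wf_choice\<close> demands a value at every \<open>i\<close>;
    the guard makes the requirement void outside \<open>Field \<kappa>\<close>.\<close>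
  define P where "P f i y \<longleftrightarrow> (i \<in> Field \<kappa> \<longrightarrow> y \<in> lim_pts r n \<and> (h i, y) \<in> r \<and>
    (\<forall>j. strict \<kappa> j i \<longrightarrow> strict r (f j) y))" for f i y
  have "\<exists>g. \<forall>i. P g i (g i)"
  proof (rule dependent_wf_choice[OF WO_wf[OF wo]])
    show "P f i y = P g i y" if "\<And>z. (z, i) \<in> \<kappa> - Id \<Longrightarrow> f z = g z" for f g i y
      using that unfolding P_def by auto
    show "\<exists>y. P f i y" if IH: "\<And>j. (j, i) \<in> \<kappa> - Id \<Longrightarrow> P f j (f j)" for i f
    proof (cases "i \<in> Field \<kappa>")
      case True
      let ?S = "f ` underS \<kappa> i"
      have SF: "?S \<subseteq> Field r"
      proof (rule image_subsetI)
        fix j assume "j \<in> underS \<kappa> i"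
        then have "(j, i) \<in> \<kappa> - Id" "j \<in> Field \<kappa>" unfolding underS_def Field_def by auto
        then show "f j \<in> Field r" using IH[of j] unfolding P_def by blast
      qed
      have "|?S| <o \<kappa>" using card_of_image card_of_underS[OF \<kappa> True] ordLeq_ordLess_trans by blast
      then have "\<not> cofinal_subset ?S r" using least not_ordLess_ordLeq by blast
      then obtain a where a: "a \<in> Field r" "\<And>b. b \<in> ?S \<Longrightarrow> (a, b) \<notin> r"
        using SF unfolding cofinal_subset_def by blast
      have lt_a: "strict r b a" if "b \<in> ?S" for b
      proof -
        have "b \<in> Field r" using that SF by blast
        then show ?thesis using WO_not_less[OF r _ a(1)] a(2)[OF that] by blast
      qed
      have hi: "h i \<in> Field r" using h True K(1) unfolding cofinal_subset_def bij_betw_def by blast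
      obtain m where m: "m \<in> Field r" "(a, m) \<in> r" "(h i, m) \<in> r"
        using strict_linear[OF r a(1) hi] WO_refl[OF r] a(1) hi by metis
      obtain y where y: "y \<in> Field r" "strict r m y" "lim_pt r n y"
        using unb m(1) unfolding lim_unbounded_def by blast
      have "strict r (f j) y" if "strict \<kappa> j i" for j
      proof -
        have "f j \<in> ?S" using that unfolding underS_def by blast
        then have "strict r (f j) m" using lt_a m(2) WO_less_le_trans[OF r] by blast
        then show ?thesis using y(2) WO_less_trans[OF r] by blast
      qed
      moreover have "(h i, y) \<in> r" using m(3) y(2) WO_trans[OF r] by blast
      ultimately show ?thesis using y(1,3) unfolding P_def by blast
    qed (simp add: P_def)
  qed
  then obtain g where g: "\<And>i. P g i (g i)" by blast
  show thesis
  proof (rule that[of g])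
    show "g i \<in> lim_pts r n" if "i \<in> Field \<kappa>" for i using g[of i] that unfolding P_def by blast
    show "strict r (g j) (g i)" if "i \<in> Field \<kappa>" "strict \<kappa> j i" for i j
      using g[of i] that unfolding P_def by blast
    show "\<exists>i\<in>Field \<kappa>. (x, g i) \<in> r" if x: "x \<in> Field r" for x
    proof -
      obtain b where b: "b \<in> K" "(x, b) \<in> r" using K(1) x unfolding cofinal_subset_def by blast
      then obtain i where i: "i \<in> Field \<kappa>" "h i = b" using h unfolding bij_betw_def by blast
      have "(b, g i) \<in> r" using g[of i] i unfolding P_def by blast
      then show ?thesis using i(1) b(2) WO_trans[OF r] by blast
    qed
  qed
qed

text \<open>The lower bound refers to all earlier \<open>g j\<close> because \<open>i\<close> may be
  a limit index, where \<open>g\<close> need not be continuous. The upper bound is attained for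
  increasing \<open>g\<close>: \<open>g i\<close> starts the last block of the piece.\<close>

definition starts :: "'a rel \<Rightarrow> nat \<Rightarrow> 'k rel \<Rightarrow> ('k \<Rightarrow> 'a) \<Rightarrow> 'k \<Rightarrow> 'a set" where
  "starts r n \<kappa> g i = {k \<in> lim_pts r n. (k, g i) \<in> r \<and> (\<forall>j. strict \<kappa> j i \<longrightarrow> strict r (g j) k)}"

definition piece :: "'a rel \<Rightarrow> nat \<Rightarrow> 'k rel \<Rightarrow> ('k \<Rightarrow> 'a) \<Rightarrow> 'k \<Rightarrow> 'a set" where
  "piece r n \<kappa> g i = \<Union>(block r n ` starts r n \<kappa> g i)"

text \<open>The block of a point goes to the least index \<open>i\<close> for which
  \<open>g i\<close> has reached the start of the block.\<close>

lemma UN_piece: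
  assumes r: "Well_order r" and unb: "lim_unbounded r n" and \<kappa>: "Well_order \<kappa>"
    and gF: "\<And>i. i \<in> Field \<kappa> \<Longrightarrow> g i \<in> lim_pts r n"
    and cof: "\<And>x. x \<in> Field r \<Longrightarrow> \<exists>i\<in>Field \<kappa>. (x, g i) \<in> r"
  shows "\<Union>(piece r n \<kappa> g ` Field \<kappa>) = Field r"
proof
  show "\<Union>(piece r n \<kappa> g ` Field \<kappa>) \<subseteq> Field r" unfolding piece_def block_def by blast
  show "Field r \<subseteq> \<Union>(piece r n \<kappa> g ` Field \<kappa>)"
  proof
    fix x assume "x \<in> Field r"
    then obtain k where k: "k \<in> Field r" "lim_pt r n k" "x \<in> block r n k" by (rule block_cover[OF r unb])
    let ?I = "{i \<in> Field \<kappa>. (k, g i) \<in> r}"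
    have "?I \<noteq> {}" using cof[OF k(1)] by blast
    then obtain i where i: "i \<in> ?I" "\<And>j. j \<in> ?I \<Longrightarrow> (i, j) \<in> \<kappa>"
      using WO_least[OF \<kappa>, of ?I] by blast
    have "strict r (g j) k" if j: "strict \<kappa> j i" for j
    proof -
      have "j \<in> Field \<kappa>" using j unfolding Field_def by blast
      moreover have "j \<notin> ?I" using i(2)[of j] j WO_antisym[OF \<kappa>] by blast
      ultimately have "(k, g j) \<notin> r" "g j \<in> Field r" using gF by blast+
      then show ?thesis using WO_not_less[OF r _ k(1)] by blast
    qed
    then have "k \<in> starts r n \<kappa> g i" using k i(1) unfolding starts_def by blast
    then show "x \<in> \<Union>(piece r n \<kappa> g ` Field \<kappa>)" using k(3) i(1) unfolding piece_def by blast
  qed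
qed

lemma pieces_before:
  assumes r: "Well_order r" and unb: "lim_unbounded r n" and ij: "strict \<kappa> i j"
  shows "before (strict r) (piece r n \<kappa> g i) (piece r n \<kappa> g j)"
  unfolding piece_def
proof (rule before_UN_strict[OF r blocks_ordered[OF r unb]])
  fix k l assume "k \<in> starts r n \<kappa> g i" "l \<in> starts r n \<kappa> g j"
  then have "(k, g i) \<in> r" "strict r (g i) l" using ij unfolding starts_def by blast+
  then show "strict r k l" by (rule WO_le_less_trans[OF r])
qed (auto simp: starts_def)

lemma pieces_ordered:
  assumes r: "Well_order r" and unb: "lim_unbounded r n" and \<kappa>: "Well_order \<kappa>"
  shows "ordered_sum (strict r) (strict \<kappa>) (Field \<kappa>) (piece r n \<kappa> g)"
  unfolding ordered_sum_def
proof (intro ballI impI)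
  fix i j x y assume ij: "i \<in> Field \<kappa>" "j \<in> Field \<kappa>" "i \<noteq> j"
    and xy: "x \<in> piece r n \<kappa> g i" "y \<in> piece r n \<kappa> g j"
  have "strict \<kappa> i j \<or> strict \<kappa> j i" using strict_linear[OF \<kappa> ij(1,2)] ij(3) by blast
  then show "strict r x y \<longleftrightarrow> strict \<kappa> i j"
  proof
    assume ij: "strict \<kappa> i j"
    have "strict r x y" using pieces_before[OF r unb ij, of g] xy unfolding before_def by simp
    then show ?thesis using ij by simp
  next
    assume ji: "strict \<kappa> j i"
    have "\<not> strict r x y" using pieces_before[OF r unb ji, of g] xy unfolding before_def by simp
    moreover have "\<not> strict \<kappa> i j" by (rule strict_asym[OF \<kappa> ji])
    ultimately show ?thesis by blast
  qed
qed

lemma pieces_disjoint: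
  assumes r: "Well_order r" and unb: "lim_unbounded r n" and \<kappa>: "Well_order \<kappa>"
    and ij: "i \<in> Field \<kappa>" "j \<in> Field \<kappa>" and x: "x \<in> piece r n \<kappa> g i" "x \<in> piece r n \<kappa> g j"
  shows "i = j"
proof (rule ccontr)
  assume "i \<noteq> j"
  then have "strict \<kappa> i j \<or> strict \<kappa> j i" using strict_linear[OF \<kappa> ij] by blast
  then show False
  proof
    assume ij: "strict \<kappa> i j"
    show False using pieces_before[OF r unb ij, of g] x unfolding before_def by auto
  next
    assume ji: "strict \<kappa> j i"
    show False using pieces_before[OF r unb ji, of g] x unfolding before_def by auto
  qed
qed

context types
begin

lemma transfer_coloring:
  assumes d: "0 < d" and r1: "Well_order r\<^sub>1" and r2: "Well_order r\<^sub>2"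
    and unb1: "\<And>n. lim_unbounded r\<^sub>1 n" and unb2: "\<And>n. lim_unbounded r\<^sub>2 n"
    and cf1: "has_cofinality r\<^sub>1 \<kappa>" and cf2: "has_cofinality r\<^sub>2 \<kappa>"
    and c: "\<And>x. x \<in> Field r\<^sub>1 \<Longrightarrow> c x < d"
  obtains c' where "\<And>x. c' x < d" "tp d (strict r\<^sub>1) c q (Field r\<^sub>1) = tp d (strict r\<^sub>2) c' q (Field r\<^sub>2)"
proof -
  have \<kappa>: "Well_order \<kappa>"
    using cf1 unfolding has_cofinality_def by (auto intro: card_order_on_well_order_on)
  obtain N where N: "set_omega (power_types N) = power_types N" "set_mult (power_types N) (power_types N) = power_types N" by (rule power_types_stable)
  obtain g where g: "\<And>i. i \<in> Field \<kappa> \<Longrightarrow> g i \<in> lim_pts r\<^sub>1 N"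
    "\<And>i j. i \<in> Field \<kappa> \<Longrightarrow> strict \<kappa> j i \<Longrightarrow> strict r\<^sub>1 (g j) (g i)"
    "\<And>x. x \<in> Field r\<^sub>1 \<Longrightarrow> \<exists>i\<in>Field \<kappa>. (x, g i) \<in> r\<^sub>1"
    using cofinal_sequence[OF r1 unb1 cf1] by blast
  obtain g' where g': "\<And>i. i \<in> Field \<kappa> \<Longrightarrow> g' i \<in> lim_pts r\<^sub>2 N"
    "\<And>i j. i \<in> Field \<kappa> \<Longrightarrow> strict \<kappa> j i \<Longrightarrow> strict r\<^sub>2 (g' j) (g' i)"
    "\<And>x. x \<in> Field r\<^sub>2 \<Longrightarrow> \<exists>i\<in>Field \<kappa>. (x, g' i) \<in> r\<^sub>2"
    using cofinal_sequence[OF r2 unb2 cf2] by blast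
  have e: "tp d (strict r\<^sub>1) c q (piece r\<^sub>1 N \<kappa> g i) \<in> power_types N" if i: "i \<in> Field \<kappa>" for i
    unfolding piece_def
  proof (rule tp_sum_closed[OF r1])
    have "g i \<in> starts r\<^sub>1 N \<kappa> g i"
      using g(1,2)[OF i] WO_refl[OF r1] unfolding starts_def by blast
    then show "starts r\<^sub>1 N \<kappa> g i \<noteq> {}" by blast
    show "ordered_sum (strict r\<^sub>1) (strict r\<^sub>1) (starts r\<^sub>1 N \<kappa> g i) (block r\<^sub>1 N)"
      by (rule ordered_sum_mono[OF blocks_ordered[OF r1 unb1]]) (auto simp: starts_def)
    show "tp_mult s t \<in> power_types N" if "s \<in> power_types N" "t \<in> power_types N" for s t using N(2) that unfolding set_mult_def by blast
    show "tp_omega f \<in> power_types N" if "\<And>i. f i \<in> power_types N" for f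
    proof -
      have "tp_omega f \<in> set_omega (power_types N)" unfolding set_omega_def using that by blast
      then show ?thesis using N(1) by simp
    qed
    show "tp d (strict r\<^sub>1) c q (block r\<^sub>1 N k) \<in> power_types N" if "k \<in> starts r\<^sub>1 N \<kappa> g i" for k
    proof (rule tp_omega_power[OF block_omega_power[OF r1 unb1]])
      show "c x < d" if "x \<in> block r\<^sub>1 N k" for x using c that unfolding block_def by blast
    qed (use that in \<open>auto simp: starts_def\<close>)
  qed (auto simp: starts_def power_types_subset[THEN subsetD])
  obtain c' where c': "\<And>x. c' x < d"
    "\<And>i. i \<in> Field \<kappa> \<Longrightarrow> tp d (strict r\<^sub>2) c' q (piece r\<^sub>2 N \<kappa> g' i) = tp d (strict r\<^sub>1) c q (piece r\<^sub>1 N \<kappa> g i)"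
  proof (rule combine_colorings[OF d])
    show "i = j" if "i \<in> Field \<kappa>" "j \<in> Field \<kappa>" "x \<in> piece r\<^sub>2 N \<kappa> g' i" "x \<in> piece r\<^sub>2 N \<kappa> g' j" for i j x
      by (rule pieces_disjoint[OF r2 unb2 \<kappa> that])
    show "\<exists>c'. (\<forall>x. c' x < d) \<and> tp d (strict r\<^sub>2) c' q (piece r\<^sub>2 N \<kappa> g' i) = tp d (strict r\<^sub>1) c q (piece r\<^sub>1 N \<kappa> g i)"
      if i: "i \<in> Field \<kappa>" for i
      unfolding piece_def[of r\<^sub>2]
    proof (rule realize_blocks[OF d r2 unb2 N(2,1) _ _ _ e[OF i]])
      show "g' i \<in> starts r\<^sub>2 N \<kappa> g' i"
        using g'(1,2)[OF i] WO_refl[OF r2] unfolding starts_def by blast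
    qed (auto simp: starts_def)
  next
    fix c' assume "\<And>x. c' x < d" "\<And>i. i \<in> Field \<kappa> \<Longrightarrow>
      tp d (strict r\<^sub>2) c' q (piece r\<^sub>2 N \<kappa> g' i) = tp d (strict r\<^sub>1) c q (piece r\<^sub>1 N \<kappa> g i)"
    then show thesis by (rule that)
  qed
  \<comment> \<open>Both decompositions are indexed by \<kappa>, so \<open>tp_sum\<close> applies:
    this is where the equality of the cofinalities is used.\<close>
  have "tp d (strict r\<^sub>1) c q (\<Union>(piece r\<^sub>1 N \<kappa> g ` Field \<kappa>)) = tp d (strict r\<^sub>2) c' q (\<Union>(piece r\<^sub>2 N \<kappa> g' ` Field \<kappa>))"
    by (rule tp_sum[OF pieces_ordered[OF r1 unb1 \<kappa>] pieces_ordered[OF r2 unb2 \<kappa>]]) (simp add: c'(2))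
  then have "tp d (strict r\<^sub>1) c q (Field r\<^sub>1) = tp d (strict r\<^sub>2) c' q (Field r\<^sub>2)"
    using UN_piece[OF r1 unb1 \<kappa> g(1,3)] UN_piece[OF r2 unb2 \<kappa> g'(1,3)] by simp
  then show thesis using that c'(1) by blast
qed

end

section \<open>Color functions, and the theorem\<close>

lemma colored_ordinal_coloring:
  assumes "colored_ordinal d \<AA>"
  obtains c where "\<And>x. x \<in> Field (ord \<AA>) \<Longrightarrow> c x < d"
    "\<And>x i. x \<in> Field (ord \<AA>) \<Longrightarrow> i < d \<Longrightarrow> x \<in> color \<AA> i \<longleftrightarrow> c x = i"
proof -
  have "\<forall>x\<in>Field (ord \<AA>). \<exists>i<d. x \<in> color \<AA> i"
    using assms unfolding colored_ordinal_def by blast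
  then obtain c where c: "\<And>x. x \<in> Field (ord \<AA>) \<Longrightarrow> c x < d \<and> x \<in> color \<AA> (c x)" by metis
  have "c x = i" if "x \<in> Field (ord \<AA>)" "i < d" "x \<in> color \<AA> i" for x i
    using assms c[OF that(1)] that unfolding colored_ordinal_def disjoint_family_on_def by blast
  then show thesis using that[of c] c by blast
qed

theorem theorem11:
  fixes d :: nat and \<kappa> :: "'k rel" and \<gamma>\<^sub>1 :: "'a rel" and \<gamma>\<^sub>2 :: "'b rel"
  assumes "d \<ge> 1"
    and "Cinfinite \<kappa>" and "regularCard \<kappa>"
    and "Well_order \<gamma>\<^sub>1" and "Well_order \<gamma>\<^sub>2"
    and "elem_equiv \<gamma>\<^sub>1 omega_omega" and "elem_equiv \<gamma>\<^sub>2 omega_omega"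
    and "has_cofinality \<gamma>\<^sub>1 \<kappa>" and "has_cofinality \<gamma>\<^sub>2 \<kappa>"
  shows "\<forall>q. \<forall>\<AA> :: 'c colored. colored_ordinal d \<AA> \<and> ord \<AA> =o \<gamma>\<^sub>1 \<longrightarrow>
    (\<exists>\<BB> :: 'b colored. colored_ordinal d \<BB> \<and> ord \<BB> =o \<gamma>\<^sub>2 \<and> equiv_upto d q \<AA> \<BB>)"
proof (intro allI impI)
  fix q and \<AA> :: "'c colored"
  assume A: "colored_ordinal d \<AA> \<and> ord \<AA> =o \<gamma>\<^sub>1"
  let ?r = "ord \<AA>"
  have wo: "Well_order ?r" using A unfolding colored_ordinal_def by blast
  obtain c where c: "\<And>x. x \<in> Field ?r \<Longrightarrow> c x < d"
    "\<And>x i. x \<in> Field ?r \<Longrightarrow> i < d \<Longrightarrow> x \<in> color \<AA> i \<longleftrightarrow> c x = i"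
    using colored_ordinal_coloring[of d \<AA>] A by blast
  \<comment> \<open>The coloring is carried over to \<open>\<gamma>\<^sub>1\<close>, since
    cofinality and elementary equivalence are assumed for that relation and not for its isomorphic
    copy.\<close>
  obtain h where h: "bij_betw h (Field ?r) (Field \<gamma>\<^sub>1)"
    "\<And>x y. x \<in> Field ?r \<Longrightarrow> y \<in> Field ?r \<Longrightarrow> (x, y) \<in> ?r \<longleftrightarrow> (h x, h y) \<in> \<gamma>\<^sub>1"
    using A unfolding ordIso_def iso_iff2 by blast
  define c\<^sub>1 where "c\<^sub>1 y = c (inv_into (Field ?r) h y)" for y
  have hinj: "inj_on h (Field ?r)" using h(1) by (rule bij_betw_imp_inj_on)
  have c1: "c\<^sub>1 (h x) = c x" if "x \<in> Field ?r" for x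
    using inv_into_f_f[OF hinj that] by (simp add: c\<^sub>1_def)
  have tp1: "tp d (strict ?r) c q (Field ?r) = tp d (strict \<gamma>\<^sub>1) c\<^sub>1 q (Field \<gamma>\<^sub>1)"
  proof (rule tp_iso[OF h(1)])
    show "c x = c\<^sub>1 (h x)" if "x \<in> Field ?r" for x using c1[OF that] by simp
    show "strict ?r x y \<longleftrightarrow> strict \<gamma>\<^sub>1 (h x) (h y)" if "x \<in> Field ?r" "y \<in> Field ?r" for x y
      using h(2)[OF that] inj_on_eq_iff[OF hinj that] by blast
  qed
  have c1d: "c\<^sub>1 y < d" if "y \<in> Field \<gamma>\<^sub>1" for y
  proof -
    have "y \<in> h ` Field ?r" using that bij_betw_imp_surj_on[OF h(1)] by simp
    then obtain x where "x \<in> Field ?r" "y = h x" by (rule imageE)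
    then show ?thesis using c1[of x] c(1)[of x] by simp
  qed
  have d: "0 < d" using assms(1) by simp
  obtain c\<^sub>2 where c2: "\<And>x. c\<^sub>2 x < d" "tp d (strict \<gamma>\<^sub>1) c\<^sub>1 q (Field \<gamma>\<^sub>1) = tp d (strict \<gamma>\<^sub>2) c\<^sub>2 q (Field \<gamma>\<^sub>2)"
  proof (rule types.transfer_coloring[where q = q, OF d assms(4,5) elem_equiv_unbounded[OF assms(6)]
        elem_equiv_unbounded[OF assms(7)] assms(8,9) c1d])
    fix c' assume "\<And>x. c' x < d"
      "tp d (strict \<gamma>\<^sub>1) c\<^sub>1 q (Field \<gamma>\<^sub>1) = tp d (strict \<gamma>\<^sub>2) c' q (Field \<gamma>\<^sub>2)"
    then show thesis by (rule that)
  qed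
  let ?B = "\<lparr>ord = \<gamma>\<^sub>2, color = \<lambda>i. {x \<in> Field \<gamma>\<^sub>2. c\<^sub>2 x = i}\<rparr>"
  have "colored_ordinal d ?B"
    unfolding colored_ordinal_def disjoint_family_on_def using assms(5) c2(1) by auto
  moreover have "ord ?B =o \<gamma>\<^sub>2" using ordIso_reflexive[OF assms(5)] by simp
  moreover have "equiv_upto d q \<AA> ?B"
    by (rule tp_eq_imp_equiv_upto[where c = c and c' = c\<^sub>2]) (use wo assms(5) c(2) tp1 c2(2) in simp_all)
  ultimately show "\<exists>\<BB> :: 'b colored. colored_ordinal d \<BB> \<and> ord \<BB> =o \<gamma>\<^sub>2 \<and> equiv_upto d q \<AA> \<BB>"
    by blast
qed

end
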